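(* Let $n, k, m$ be nonnegative integers with $0\leq k \leq n$, and let $\lambda \coloneqq (n,n-1,\ldots,1) + (k,k-1,\ldots,1)$ (componentwise sum, where $(k,k-1,\ldots,1)$ is padded with zeros to length $n$), the shifted double staircase shape. Then \[\#\mathcal{SPP}^{m}(\lambda) = \prod_{1\leq i \leq j \leq n} \frac{m+i+j-1}{i+j-1} \prod_{1\leq i \leq j \leq k} \frac{m+i+j}{i+j},\] where empty products equal $1$.
   Context: For a strict partition $\lambda=(\lambda_1>\lambda_2>\cdots>\lambda_\ell>0)$, its shifted Young diagram consists of $\ell$ rows of boxes, row $i$ having $\lambda_i$ boxes, with each row indented one position to the right relative to the row above it (so row $i$ occupies columns $i, i+1, \ldots, i+\lambda_i-1$). A (shifted) plane partition of shifted shape $\lambda$ is a filling of the boxes of the shifted Young diagram of $\lambda$ with nonnegative integers that is weakly decreasing along each row (left to right) and down each column (top to bottom). $\mathcal{SPP}^m(\lambda)$ denotes the set of such plane partitions all of whose entries are at most $m$. *)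

theory Defs
  imports Complex_Main "HOL-Library.FuncSet"
begin

definition strict_partition :: "nat list \<Rightarrow> bool" where
  "strict_partition lam \<longleftrightarrow> sorted_wrt (>) lam \<and> 0 \<notin> set lam"

text \<open>Rows and columns are numbered from 1, so the part belonging to row i is
  \<open>lam ! (i - 1)\<close>.  A box is a pair (row, column).\<close>

definition shifted_diagram :: "nat list \<Rightarrow> (nat \<times> nat) set" where
  "shifted_diagram lam =
     {(i, j). 1 \<le> i \<and> i \<le> length lam \<and> i \<le> j \<and> j < i + lam ! (i - 1)}"

text \<open>A filling is a function on the diagram; it is made extensional (via \<open>PiE\<close>)
  so that distinct functions are distinct fillings.\<close>

definition shifted_plane_partitions :: "nat list \<Rightarrow> (nat \<times> nat \<Rightarrow> nat) set" where
  "shifted_plane_partitions lam =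
     {p \<in> shifted_diagram lam \<rightarrow>\<^sub>E UNIV.
        (\<forall>i j j'. (i, j) \<in> shifted_diagram lam \<longrightarrow> (i, j') \<in> shifted_diagram lam \<longrightarrow>
           j \<le> j' \<longrightarrow> p (i, j') \<le> p (i, j)) \<and>
        (\<forall>i i' j. (i, j) \<in> shifted_diagram lam \<longrightarrow> (i', j) \<in> shifted_diagram lam \<longrightarrow>
           i \<le> i' \<longrightarrow> p (i', j) \<le> p (i, j))}"

definition SPP :: "nat \<Rightarrow> nat list \<Rightarrow> (nat \<times> nat \<Rightarrow> nat) set" where
  "SPP m lam =
     {p \<in> shifted_plane_partitions lam. \<forall>b \<in> shifted_diagram lam. p b \<le> m}"

definition staircase :: "nat \<Rightarrow> nat list" where
  "staircase n = rev [1..<Suc n]"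

definition shifted_double_staircase :: "nat \<Rightarrow> nat \<Rightarrow> nat list" where
  "shifted_double_staircase n k =
     map2 (+) (staircase n) (staircase k @ replicate (n - k) 0)"

lemma length_shifted_double_staircase:
  "k \<le> n \<Longrightarrow> length (shifted_double_staircase n k) = n"
  by (simp add: shifted_double_staircase_def staircase_def del: upt_Suc)

lemma nth_shifted_double_staircase:
  assumes "k \<le> n" "i < n"
  shows "shifted_double_staircase n k ! i = (n - i) + (k - i)"
proof -
  have "(staircase k @ replicate (n - k) 0) ! i = k - i"
    using assms by (auto simp: staircase_def nth_append rev_nth simp del: upt_Suc)
  then show ?thesis
    using assms
    by (simp add: shifted_double_staircase_def staircase_def rev_nth del: upt_Suc)
qed

lemma strict_partition_shifted_double_staircase:
  assumes "k \<le> n"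
  shows "strict_partition (shifted_double_staircase n k)"
  unfolding strict_partition_def
  using assms
  by (auto simp: sorted_wrt_iff_nth_less in_set_conv_nth
      length_shifted_double_staircase nth_shifted_double_staircase)

end

theory Submission
  imports Defs "HOL-Computational_Algebra.Polynomial"
begin

text \<open>
  A filling of the shifted double staircase is the same as the sequence of its diagonals, which
  interlace; read from the outside in, their lengths are
  \<open>0, 1, 1, 2, 2, \<dots>, k, k, k + 1, \<dots>, n\<close>.
  Weighting a step by a power of a variable turns the number of chains ending in a given main
  diagonal into a determinant: the first \<open>2 k\<close> steps build a symplectic character in
  \<open>z 0, \<dots>, z (k - 1)\<close>, and each of the other \<open>n - k\<close> steps is a branching step of the general
  linear group with a new variable.  Expanding the \<open>k\<close> symplectic rows
  \<open>z\<^sup>v - z\<^sup>-\<^sup>v\<close>, the sum over all main diagonals bounded by \<open>m\<close> is given termwise by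
  Macdonald's bounded version of Littlewood's identity, whose numerator changes only by a monomial
  under \<open>z i \<mapsto> 1 / z i\<close>.  It therefore factors out (the odd orthogonal character of the
  \<open>n\<close>-fold rectangle), all factors that mix the two kinds of variables cancel, and the remaining
  sum over sign changes is the symplectic character of a rectangle of \<open>k\<close> rows.  At
  \<open>z i = exp (2 (i + 1) t)\<close> both become products of hyperbolic sines.  The factors independent of
  \<open>m\<close> are removed by dividing by the case \<open>m = 0\<close>, and \<open>t \<longlongrightarrow> 0\<close> gives the count.
\<close>

subsection \<open>Alternants as Laplace expansions\<close>

text \<open>The determinant formulas fail at the point of interest, where all variables are 1: a
  branching step with a new variable \<open>w\<close> multiplies the powers of an old variable
  \<open>y\<close> by \<open>w / (y - w)\<close>. So the variables are kept distinct and above 1,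
  where no inverse meets another variable, and 1 is reached only in the limit, which the weights
  themselves survive because they are finite sums. The constants in these formulas are never
  evaluated; it suffices that they depend neither on the main diagonal nor on \<open>m\<close>, so
  that the same constant occurs for \<open>m\<close> and for 0. Branching factors and Macdonald's
  denominators combine to factors which, apart from monomials and a Vandermonde product, depend on
  \<open>y + 1 / y\<close> only, so sign changes leave them alone. The arithmetic progression of
  exponents is the principal specialization: row \<open>i\<close> becomes a polynomial of degree
  \<open>i\<close> in a hyperbolic cosine attached to the column. Throughout, rows are indexed by a
  set and columns form a list, so minors need no renumbering, and \<open>alt\<close> is 0 if the two
  sizes differ.\<close>

fun alt :: "nat set \<Rightarrow> (nat \<Rightarrow> real) list \<Rightarrow> real" where
  "alt A [] = (if A = {} then 1 else 0)"
| "alt A (c # cs) = (\<Sum>i\<in>A. (-1) ^ card {j \<in> A. j < i} * c i * alt (A - {i}) cs)"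

lemma alt_cong:
  assumes "finite A" "length cs = length ds" "\<And>m i. m < length cs \<Longrightarrow> i \<in> A \<Longrightarrow> (cs ! m) i = (ds ! m) i"
  shows "alt A cs = alt A ds"
  using assms(2,1,3)
proof (induction cs ds arbitrary: A rule: list_induct2)
  case (Cons c cs d ds)
  have "c i = d i" if "i \<in> A" for i
    using Cons.prems(2)[of 0 i] that by simp
  moreover have "alt (A - {i}) cs = alt (A - {i}) ds" if "i \<in> A" for i
    using Cons.prems(2)[of "Suc _"] Cons.prems(1) by (intro Cons.IH) auto
  ultimately show ?case by simp
qed simp

lemma alt_map_cong:
  assumes "finite A" "\<And>v i. v \<in> set l \<Longrightarrow> i \<in> A \<Longrightarrow> f v i = g v i"
  shows "alt A (map f l) = alt A (map g l)"
  using assms by (intro alt_cong) auto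

lemma alt_scale_rows:
  assumes "finite A"
  shows "alt A (map (\<lambda>v i. s i * f v i) l) = (\<Prod>i\<in>A. s i) * alt A (map f l)"
  using assms
proof (induction l arbitrary: A)
  case (Cons v l)
  have "alt A (map (\<lambda>v i. s i * f v i) (v # l)) =
      (\<Sum>i\<in>A. (-1) ^ card {j \<in> A. j < i} * (s i * f v i) * ((\<Prod>i\<in>A - {i}. s i) * alt (A - {i}) (map f l)))"
    using Cons by simp
  also have "\<dots> = (\<Sum>i\<in>A. (\<Prod>i\<in>A. s i) * ((-1) ^ card {j \<in> A. j < i} * f v i * alt (A - {i}) (map f l)))"
    using Cons.prems by (intro sum.cong) (auto simp: prod.remove)
  finally show ?case by (simp add: sum_distrib_left)
qed auto

lemma alt_scale_cols:
  "alt A (map (\<lambda>v i. s v * f v i) l) = prod_list (map s l) * alt A (map f l)"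
  by (induction l arbitrary: A) (auto simp: sum_distrib_left mult_ac)

lemma alt_Cons_sum:
  "alt A ((\<lambda>i. \<Sum>v\<in>V. f v i) # cs) = (\<Sum>v\<in>V. alt A (f v # cs))"
  unfolding alt.simps sum_distrib_left sum_distrib_right by (rule sum.swap)

lemma sum_listset_Cons:
  "(\<Sum>m\<in>listset (R # Rs). f m) = (\<Sum>v\<in>R. \<Sum>m\<in>listset Rs. f (v # m))"
proof -
  have "listset (R # Rs) = (\<lambda>(v, m). v # m) ` (R \<times> listset Rs)"
    by (auto simp: set_Cons_def)
  moreover have "inj_on (\<lambda>(v, m). v # m) (R \<times> listset Rs)"
    by (auto simp: inj_on_def)
  ultimately show ?thesis
    by (simp add: sum.reindex sum.cartesian_product split_def)
qed

text \<open>Multilinearity in the columns. Once a diagonal is fixed, interlacing confines each part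
  of the next one to its own interval, so a sum over interlacing lists has this form and stays a
  determinant.\<close>

lemma sum_listset_alt:
  "(\<Sum>m\<in>listset Rs. alt A (map f m)) = alt A (map (\<lambda>R i. \<Sum>v\<in>R. f v i) Rs)"
proof (induction Rs arbitrary: A)
  case (Cons R Rs)
  have "(\<Sum>m\<in>listset (R # Rs). alt A (map f m)) =
      (\<Sum>v\<in>R. \<Sum>i\<in>A. (-1) ^ card {j \<in> A. j < i} * f v i * (\<Sum>m\<in>listset Rs. alt (A - {i}) (map f m)))"
    unfolding sum_listset_Cons
    by (auto simp: sum_distrib_left intro!: sum.cong sum.swap)
  then show ?case
    using alt_Cons_sum[of A f R] by (simp add: Cons.IH)
qed simp

lemma alt_Cons_diff: "alt A ((\<lambda>i. c i - d i) # cs) = alt A (c # cs) - alt A (d # cs)"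
  by (simp add: algebra_simps sum_subtractf)

lemma alt_swap:
  assumes "finite A"
  shows "alt A (c # d # cs) = - alt A (d # c # cs)"
proof -
  define s where "s A i = ((-1) ^ card {j \<in> A. j < i} :: real)" for A and i :: nat
  \<comment> \<open>Deleting \<open>i\<close> lowers the rank of the larger index \<open>j\<close>
    by one, whereas deleting \<open>j\<close> leaves the rank of \<open>i\<close> alone; hence the
    sign.\<close>
  have s: "s A i * s (A - {i}) j = - (s A j * s (A - {j}) i)" if "i \<in> A" "j \<in> A" "i < j" for i j
  proof -
    have "{l \<in> A. l < j} = insert i {l \<in> A - {i}. l < j}"
      using that by auto
    then have "s A j = - s (A - {i}) j"
      using assms by (simp add: s_def)
    moreover have "{l \<in> A - {j}. l < i} = {l \<in> A. l < i}"
      using that by auto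
    ultimately show ?thesis by (simp add: s_def)
  qed
  have s': "s A i * s (A - {i}) j = - (s A j * s (A - {j}) i)" if "i \<in> A" "j \<in> A" "i \<noteq> j" for i j
    using s[of i j] s[of j i] that by (cases "i < j") auto
  have E: "alt A (c # d # cs) =
      (\<Sum>i\<in>A. \<Sum>j\<in>A. if i \<noteq> j then s A i * s (A - {i}) j * c i * d j * alt (A - {i} - {j}) cs else 0)" for c d
  proof -
    have "(\<Sum>j\<in>A. if i \<noteq> j then s A i * s (A - {i}) j * c i * d j * alt (A - {i} - {j}) cs else 0)
      = s A i * c i * alt (A - {i}) (d # cs)" if "i \<in> A" for i
    proof -
      have "(\<Sum>j\<in>A. if i \<noteq> j then s A i * s (A - {i}) j * c i * d j * alt (A - {i} - {j}) cs else 0)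
        = (\<Sum>j\<in>A - {i}. s A i * s (A - {i}) j * c i * d j * alt (A - {i} - {j}) cs)"
        using assms that by (simp add: sum.remove[of A i])
      also have "\<dots> = s A i * c i * alt (A - {i}) (d # cs)"
        by (simp add: sum_distrib_left s_def mult_ac)
      finally show ?thesis .
    qed
    then show ?thesis by (simp add: s_def)
  qed
  have "alt A (d # c # cs) =
      (\<Sum>j\<in>A. \<Sum>i\<in>A. if i \<noteq> j then s A i * s (A - {i}) j * d i * c j * alt (A - {i} - {j}) cs else 0)"
    unfolding E by (rule sum.swap)
  also have "\<dots> = (\<Sum>j\<in>A. \<Sum>i\<in>A. - (if j \<noteq> i then s A j * s (A - {j}) i * c j * d i * alt (A - {j} - {i}) cs else 0))"
  proof (intro sum.cong refl)
    fix i j assume "j \<in> A" "i \<in> A"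
    then show "(if i \<noteq> j then s A i * s (A - {i}) j * d i * c j * alt (A - {i} - {j}) cs else 0) =
       - (if j \<noteq> i then s A j * s (A - {j}) i * c j * d i * alt (A - {j} - {i}) cs else 0)"
      using s'[of i j] by (simp add: Diff_insert2[symmetric] insert_commute)
  qed
  also have "\<dots> = - alt A (c # d # cs)"
    unfolding E by (simp add: sum_negf)
  finally show ?thesis by simp
qed

lemma alt_repeated:
  assumes "finite A" "c \<in> set cs"
  shows "alt A (c # cs) = 0"
  using assms
proof (induction cs arbitrary: A)
  case (Cons d cs)
  show ?case
  proof (cases "d = c")
    case True
    then show ?thesis using alt_swap[OF Cons.prems(1), of c c cs] by simp
  next
    case False
    then have "alt (A - {i}) (c # cs) = 0" for i
      using Cons.prems by (intro Cons.IH) auto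
    then have "alt A (d # c # cs) = 0"
      by (simp only: alt.simps(2)[of A d]) simp
    then show ?thesis using alt_swap[OF Cons.prems(1), of c d cs] by simp
  qed
qed simp

subsection \<open>Vandermonde products\<close>

definition pair_prod :: "nat set \<Rightarrow> (nat \<Rightarrow> nat \<Rightarrow> real) \<Rightarrow> real" where
  "pair_prod A g = (\<Prod>(i, j)\<in>{(i, j). i \<in> A \<and> j \<in> A \<and> i < j}. g i j)"

definition vdm :: "nat set \<Rightarrow> (nat \<Rightarrow> real) \<Rightarrow> real" where
  "vdm A y = pair_prod A (\<lambda>i j. y i - y j)"

lemma finite_index_pairs [simp]:
  "finite A \<Longrightarrow> finite {(i, j). i \<in> A \<and> j \<in> A \<and> i < (j :: nat)}"
  by (rule finite_subset[of _ "A \<times> A"]) auto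

lemma pair_prod_empty [simp]: "pair_prod {} g = 1"
  by (simp add: pair_prod_def)

lemma pair_prod_cong:
  "(\<And>i j. i \<in> A \<Longrightarrow> j \<in> A \<Longrightarrow> i < j \<Longrightarrow> f i j = g i j) \<Longrightarrow> pair_prod A f = pair_prod A g"
  unfolding pair_prod_def by (intro prod.cong) auto

lemma pair_prod_mult: "pair_prod A (\<lambda>i j. f i j * g i j) = pair_prod A f * pair_prod A g"
  by (simp add: pair_prod_def split_def prod.distrib)

lemma pair_prod_divide: "pair_prod A (\<lambda>i j. f i j / g i j) = pair_prod A f / pair_prod A g"
  by (simp add: pair_prod_def split_def prod_dividef)

lemma pair_prod_nonzero:
  assumes "finite A" "\<And>i j. i \<in> A \<Longrightarrow> j \<in> A \<Longrightarrow> i < j \<Longrightarrow> g i j \<noteq> 0"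
  shows "pair_prod A g \<noteq> 0"
  using assms by (auto simp: pair_prod_def)

lemma pair_prod_Un:
  assumes "finite A" "finite B" "\<And>a b. a \<in> A \<Longrightarrow> b \<in> B \<Longrightarrow> a < b"
  shows "pair_prod (A \<union> B) g = pair_prod A g * pair_prod B g * (\<Prod>a\<in>A. \<Prod>b\<in>B. g a b)"
proof -
  let ?P = "\<lambda>A. {(i, j). i \<in> A \<and> j \<in> A \<and> i < (j :: nat)}"
  have "?P (A \<union> B) = (?P A \<union> ?P B) \<union> A \<times> B"
    using assms(3) by (auto dest: less_asym)
  moreover have "(?P A \<union> ?P B) \<inter> A \<times> B = {}" "?P A \<inter> ?P B = {}"
    using assms(3) by force+
  ultimately show ?thesis
    using assms(1,2) by (simp add: pair_prod_def prod.union_disjoint prod.cartesian_product)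
qed

lemma pair_prod_remove:
  assumes "finite A" "i \<in> A"
  shows "pair_prod A g =
    (\<Prod>j\<in>{j \<in> A. j < i}. g j i) * (\<Prod>j\<in>{j \<in> A. i < j}. g i j) * pair_prod (A - {i}) g"
proof -
  let ?P = "\<lambda>A. {(i, j). i \<in> A \<and> j \<in> A \<and> i < (j :: nat)}"
  have "?P A = ((\<lambda>j. (j, i)) ` {j \<in> A. j < i} \<union> (\<lambda>j. (i, j)) ` {j \<in> A. i < j}) \<union> ?P (A - {i})"
    using assms(2) by auto
  moreover have "(\<lambda>j. (j, i)) ` {j \<in> A. j < i} \<inter> (\<lambda>j. (i, j)) ` {j \<in> A. i < j} = {}"
    "((\<lambda>j. (j, i)) ` {j \<in> A. j < i} \<union> (\<lambda>j. (i, j)) ` {j \<in> A. i < j}) \<inter> ?P (A - {i}) = {}"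
    by auto
  moreover have "(\<Prod>p\<in>(\<lambda>j. (j, i)) ` {j \<in> A. j < i}. case p of (i, j) \<Rightarrow> g i j) = (\<Prod>j\<in>{j \<in> A. j < i}. g j i)"
    "(\<Prod>p\<in>(\<lambda>j. (i, j)) ` {j \<in> A. i < j}. case p of (i, j) \<Rightarrow> g i j) = (\<Prod>j\<in>{j \<in> A. i < j}. g i j)"
    by (simp_all add: prod.reindex inj_on_def)
  ultimately show ?thesis
    using assms(1) unfolding pair_prod_def by (simp add: prod.union_disjoint del: Diff_iff)
qed

lemma prod_remove_split:
  assumes "finite A" "i \<in> A"
  shows "(\<Prod>j\<in>A - {i}. h j) = (\<Prod>j\<in>{j \<in> A. j < i}. h j) * (\<Prod>j\<in>{j \<in> A. i < (j :: nat)}. h j)"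
proof -
  have "A - {i} = {j \<in> A. j < i} \<union> {j \<in> A. i < j}"
    by auto
  moreover have "{j \<in> A. j < i} \<inter> {j \<in> A. i < j} = {}"
    by auto
  ultimately show ?thesis
    using assms by (simp add: prod.union_disjoint)
qed

lemma pair_prod_sym_remove:
  assumes "finite A" "i \<in> A" "\<And>i j. g i j = g j i"
  shows "pair_prod A g = (\<Prod>j\<in>A - {i}. g i j) * pair_prod (A - {i}) g"
  using assms by (simp add: pair_prod_remove[of A i] prod_remove_split[of A i])

lemma vdm_remove:
  assumes "finite A" "i \<in> A"
  shows "vdm A y = (-1) ^ card {j \<in> A. j < i} * (\<Prod>j\<in>A - {i}. y i - y j) * vdm (A - {i}) y"
proof -
  have "(\<Prod>j\<in>{j \<in> A. j < i}. y j - y i) = (\<Prod>j\<in>{j \<in> A. j < i}. (-1) * (y i - y j))"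
    by (intro prod.cong) auto
  also have "\<dots> = (-1) ^ card {j \<in> A. j < i} * (\<Prod>j\<in>{j \<in> A. j < i}. y i - y j)"
    by (subst prod.distrib) simp
  finally show ?thesis
    using assms by (simp add: vdm_def pair_prod_remove[of A i] prod_remove_split[of A i])
qed

text \<open>By the degree bound \<open>P\<close> equals its Lagrange interpolant at the nodes
  \<open>X\<close>. The basis products are monic of degree \<open>card X - 1\<close>, so the sum is
  the coefficient at that degree.\<close>

lemma lagrange_leading_coeff:
  fixes X :: "real set"
  assumes "finite X" "X \<noteq> {}" "degree P < card X"
  shows "(\<Sum>x\<in>X. poly P x / (\<Prod>y\<in>X - {x}. x - y)) = coeff P (card X - 1)"
proof -
  define b where "b x = (\<Prod>y\<in>X - {x}. [:- y, 1:])" for x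
  define L where "L = (\<Sum>x\<in>X. smult (poly P x / (\<Prod>y\<in>X - {x}. x - y)) (b x))"
  have deg: "degree (b x) = card X - 1" if "x \<in> X" for x
    using that assms(1) by (simp add: b_def degree_prod_eq_sum_degree)
  have lc: "coeff (b x) (card X - 1) = 1" if "x \<in> X" for x
    using lead_coeff_prod[of "\<lambda>y. [:- y, 1:]" "X - {x}"] deg[OF that] by (simp add: b_def)
  have "poly L z = poly P z" if "z \<in> X" for z
  proof -
    have "poly (b x) z = 0" if "x \<in> X - {z}" for x
      using that \<open>z \<in> X\<close> assms(1) by (auto simp: b_def poly_prod)
    then have "poly L z = poly P z / (\<Prod>y\<in>X - {z}. z - y) * poly (b z) z"
      using \<open>z \<in> X\<close> assms(1) by (simp add: L_def poly_sum sum.remove[of X z])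
    also have "poly (b z) z = (\<Prod>y\<in>X - {z}. z - y)"
      by (simp add: b_def poly_prod)
    also have "(\<Prod>y\<in>X - {z}. z - y) \<noteq> 0"
      using assms(1) by simp
    ultimately show ?thesis by simp
  qed
  moreover have "degree L < card X"
  proof -
    have "degree L \<le> card X - 1"
      unfolding L_def using deg assms(1) by (intro degree_sum_le) (auto intro: order.trans[OF degree_smult_le])
    then show ?thesis
      using assms(1,2) by (metis Suc_pred' card_gt_0_iff le_imp_less_Suc)
  qed
  ultimately have "L = P"
    using assms(3) by (intro poly_eqI_degree[of X]) auto
  moreover have "coeff L (card X - 1) = (\<Sum>x\<in>X. poly P x / (\<Prod>y\<in>X - {x}. x - y))"
    unfolding L_def coeff_sum by (intro sum.cong) (simp_all add: lc del: One_nat_def)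
  ultimately show ?thesis by simp
qed

lemma lagrange_leading_coeff_inj:
  fixes y :: "'i \<Rightarrow> real"
  assumes "finite I" "I \<noteq> {}" "inj_on y I" "degree P < card I"
  shows "(\<Sum>i\<in>I. poly P (y i) / (\<Prod>j\<in>I - {i}. y i - y j)) = coeff P (card I - 1)"
proof -
  have "(\<Prod>w\<in>y ` I - {y i}. y i - w) = (\<Prod>j\<in>I - {i}. y i - y j)" if "i \<in> I" for i
  proof -
    have "y ` I - {y i} = y ` (I - {i})"
      using that assms(3) by (auto simp: inj_on_def)
    then show ?thesis
      using assms(3) by (simp add: prod.reindex inj_on_diff)
  qed
  then show ?thesis
    using lagrange_leading_coeff[of "y ` I" P] assms
    by (simp add: card_image sum.reindex)
qed

text \<open>Vandermonde's determinant. Expanding along the column of the highest power and dividing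
  by \<open>vdm A y\<close> leaves the interpolation identity for the monomial of degree
  \<open>card A - 1\<close>. The exponents descend so that no sign appears.\<close>

lemma alt_powers:
  assumes "finite A" "inj_on y A"
  shows "alt A (map (\<lambda>j i. y i ^ j) (rev [0..<card A])) = vdm A y"
  using assms
proof (induction "card A" arbitrary: A)
  case 0
  then show ?case by (simp add: vdm_def)
next
  case (Suc n)
  then have ne: "A \<noteq> {}" by auto
  have IH: "alt (A - {i}) (map (\<lambda>j i. y i ^ j) (rev [0..<n])) = vdm (A - {i}) y" if "i \<in> A" for i
  proof -
    have "n = card (A - {i})"
      using Suc.hyps(2) Suc.prems that by simp
    then show ?thesis
      using Suc.hyps(1)[of "A - {i}"] Suc.prems by (simp add: inj_on_diff)
  qed
  have nz: "(\<Prod>j\<in>A - {i}. y i - y j) \<noteq> 0" if "i \<in> A" for i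
    using Suc.prems that by (auto simp: inj_on_def)
  have "alt A (map (\<lambda>j i. y i ^ j) (rev [0..<card A])) =
      (\<Sum>i\<in>A. (-1) ^ card {j \<in> A. j < i} * y i ^ n * vdm (A - {i}) y)"
    unfolding Suc.hyps(2)[symmetric] using IH by simp
  also have "\<dots> = (\<Sum>i\<in>A. vdm A y * (poly (monom 1 n) (y i) / (\<Prod>j\<in>A - {i}. y i - y j)))"
  proof (intro sum.cong refl)
    fix i assume "i \<in> A"
    then show "(-1) ^ card {j \<in> A. j < i} * y i ^ n * vdm (A - {i}) y =
        vdm A y * (poly (monom 1 n) (y i) / (\<Prod>j\<in>A - {i}. y i - y j))"
      using nz[of i] Suc.prems by (subst vdm_remove[of A i]) (auto simp: poly_monom)
  qed
  also have "\<dots> = vdm A y"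
  proof -
    have "degree (monom 1 n :: real poly) < card A" "card A - 1 = n"
      using Suc.hyps(2) by (simp_all add: degree_monom_eq)
    then have "(\<Sum>i\<in>A. poly (monom 1 n) (y i) / (\<Prod>j\<in>A - {i}. y i - y j)) = 1"
      using lagrange_leading_coeff_inj[of A y "monom 1 n"] Suc.prems ne by simp
    then show ?thesis
      by (simp only: sum_distrib_left[symmetric] mult_1_right)
  qed
  finally show ?case .
qed

text \<open>Here the points index the columns and the polynomials the rows. As a polynomial in the
  first point, the determinant has at most as large a degree as there are other points, vanishes at
  all of these, and has the signed minor without the last row as top coefficient. The signs
  \<open>(-1) ^ i\<close> arise because the degrees increase down the rows.\<close>

lemma alt_monic_polys:
  assumes "distinct xs" "\<And>i. i < length xs \<Longrightarrow> degree (p i) = i"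
    and "\<And>i. i < length xs \<Longrightarrow> coeff (p i) i = 1"
  shows "alt {..<length xs} (map (\<lambda>x i. poly (p i) x) xs) =
    (\<Prod>i<length xs. (-1) ^ i) * (\<Prod>i<length xs. \<Prod>j\<in>{i<..<length xs}. xs ! i - xs ! j)"
  using assms
proof (induction xs)
  case (Cons x xs)
  define n where "n = length xs"
  define cs where "cs = map (\<lambda>x i. poly (p i) x) xs"
  define Q where "Q = (\<Sum>i<Suc n. smult ((-1) ^ i * alt ({..<Suc n} - {i}) cs) (p i))"
  have p: "degree (p i) = i" "coeff (p i) i = 1" if "i < Suc n" for i
    using Cons.prems(2,3)[of i] that by (auto simp: n_def)
  have "{j. j < Suc n \<and> j < i} = {..<i}" if "i < Suc n" for i
    using that by auto
  then have Q: "poly Q z = alt {..<Suc n} ((\<lambda>i. poly (p i) z) # cs)" for z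
    by (simp add: Q_def poly_sum mult_ac lessThan_def del: sum.lessThan_Suc)
  define R where "R = smult ((-1) ^ n * alt {..<n} cs) (\<Prod>y\<in>set xs. [:- y, 1:])"
  have card: "card (set xs) = n"
    using Cons.prems(1) by (simp add: n_def distinct_card)
  have "Q = R"
  proof (rule poly_eqI_degree_lead_coeff[where A = "set xs" and n = n])
    show "poly Q z = poly R z" if "z \<in> set xs" for z
    proof -
      have "(\<lambda>i. poly (p i) z) \<in> set cs"
        using that by (auto simp: cs_def)
      then have "poly Q z = 0"
        unfolding Q by (intro alt_repeated) auto
      then show ?thesis
        using that by (auto simp: R_def poly_prod)
    qed
    show "degree Q \<le> n"
      unfolding Q_def by (intro degree_sum_le) (auto simp: p intro: order.trans[OF degree_smult_le])
    have degP: "degree (\<Prod>y\<in>set xs. [:- y, 1:]) = n"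
      by (simp add: degree_prod_eq_sum_degree card)
    then show "degree R \<le> n"
      unfolding R_def by (intro order.trans[OF degree_smult_le]) simp
    have "{..<Suc n} - {n} = {..<n}" by auto
    moreover have "coeff (p i) n = 0" if "i < n" for i
      using p[of i] that by (intro coeff_eq_0) auto
    ultimately have "coeff Q n = (-1) ^ n * alt {..<n} cs"
      using p[of n] by (simp add: Q_def coeff_sum)
    also have "\<dots> = coeff R n"
      using lead_coeff_prod[of "\<lambda>y. [:- y, 1:]" "set xs"] degP by (simp add: R_def)
    finally show "coeff Q n = coeff R n" .
  qed (use card in auto)
  then have "alt {..<Suc n} (map (\<lambda>x i. poly (p i) x) (x # xs)) =
      (-1) ^ n * alt {..<n} cs * (\<Prod>y\<in>set xs. x - y)"
    using Q[of x] by (simp add: R_def poly_prod cs_def)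
  also have "(\<Prod>y\<in>set xs. x - y) = (\<Prod>j<n. x - xs ! j)"
    using Cons.prems(1)
    by (intro prod.reindex_bij_betw[symmetric] bij_betw_nth) (auto simp: n_def)
  also have "\<dots> = (\<Prod>j\<in>{0<..<Suc n}. (x # xs) ! 0 - (x # xs) ! j)"
    by (rule prod.reindex_bij_witness[of _ "\<lambda>j. j - 1" Suc]) auto
  also have "alt {..<n} cs = (\<Prod>i<n. (-1) ^ i) * (\<Prod>i<n. \<Prod>j\<in>{i<..<n}. xs ! i - xs ! j)"
    unfolding cs_def n_def using Cons.prems by (intro Cons.IH) auto
  also have "(\<Prod>i<n. \<Prod>j\<in>{i<..<n}. xs ! i - xs ! j) =
      (\<Prod>i<n. \<Prod>j\<in>{Suc i<..<Suc n}. (x # xs) ! Suc i - (x # xs) ! j)"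
  proof (rule prod.cong[OF refl])
    show "(\<Prod>j\<in>{i<..<n}. xs ! i - xs ! j) = (\<Prod>j\<in>{Suc i<..<Suc n}. (x # xs) ! Suc i - (x # xs) ! j)" for i
      by (rule prod.reindex_bij_witness[of _ "\<lambda>j. j - 1" Suc]) auto
  qed
  also have "(-1) ^ n * ((\<Prod>i<n. (-1) ^ i) * (\<Prod>i<n. \<Prod>j\<in>{Suc i<..<Suc n}. (x # xs) ! Suc i - (x # xs) ! j)) *
      (\<Prod>j\<in>{0<..<Suc n}. (x # xs) ! 0 - (x # xs) ! j) =
      (\<Prod>i<Suc n. (-1) ^ i) * (\<Prod>i<Suc n. \<Prod>j\<in>{i<..<Suc n}. (x # xs) ! i - (x # xs) ! j)"
    unfolding prod.lessThan_Suc_shift[of _ n, of "\<lambda>i. \<Prod>j\<in>{i<..<Suc n}. (x # xs) ! i - (x # xs) ! j"]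
    by (simp add: mult_ac)
  finally show ?case by (simp add: n_def del: prod.lessThan_Suc)
qed simp

subsection \<open>Sums over sign changes\<close>

definition flip :: "nat set \<Rightarrow> (nat \<Rightarrow> real) \<Rightarrow> nat \<Rightarrow> real" where
  "flip T z i = (if i \<in> T then 1 / z i else z i)"

text \<open>By \<open>flip_sum_alt\<close> below, this is the determinant with entries \<open>z i ^ j - u i / z i ^ j\<close>: up to a
  monomial, the numerator of an orthogonal or symplectic character when \<open>u i\<close> is a fixed power
  of \<open>z i\<close>.\<close>

definition flip_sum :: "nat set \<Rightarrow> (nat \<Rightarrow> real) \<Rightarrow> (nat \<Rightarrow> real) \<Rightarrow> real" where
  "flip_sum A u z = (\<Sum>T\<in>Pow A. (\<Prod>i\<in>T. - u i) * vdm A (flip T z))"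

text \<open>The variables and their inverses lie on different sides of 1, so no sign change creates
  a collision.\<close>

lemma inj_on_flip:
  assumes "inj_on z A" "\<And>i. i \<in> A \<Longrightarrow> z i > 1"
  shows "inj_on (flip X z) A"
proof (rule inj_onI)
  fix i j assume ij: "i \<in> A" "j \<in> A" "flip X z i = flip X z j"
  have gt: "z i > 1" "z j > 1"
    using assms(2) ij by auto
  then have "1 / z i < 1" "1 / z j < 1" by simp_all
  then have "1 / z i < z j" "1 / z j < z i"
    using gt by linarith+
  then have "z i = z j"
    using ij by (auto simp: flip_def split: if_splits)
  then show "i = j" using assms(1) ij by (auto simp: inj_on_def)
qed

lemma vdm_cong: "(\<And>i. i \<in> A \<Longrightarrow> y i = z i) \<Longrightarrow> vdm A y = vdm A z"
  unfolding vdm_def by (intro pair_prod_cong) auto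

lemma flip_sum_cong:
  assumes "\<And>i. i \<in> A \<Longrightarrow> u i = u' i" "\<And>i. i \<in> A \<Longrightarrow> z i = z' i"
  shows "flip_sum A u z = flip_sum A u' z'"
  unfolding flip_sum_def
  using assms by (auto simp: flip_def intro!: sum.cong arg_cong2[of _ _ _ _ "(*)"] prod.cong vdm_cong)

lemma prod_subset_if:
  assumes "finite A" "T \<subseteq> A"
  shows "(\<Prod>i\<in>T. g i) = (\<Prod>i\<in>A. if i \<in> T then g i else 1)"
  using assms by (simp add: prod.If_cases Int_absorb1)

text \<open>Inverting the variables in \<open>X\<close> permutes the summands by symmetric
  difference with \<open>X\<close>. The correction \<open>- 1 / u i\<close> for \<open>i\<close> in
  \<open>X\<close> is the same whether or not \<open>i\<close> lies in \<open>T\<close>, so it comes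
  out of the sum.\<close>

lemma flip_sum_flip:
  assumes "finite A" "X \<subseteq> A" "\<And>i. i \<in> A \<Longrightarrow> u i \<noteq> 0"
  shows "flip_sum A (flip X u) (flip X z) = (\<Prod>i\<in>X. - 1 / u i) * flip_sum A u z"
proof -
  let ?D = "\<lambda>T. (T - X) \<union> (X - T)"
  have *: "(\<Prod>i\<in>T. - flip X u i) = (\<Prod>i\<in>X. - 1 / u i) * (\<Prod>i\<in>?D T. - u i)" if "T \<subseteq> A" for T
  proof -
    have "?D T \<subseteq> A"
      using assms(2) that by auto
    then show ?thesis
      unfolding prod_subset_if[OF assms(1) that] prod_subset_if[OF assms(1,2)]
        prod_subset_if[OF assms(1) \<open>?D T \<subseteq> A\<close>] prod.distrib[symmetric]
      using assms(3) by (intro prod.cong) (auto simp: flip_def)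
  qed
  have "flip_sum A (flip X u) (flip X z) =
      (\<Sum>T\<in>Pow A. (\<Prod>i\<in>X. - 1 / u i) * ((\<Prod>i\<in>?D T. - u i) * vdm A (flip (?D T) z)))"
    unfolding flip_sum_def
  proof (intro sum.cong refl)
    fix T assume "T \<in> Pow A"
    moreover have "vdm A (flip T (flip X z)) = vdm A (flip (?D T) z)"
      by (intro vdm_cong) (auto simp: flip_def)
    ultimately show "(\<Prod>i\<in>T. - flip X u i) * vdm A (flip T (flip X z)) =
        (\<Prod>i\<in>X. - 1 / u i) * ((\<Prod>i\<in>?D T. - u i) * vdm A (flip (?D T) z))"
      using *[of T] by (simp add: mult.assoc)
  qed
  also have "\<dots> = (\<Sum>T\<in>Pow A. (\<Prod>i\<in>X. - 1 / u i) * ((\<Prod>i\<in>T. - u i) * vdm A (flip T z)))"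
  proof (rule sum.reindex_bij_witness[of _ ?D ?D])
    fix T assume "T \<in> Pow A"
    have "?D (?D T) = T" by auto
    then show "?D (?D T) = T" "?D (?D T) = T" by assumption+
    show "?D T \<in> Pow A" "?D T \<in> Pow A"
      using \<open>T \<in> Pow A\<close> assms(2) by auto
  qed auto
  finally show ?thesis
    by (simp add: flip_sum_def sum_distrib_left)
qed

section \<open>Strictly decreasing exponent lists in a bounded range\<close>

definition decreasing :: "nat \<Rightarrow> nat \<Rightarrow> nat list set" where
  "decreasing n M = {l. length l = n \<and> sorted_wrt (>) l \<and> set l \<subseteq> {1..M}}"

text \<open>For \<open>f v i = y i ^ v\<close> and finite \<open>A\<close> this is the sum of the
  Schur functions of all partitions with at most \<open>card A\<close> parts, none above
  \<open>M - card A\<close>, times \<open>vdm A y\<close> and the product of the variables (and 0 if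
  \<open>M < card A\<close>).\<close>

definition alt_sum :: "nat set \<Rightarrow> nat \<Rightarrow> (nat \<Rightarrow> nat \<Rightarrow> real) \<Rightarrow> real" where
  "alt_sum A M f = (\<Sum>l\<in>decreasing (card A) M. alt A (map f l))"

lemma finite_decreasing [simp]: "finite (decreasing n M)"
  by (rule finite_subset[OF _ finite_lists_length_eq[of "{1..M}" n]]) (auto simp: decreasing_def)

lemma decreasing_0_left [simp]: "decreasing 0 M = {[]}"
  by (auto simp: decreasing_def)

lemma decreasing_0_right [simp]: "decreasing (Suc n) 0 = {}"
  by (auto simp: decreasing_def)

lemma decreasing_Suc_Suc:
  "decreasing (Suc n) (Suc M) = decreasing (Suc n) M \<union> (#) (Suc M) ` decreasing n M"
proof -
  have "l \<in> decreasing (Suc n) M \<union> (#) (Suc M) ` decreasing n M" if l: "l \<in> decreasing (Suc n) (Suc M)" for l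
  proof -
    obtain v l' where [simp]: "l = v # l'"
      using l by (cases l) (auto simp: decreasing_def)
    have v: "v \<le> Suc M" "length l' = n" "sorted_wrt (>) l'" "\<And>x. x \<in> set l' \<Longrightarrow> x < v \<and> 1 \<le> x" "1 \<le> v"
      using l by (auto simp: decreasing_def)
    show ?thesis
    proof (cases "v = Suc M")
      case True
      then have "l' \<in> decreasing n M"
        using v by (auto simp: decreasing_def less_Suc_eq_le)
      then show ?thesis using True by auto
    next
      case False
      then have "v \<le> M" using v(1) by simp
      then have "\<And>x. x \<in> set l' \<Longrightarrow> x \<le> M"
        using v(4) by fastforce
      then have "l \<in> decreasing (Suc n) M"
        using v \<open>v \<le> M\<close> by (auto simp: decreasing_def)
      then show ?thesis by auto
    qed
  qed
  moreover have "decreasing (Suc n) M \<union> (#) (Suc M) ` decreasing n M \<subseteq> decreasing (Suc n) (Suc M)"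
    by (fastforce simp: decreasing_def)
  ultimately show ?thesis by blast
qed

lemma alt_sum_empty [simp]: "alt_sum {} M f = 1"
  by (simp add: alt_sum_def)

lemma alt_sum_0:
  assumes "finite A" "A \<noteq> {}"
  shows "alt_sum A 0 f = 0"
proof -
  obtain n where "card A = Suc n"
    using assms by (metis card_gt_0_iff gr0_implies_Suc)
  then show ?thesis by (simp add: alt_sum_def)
qed

text \<open>Either all entries are at most \<open>M\<close>, or the first one is
  \<open>Suc M\<close> and the alternant is expanded along its column.\<close>

lemma alt_sum_Suc:
  assumes "finite A"
  shows "alt_sum A (Suc M) f = alt_sum A M f +
    (\<Sum>i\<in>A. (-1) ^ card {j \<in> A. j < i} * f (Suc M) i * alt_sum (A - {i}) M f)"
proof (cases "A = {}")
  case False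
  then obtain n where n: "card A = Suc n"
    using assms by (metis card_gt_0_iff gr0_implies_Suc)
  have "decreasing (Suc n) M \<inter> (#) (Suc M) ` decreasing n M = {}"
    by (auto simp: decreasing_def)
  then have "alt_sum A (Suc M) f = alt_sum A M f + (\<Sum>l\<in>decreasing n M. alt A (f (Suc M) # map f l))"
    unfolding alt_sum_def n decreasing_Suc_Suc
    by (subst sum.union_disjoint) (auto simp: sum.reindex)
  also have "(\<Sum>l\<in>decreasing n M. alt A (f (Suc M) # map f l)) =
      (\<Sum>i\<in>A. (-1) ^ card {j \<in> A. j < i} * f (Suc M) i * (\<Sum>l\<in>decreasing n M. alt (A - {i}) (map f l)))"
    by (simp add: sum_distrib_left) (rule sum.swap)
  also have "\<dots> = (\<Sum>i\<in>A. (-1) ^ card {j \<in> A. j < i} * f (Suc M) i * alt_sum (A - {i}) M f)"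
    using n assms by (intro sum.cong) (auto simp: alt_sum_def)
  finally show ?thesis .
qed simp

text \<open>Lagrange interpolation of \<open>\<Prod>j\<in>T. (1 - x * z j)\<close> at the nodes \<open>z i\<close> and \<open>-1\<close>.\<close>

lemma one_minus_prod_expansion:
  fixes z :: "'i \<Rightarrow> real"
  assumes "finite T" "inj_on z T" "\<And>i. i \<in> T \<Longrightarrow> z i \<noteq> -1"
  shows "(\<Sum>i\<in>T. (1 - z i) * (\<Prod>j\<in>T - {i}. (1 - z i * z j) / (z j - z i))) = 1 - (\<Prod>i\<in>T. z i)"
proof -
  define P where "P = (\<Prod>j\<in>T. [:1, - z j:])"
  \<comment> \<open>At \<open>z i\<close> the polynomial \<open>P\<close> contains the factor
    \<open>1 - z i * z i\<close>; the extra node \<open>-1\<close> contributes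
    \<open>z i + 1\<close> to the denominator and leaves the wanted \<open>1 - z i\<close>.\<close>
  define X where "X = insert (-1) (z ` T)"
  let ?t = "card T"
  have notin: "-1 \<notin> z ` T"
    using assms(3) by force
  have card: "card X = Suc ?t"
    using assms(1,2) notin by (simp add: X_def card_image)
  have lin: "degree (\<Prod>j\<in>F. [:1, - z j:]) \<le> card F" if "finite F" for F
  proof -
    have "degree (\<Prod>j\<in>F. [:1, - z j:]) \<le> (\<Sum>j\<in>F. 1)"
      by (rule order.trans[OF degree_prod_sum_le[OF that]], rule sum_mono) simp
    then show ?thesis by simp
  qed
  then have deg: "degree P \<le> ?t"
    using assms(1) by (simp add: P_def)
  have cf: "coeff P ?t = (\<Prod>j\<in>T. - z j)"
    using assms(1) unfolding P_def
  proof (induction T)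
    case (insert a F)
    have "degree (\<Prod>j\<in>F. [:1, - z j:]) \<le> card F"
      using insert.hyps(1) by (rule lin)
    then have "coeff (\<Prod>j\<in>F. [:1, - z j:]) (Suc (card F)) = 0"
      by (intro coeff_eq_0) simp
    then show ?case
      using insert by simp
  qed simp
  have sgn: "(\<Prod>j\<in>T. - h j) = (-1) ^ ?t * (\<Prod>j\<in>T. h j)" for h :: "'i \<Rightarrow> real"
    by (rule prod_uminus)
  have "(\<Sum>x\<in>X. poly P x / (\<Prod>y\<in>X - {x}. x - y)) = coeff P ?t"
    using lagrange_leading_coeff[of X P] assms(1) deg card by (simp add: X_def)
  moreover have "(\<Sum>x\<in>X. poly P x / (\<Prod>y\<in>X - {x}. x - y)) =
      poly P (-1) / (\<Prod>y\<in>z ` T. -1 - y) + (\<Sum>i\<in>T. poly P (z i) / (\<Prod>y\<in>X - {z i}. z i - y))"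
    using notin assms(1,2) by (simp add: X_def sum.reindex)
  moreover have "poly P (-1) / (\<Prod>y\<in>z ` T. -1 - y) = (-1) ^ ?t"
  proof -
    have "(\<Prod>y\<in>z ` T. -1 - y) = (\<Prod>j\<in>T. - (1 + z j))"
      using assms(2) by (simp add: prod.reindex)
    moreover have "poly P (-1) = (\<Prod>j\<in>T. 1 + z j)"
      by (simp add: P_def poly_prod)
    moreover have "(\<Prod>j\<in>T. 1 + z j) \<noteq> 0"
      using assms(1,3) by (auto simp: add_eq_0_iff)
    ultimately show ?thesis
      unfolding sgn by (simp add: power_one_over[symmetric])
  qed
  moreover have "poly P (z i) / (\<Prod>y\<in>X - {z i}. z i - y) =
      (-1) ^ (?t - 1) * ((1 - z i) * (\<Prod>j\<in>T - {i}. (1 - z i * z j) / (z j - z i)))" if "i \<in> T" for i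
  proof -
    have "X - {z i} = insert (-1) (z ` (T - {i}))"
      using assms(2) notin that by (auto simp: X_def inj_on_def)
    moreover have "-1 \<notin> z ` (T - {i})"
      using notin by auto
    ultimately have "(\<Prod>y\<in>X - {z i}. z i - y) = (z i + 1) * (\<Prod>j\<in>T - {i}. - (z j - z i))"
      using assms(1,2) by (simp add: prod.reindex inj_on_diff)
    also have "\<dots> = (-1) ^ (?t - 1) * ((z i + 1) * (\<Prod>j\<in>T - {i}. z j - z i))"
      unfolding prod_uminus using that assms(1) by simp
    finally have *: "(\<Prod>y\<in>X - {z i}. z i - y) = (-1) ^ (?t - 1) * ((z i + 1) * (\<Prod>j\<in>T - {i}. z j - z i))" .
    have "poly P (z i) = (1 - z i * z i) * (\<Prod>j\<in>T - {i}. 1 - z i * z j)"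
      using prod.remove[OF assms(1) that, of "\<lambda>j. 1 - z i * z j"] by (simp add: P_def poly_prod)
    moreover have "1 - z i * z i = (z i + 1) * (1 - z i)"
      by (simp add: algebra_simps)
    moreover have "z i + 1 \<noteq> 0"
      using assms(3)[OF that] by (simp add: add_eq_0_iff2)
    ultimately have "poly P (z i) / (\<Prod>y\<in>X - {z i}. z i - y) =
        (z i + 1) * ((1 - z i) * (\<Prod>j\<in>T - {i}. 1 - z i * z j)) /
          ((-1) ^ (?t - 1) * ((z i + 1) * (\<Prod>j\<in>T - {i}. z j - z i)))"
      unfolding * by (simp only: mult.assoc)
    also have "\<dots> = (-1) ^ (?t - 1) * ((1 - z i) * (\<Prod>j\<in>T - {i}. 1 - z i * z j) / (\<Prod>j\<in>T - {i}. z j - z i))"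
      using \<open>z i + 1 \<noteq> 0\<close> by (cases "even (?t - 1)") simp_all
    finally show ?thesis
      by (simp only: prod_dividef times_divide_eq_right)
  qed
  ultimately have eq: "(-1) ^ ?t + (\<Sum>i\<in>T. (-1) ^ (?t - 1) * ((1 - z i) * (\<Prod>j\<in>T - {i}. (1 - z i * z j) / (z j - z i))))
      = (-1) ^ ?t * (\<Prod>i\<in>T. z i)"
    unfolding cf sgn by simp
  show ?thesis
  proof (cases "T = {}")
    case False
    then obtain t where t: "?t = Suc t"
      using assms(1) by (metis card_gt_0_iff gr0_implies_Suc)
    have "(-1) ^ t * ((\<Sum>i\<in>T. (1 - z i) * (\<Prod>j\<in>T - {i}. (1 - z i * z j) / (z j - z i))) - (1 - (\<Prod>i\<in>T. z i))) = 0"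
      using eq by (simp add: t algebra_simps sum_distrib_left)
    then show ?thesis by simp
  qed simp
qed

subsection \<open>Bounded sums of alternants\<close>

text \<open>After halving the exponents symmetrically, the determinant in
  \<open>flip_sum_alt\<close> shows the numerator of the odd orthogonal character of a rectangle
  with \<open>card A\<close> rows of length \<open>(M - card A) / 2\<close>.\<close>

abbreviation box_sum :: "nat set \<Rightarrow> nat \<Rightarrow> (nat \<Rightarrow> real) \<Rightarrow> real" where
  "box_sum A M z \<equiv> flip_sum A (\<lambda>i. z i ^ (M + card A - 1)) z"

lemma sum_Pow_remove:
  assumes "finite A"
  shows "(\<Sum>i\<in>A. \<Sum>T\<in>Pow (A - {i}). g i T) = (\<Sum>T\<in>Pow A. \<Sum>i\<in>T. g i (T - {i}))"
proof -
  have fin: "finite T" if "T \<in> Pow A" for T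
    using that assms by (auto intro: finite_subset)
  have "(\<Sum>i\<in>A. \<Sum>T\<in>Pow (A - {i}). g i T) = (\<Sum>(i, T)\<in>(SIGMA i:A. Pow (A - {i})). g i T)"
    using assms by (intro sum.Sigma) auto
  also have "\<dots> = (\<Sum>(T, i)\<in>(SIGMA T:Pow A. T). g i (T - {i}))"
    by (rule sum.reindex_bij_witness[of _ "\<lambda>(T, i). (i, T - {i})" "\<lambda>(i, T). (insert i T, i)"])
      (auto intro!: arg_cong[of _ _ "g _"])
  also have "\<dots> = (\<Sum>T\<in>Pow A. \<Sum>i\<in>T. g i (T - {i}))"
    using assms fin by (intro sum.Sigma[symmetric]) auto
  finally show ?thesis .
qed

text \<open>This matches the recursion of \<open>alt_sum_Suc\<close> once denominators are cleared.
  Raising \<open>M\<close> multiplies the summand of \<open>T\<close> by the product of the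
  \<open>z i\<close> over \<open>T\<close>; the summands of the smaller index sets, regrouped by
  \<open>T\<close> with \<open>i\<close> put back, account for exactly this change through
  \<open>one_minus_prod_expansion\<close>.\<close>

lemma box_sum_Suc:
  assumes "finite A" "inj_on z A" "\<And>i. i \<in> A \<Longrightarrow> z i \<noteq> 0" "\<And>i. i \<in> A \<Longrightarrow> z i \<noteq> -1"
  shows "box_sum A (Suc M) z = box_sum A M z +
    (\<Sum>i\<in>A. (-1) ^ card {j \<in> A. j < i} * z i ^ M * (1 - z i) *
      (\<Prod>j\<in>A - {i}. 1 - z i * z j) * box_sum (A - {i}) M z)"
proof (cases "A = {}")
  case False
  then obtain n where n: "card A = Suc n"
    using assms(1) by (metis card_gt_0_iff gr0_implies_Suc)
  define s where "s i = ((-1) ^ card {j \<in> A. j < i} :: real)" for i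
  define w where "w T = (\<Prod>i\<in>T. - (z i ^ (M + n))) * vdm A (flip T z)" for T
  have fin: "finite T" if "T \<in> Pow A" for T
    using that assms(1) by (auto intro: finite_subset)
  have key: "s i * z i ^ M * (\<Prod>j\<in>A - {i}. 1 - z i * z j) *
      ((\<Prod>j\<in>T - {i}. - (z j ^ (M + card (A - {i}) - 1))) * vdm (A - {i}) (flip (T - {i}) z))
    = - w T * (\<Prod>j\<in>T - {i}. (1 - z i * z j) / (z j - z i))" if "T \<subseteq> A" "i \<in> T" for T i
  proof -
    define y where "y = flip T z"
    have iA: "i \<in> A" using that by auto
    have finT: "finite T" using that assms(1) by (auto intro: finite_subset)
    have ci: "card (A - {i}) = n" using iA n assms(1) by simp
    have sub: "T - {i} \<subseteq> A - {i}" using that by auto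
    \<comment> \<open>The power supplies one factor \<open>z i\<close> for each of the
      \<open>n\<close> remaining indices. This clears denominators: \<open>z i * (y i - y j)\<close>
      is \<open>1 - z i * z j\<close> for \<open>j\<close> outside \<open>T\<close> and
      \<open>(z j - z i) / z j\<close> inside.\<close>
    have "z i ^ n = (\<Prod>j\<in>A - {i}. z i)" using ci by simp
    then have "z i ^ n * (\<Prod>j\<in>T - {i}. - (z j ^ (M + n))) * (\<Prod>j\<in>A - {i}. y i - y j) *
        (\<Prod>j\<in>T - {i}. (1 - z i * z j) / (z j - z i)) =
        (\<Prod>j\<in>A - {i}. z i * (if j \<in> T - {i} then - (z j ^ (M + n)) else 1) * (y i - y j) *
          (if j \<in> T - {i} then (1 - z i * z j) / (z j - z i) else 1))"
      using assms(1) by (simp only: prod_subset_if[OF finite_Diff sub] prod.distrib)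
    also have "\<dots> = (\<Prod>j\<in>A - {i}. (1 - z i * z j) * (if j \<in> T - {i} then - (z j ^ (M + n - 1)) else 1))"
    proof (intro prod.cong refl)
      fix j assume j: "j \<in> A - {i}"
      have nz: "z i \<noteq> 0" "z j \<noteq> 0" "z j \<noteq> z i"
        using assms(2,3) iA j by (auto simp: inj_on_def)
      have yi: "y i = 1 / z i" using that by (simp add: y_def flip_def)
      show "z i * (if j \<in> T - {i} then - (z j ^ (M + n)) else 1) * (y i - y j) *
          (if j \<in> T - {i} then (1 - z i * z j) / (z j - z i) else 1) =
          (1 - z i * z j) * (if j \<in> T - {i} then - (z j ^ (M + n - 1)) else 1)"
      proof (cases "j \<in> T - {i}")
        case True
        have "n > 0" using j ci assms(1) by (metis card_gt_0_iff empty_iff finite_Diff)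
        then have p: "z j ^ (M + n) = z j * z j ^ (M + n - 1)"
          by (simp add: power_eq_if)
        have "y j = 1 / z j" using True by (simp add: y_def flip_def)
        then have "y i - y j = (z j - z i) / (z i * z j)"
          using nz by (simp add: yi field_simps)
        then show ?thesis
          using True nz by (simp add: p)
      next
        case False
        then have "y j = z j" using j by (simp add: y_def flip_def)
        then have "z i * (y i - y j) = 1 - z i * z j"
          using nz by (simp add: yi field_simps)
        then show ?thesis by (simp only: False if_False mult_1_right)
      qed
    qed
    also have "\<dots> = (\<Prod>j\<in>A - {i}. 1 - z i * z j) * (\<Prod>j\<in>T - {i}. - (z j ^ (M + n - 1)))"
      using assms(1) by (simp only: prod_subset_if[OF finite_Diff sub] prod.distrib)
    finally have main: "z i ^ n * (\<Prod>j\<in>T - {i}. - (z j ^ (M + n))) * (\<Prod>j\<in>A - {i}. y i - y j) *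
        (\<Prod>j\<in>T - {i}. (1 - z i * z j) / (z j - z i)) =
        (\<Prod>j\<in>A - {i}. 1 - z i * z j) * (\<Prod>j\<in>T - {i}. - (z j ^ (M + n - 1)))" .
    have v: "vdm (A - {i}) (flip (T - {i}) z) = vdm (A - {i}) y"
      by (intro vdm_cong) (auto simp: y_def flip_def)
    have w: "w T = - (z i ^ M * z i ^ n) * (\<Prod>j\<in>T - {i}. - (z j ^ (M + n))) *
        (s i * (\<Prod>j\<in>A - {i}. y i - y j) * vdm (A - {i}) y)"
      using finT that vdm_remove[OF assms(1) iA, of y]
      by (simp add: w_def y_def s_def prod.remove[of T i] power_add)
    have "- w T * (\<Prod>j\<in>T - {i}. (1 - z i * z j) / (z j - z i)) =
      s i * z i ^ M * vdm (A - {i}) y * (z i ^ n * (\<Prod>j\<in>T - {i}. - (z j ^ (M + n))) * (\<Prod>j\<in>A - {i}. y i - y j) *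
        (\<Prod>j\<in>T - {i}. (1 - z i * z j) / (z j - z i)))"
      unfolding w by (simp only: mult_ac minus_mult_left[symmetric] minus_mult_right[symmetric] minus_minus)
    then show ?thesis
      unfolding main ci v by (simp only: mult_ac)
  qed
  have "(\<Sum>i\<in>A. s i * z i ^ M * (1 - z i) * (\<Prod>j\<in>A - {i}. 1 - z i * z j) * box_sum (A - {i}) M z) =
      (\<Sum>i\<in>A. \<Sum>T\<in>Pow (A - {i}). (1 - z i) * (s i * z i ^ M * (\<Prod>j\<in>A - {i}. 1 - z i * z j) *
        ((\<Prod>j\<in>T. - (z j ^ (M + card (A - {i}) - 1))) * vdm (A - {i}) (flip T z))))"
    unfolding flip_sum_def sum_distrib_left by (simp only: mult_ac)
  also have "\<dots> = (\<Sum>T\<in>Pow A. \<Sum>i\<in>T. (1 - z i) * (s i * z i ^ M * (\<Prod>j\<in>A - {i}. 1 - z i * z j) *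
        ((\<Prod>j\<in>T - {i}. - (z j ^ (M + card (A - {i}) - 1))) * vdm (A - {i}) (flip (T - {i}) z))))"
    by (rule sum_Pow_remove[OF assms(1)])
  also have "\<dots> = (\<Sum>T\<in>Pow A. - w T * (\<Sum>i\<in>T. (1 - z i) * (\<Prod>j\<in>T - {i}. (1 - z i * z j) / (z j - z i))))"
    unfolding sum_distrib_left
  proof (intro sum.cong refl)
    fix T i assume "T \<in> Pow A" "i \<in> T"
    then have "T \<subseteq> A" by simp
    show "(1 - z i) * (s i * z i ^ M * (\<Prod>j\<in>A - {i}. 1 - z i * z j) *
        ((\<Prod>j\<in>T - {i}. - (z j ^ (M + card (A - {i}) - 1))) * vdm (A - {i}) (flip (T - {i}) z))) =
      - w T * ((1 - z i) * (\<Prod>j\<in>T - {i}. (1 - z i * z j) / (z j - z i)))"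
      unfolding key[OF \<open>T \<subseteq> A\<close> \<open>i \<in> T\<close>] by (simp only: mult_ac)
  qed
  also have "\<dots> = (\<Sum>T\<in>Pow A. - w T * (1 - (\<Prod>i\<in>T. z i)))"
  proof (intro sum.cong refl arg_cong2[of _ _ _ _ "(*)"])
    fix T assume "T \<in> Pow A"
    then show "(\<Sum>i\<in>T. (1 - z i) * (\<Prod>j\<in>T - {i}. (1 - z i * z j) / (z j - z i))) = 1 - (\<Prod>i\<in>T. z i)"
      using assms(2,4) fin by (intro one_minus_prod_expansion) (auto intro: inj_on_subset)
  qed
  also have "\<dots> = box_sum A (Suc M) z - box_sum A M z"
    unfolding flip_sum_def sum_subtractf[symmetric] n
    by (intro sum.cong refl) (simp add: w_def prod_uminus prod.distrib algebra_simps)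
  finally show ?thesis
    unfolding s_def by simp
qed (simp add: flip_sum_def)

text \<open>The recursion gives \<open>box_sum A 1 = box_sum A 0\<close> at both \<open>z\<close> and \<open>1 / z\<close>, whereas inverting all
  variables multiplies the two by monomials that differ by the factor \<open>\<Prod>i\<in>A. z i\<close>.\<close>

lemma box_sum_0:
  assumes "finite A" "A \<noteq> {}" "inj_on z A" "\<And>i. i \<in> A \<Longrightarrow> z i > 1"
  shows "box_sum A 0 z = 0"
  using assms
proof (induction "card A" arbitrary: A)
  case 0
  then show ?case by simp
next
  case (Suc n)
  show ?case
  proof (cases "n = 0")
    \<comment> \<open>A singleton is separate because removing its element leaves the empty set,
      where the box sum is 1 and not 0.\<close>
    case True
    then obtain a where "A = {a}"
      using Suc.hyps(2) by (metis One_nat_def card_1_singletonE)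
    then show ?thesis
      by (simp add: flip_sum_def vdm_remove[of "{a}" a] vdm_def[of "{}"] Pow_insert)
  next
    case False
    define z' where "z' i = 1 / z i" for i
    have gt: "z i > 1" if "i \<in> A" for i using Suc.prems that by auto
    have IH: "box_sum (A - {i}) 0 z = 0" if "i \<in> A" for i
    proof -
      have "n = card (A - {i})" using Suc.hyps(2) Suc.prems that by simp
      moreover from this have "A - {i} \<noteq> {}" using False by (metis card.empty)
      ultimately show ?thesis
        using Suc.hyps(1)[of "A - {i}"] Suc.prems by (simp add: inj_on_diff)
    qed
    have inv: "box_sum B M z' = (\<Prod>i\<in>B. - 1 / z i ^ (M + card B - 1)) * box_sum B M z" if "B \<subseteq> A" for B M
    proof -
      have "finite B" using that Suc.prems(1) by (rule finite_subset)
      have "box_sum B M z' = flip_sum B (flip B (\<lambda>i. z i ^ (M + card B - 1))) (flip B z)"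
        by (intro flip_sum_cong) (auto simp: flip_def z'_def power_one_over)
      also have "\<dots> = (\<Prod>i\<in>B. - 1 / z i ^ (M + card B - 1)) * box_sum B M z"
        using that gt \<open>finite B\<close> by (intro flip_sum_flip) force+
      finally show ?thesis .
    qed
    have "box_sum A (Suc 0) z = box_sum A 0 z"
      using Suc.prems(1,3) gt IH by (subst box_sum_Suc) force+
    moreover have "box_sum A (Suc 0) z' = box_sum A 0 z'"
    proof -
      have "inj_on z' A" using Suc.prems(3) by (auto simp: inj_on_def z'_def)
      moreover have "z' i > 0" if "i \<in> A" for i using gt[OF that] by (simp add: z'_def)
      moreover have "box_sum (A - {i}) 0 z' = 0" if "i \<in> A" for i
        using inv[of "A - {i}" 0] IH[OF that] by auto
      ultimately show ?thesis
        using Suc.prems(1) by (subst box_sum_Suc) force+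
    qed
    ultimately have "(\<Prod>i\<in>A. - 1 / z i ^ Suc n) * box_sum A 0 z = (\<Prod>i\<in>A. - 1 / z i ^ n) * box_sum A 0 z"
      using inv[of A "Suc 0"] inv[of A 0] Suc.hyps(2)[symmetric] by simp
    moreover have "(\<Prod>i\<in>A. - 1 / z i ^ n) = (\<Prod>i\<in>A. - 1 / z i ^ Suc n) * (\<Prod>i\<in>A. z i)"
      unfolding prod.distrib[symmetric] using gt by (intro prod.cong) force+
    moreover have "(\<Prod>i\<in>A. - 1 / z i ^ Suc n) \<noteq> 0"
      using gt Suc.prems(1) by force
    ultimately have "box_sum A 0 z = (\<Prod>i\<in>A. z i) * box_sum A 0 z"
      by (simp add: mult.assoc)
    moreover have "(\<Prod>i\<in>A. z i) > 1"
      using gt Suc.prems(1,2) by (metis less_1_prod)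
    ultimately show ?thesis by simp
  qed
qed

text \<open>Macdonald's identity, also at inverted variables.\<close>

lemma alt_sum_powers:
  assumes "finite A" "inj_on z A" "\<And>i. i \<in> A \<Longrightarrow> z i > 1" "X \<subseteq> A"
  defines "y \<equiv> flip X z"
  shows "alt_sum A M (\<lambda>v i. y i ^ v) * ((\<Prod>i\<in>A. 1 - y i) * pair_prod A (\<lambda>i j. 1 - y i * y j)) =
    (\<Prod>i\<in>A. y i) * box_sum A M y"
proof -
  have pos: "y i > 0" if "i \<in> A" for i
    using assms(3)[OF that] by (simp add: y_def flip_def)
  have inj: "inj_on y A"
    unfolding y_def using assms(2,3) by (rule inj_on_flip)
  \<comment> \<open>\<open>box_sum_0\<close> asks for variables above 1;
    \<open>flip_sum_flip\<close> carries the vanishing over from \<open>z\<close> to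
    \<open>y\<close>.\<close>
  have zero: "box_sum B 0 y = 0" if "B \<subseteq> A" "B \<noteq> {}" for B
  proof -
    have "finite B" using that assms(1) by (auto intro: finite_subset)
    have "box_sum B 0 y = flip_sum B (flip (X \<inter> B) (\<lambda>i. z i ^ (card B - 1))) (flip (X \<inter> B) z)"
      by (intro flip_sum_cong) (auto simp: flip_def y_def power_one_over)
    also have "\<dots> = (\<Prod>i\<in>X \<inter> B. - 1 / z i ^ (card B - 1)) * box_sum B 0 z"
      using that assms(3) \<open>finite B\<close> by (subst flip_sum_flip) force+
    also have "box_sum B 0 z = 0"
      using that assms(2,3) \<open>finite B\<close> by (intro box_sum_0) (auto intro: inj_on_subset)
    finally show ?thesis by simp
  qed
  have "alt_sum B M (\<lambda>v i. y i ^ v) * ((\<Prod>i\<in>B. 1 - y i) * pair_prod B (\<lambda>i j. 1 - y i * y j)) =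
    (\<Prod>i\<in>B. y i) * box_sum B M y" if "B \<subseteq> A" for B
    using that
  proof (induction M arbitrary: B)
    case 0
    then have "finite B" using assms(1) by (auto intro: finite_subset)
    then show ?case
      using zero[OF 0] by (cases "B = {}") (auto simp: alt_sum_0 flip_sum_def vdm_def)
  next
    case (Suc M)
    have fin: "finite B" using Suc.prems assms(1) by (auto intro: finite_subset)
    define G where "G B = (\<Prod>i\<in>B. 1 - y i) * pair_prod B (\<lambda>i j. 1 - y i * y j)" for B
    have G: "G B = (1 - y i) * (\<Prod>j\<in>B - {i}. 1 - y i * y j) * G (B - {i})" if "i \<in> B" for i
      using pair_prod_sym_remove[OF fin that, of "\<lambda>i j. 1 - y i * y j"] fin that
      by (simp add: G_def prod.remove[of B i] mult_ac)
    have IH: "alt_sum C M (\<lambda>v i. y i ^ v) * G C = (\<Prod>i\<in>C. y i) * box_sum C M y" if "C \<subseteq> B" for C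
      unfolding G_def using Suc.IH[of C] Suc.prems that by auto
    have "alt_sum B (Suc M) (\<lambda>v i. y i ^ v) * G B = alt_sum B M (\<lambda>v i. y i ^ v) * G B +
      (\<Sum>i\<in>B. (-1) ^ card {j \<in> B. j < i} * y i ^ Suc M * alt_sum (B - {i}) M (\<lambda>v i. y i ^ v) * G B)"
      by (subst alt_sum_Suc[OF fin]) (simp add: distrib_right sum_distrib_right)
    also have "(\<Sum>i\<in>B. (-1) ^ card {j \<in> B. j < i} * y i ^ Suc M * alt_sum (B - {i}) M (\<lambda>v i. y i ^ v) * G B) =
      (\<Sum>i\<in>B. (\<Prod>i\<in>B. y i) * ((-1) ^ card {j \<in> B. j < i} * y i ^ M * (1 - y i) *
        (\<Prod>j\<in>B - {i}. 1 - y i * y j) * box_sum (B - {i}) M y))"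
    proof (intro sum.cong refl)
      fix i assume i: "i \<in> B"
      have "(-1) ^ card {j \<in> B. j < i} * y i ^ Suc M * alt_sum (B - {i}) M (\<lambda>v i. y i ^ v) * G B =
        (-1) ^ card {j \<in> B. j < i} * y i ^ Suc M * ((1 - y i) * (\<Prod>j\<in>B - {i}. 1 - y i * y j)) *
          (alt_sum (B - {i}) M (\<lambda>v i. y i ^ v) * G (B - {i}))"
        unfolding G[OF i] by (simp only: mult_ac)
      also have "\<dots> = (-1) ^ card {j \<in> B. j < i} * y i ^ Suc M * ((1 - y i) * (\<Prod>j\<in>B - {i}. 1 - y i * y j)) *
          ((\<Prod>i\<in>B - {i}. y i) * box_sum (B - {i}) M y)"
        by (subst IH) auto
      finally show "(-1) ^ card {j \<in> B. j < i} * y i ^ Suc M * alt_sum (B - {i}) M (\<lambda>v i. y i ^ v) * G B =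
        (\<Prod>i\<in>B. y i) * ((-1) ^ card {j \<in> B. j < i} * y i ^ M * (1 - y i) *
        (\<Prod>j\<in>B - {i}. 1 - y i * y j) * box_sum (B - {i}) M y)"
        using fin i by (simp only: prod.remove[of B i] power_Suc mult_ac)
    qed
    also have "alt_sum B M (\<lambda>v i. y i ^ v) * G B = (\<Prod>i\<in>B. y i) * box_sum B M y"
      by (rule IH) simp
    also have "(\<Prod>i\<in>B. y i) * box_sum B M y + (\<Sum>i\<in>B. (\<Prod>i\<in>B. y i) * ((-1) ^ card {j \<in> B. j < i} * y i ^ M * (1 - y i) *
        (\<Prod>j\<in>B - {i}. 1 - y i * y j) * box_sum (B - {i}) M y)) = (\<Prod>i\<in>B. y i) * box_sum B (Suc M) y"
    proof -
      have "inj_on y B" using inj Suc.prems by (rule inj_on_subset)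
      moreover have "y i > 0" if "i \<in> B" for i using pos Suc.prems that by auto
      ultimately have "box_sum B (Suc M) y = box_sum B M y +
          (\<Sum>i\<in>B. (-1) ^ card {j \<in> B. j < i} * y i ^ M * (1 - y i) *
            (\<Prod>j\<in>B - {i}. 1 - y i * y j) * box_sum (B - {i}) M y)"
        using fin by (intro box_sum_Suc) force+
      then show ?thesis by (simp only: sum_distrib_left distrib_left)
    qed
    finally show ?case by (simp only: G_def)
  qed
  then show ?thesis by simp
qed

subsection \<open>Interlacing steps\<close>

text \<open>A partition with \<open>r\<close> parts \<open>\<lambda>\<^sub>0 \<ge> \<dots> \<ge> \<lambda>\<^sub>r\<^sub>-\<^sub>1 \<ge> 0\<close> is encoded by the strictly decreasing list of
  the positions \<open>\<lambda>\<^sub>j + r - j \<ge> 1\<close>.  The partitions that interlace it then form a product of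
  intervals: \<open>gl_ranges\<close> if they have one part less, \<open>sp_ranges\<close> if they have equally many, where
  the position 0 bounds the last interval.\<close>

definition gl_ranges :: "nat list \<Rightarrow> nat set list" where
  "gl_ranges l = map (\<lambda>(a, b). {b..<a}) (zip l (tl l))"

definition sp_ranges :: "nat list \<Rightarrow> nat set list" where
  "sp_ranges l = map (\<lambda>(a, b). {b<..a}) (zip l (tl l @ [0]))"

text \<open>The entries of a position list add up to the size of the partition plus a number
  depending only on the length. So, up to a fixed power of \<open>z\<close>, the exponent is the
  growth in size. Written as a quotient, the weight splits over the columns.\<close>

definition gl_step :: "real \<Rightarrow> (nat list \<Rightarrow> real) \<Rightarrow> nat list \<Rightarrow> real" where
  "gl_step z f l = (\<Sum>m\<in>listset (gl_ranges l). z ^ sum_list l / z ^ sum_list m * f m)"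

definition sp_step :: "real \<Rightarrow> (nat list \<Rightarrow> real) \<Rightarrow> nat list \<Rightarrow> real" where
  "sp_step z f l = (\<Sum>m\<in>listset (sp_ranges l). z ^ sum_list l / z ^ sum_list m * f m)"

lemma listset_iff: "m \<in> listset Rs \<longleftrightarrow> list_all2 (\<in>) m Rs"
proof (induction Rs arbitrary: m)
  case (Cons R Rs)
  then show ?case by (cases m) (auto simp: set_Cons_def)
qed simp

lemma strict_partition_Cons:
  "strict_partition (a # l) \<longleftrightarrow> 0 < a \<and> (\<forall>x\<in>set l. x < a) \<and> strict_partition l"
  by (auto simp: strict_partition_def)

lemma gl_ranges_strict:
  assumes "strict_partition l" "m \<in> listset (gl_ranges l)"
  shows "strict_partition m \<and> length m = length l - 1 \<and> (\<forall>x\<in>set m. x < hd l)"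
  using assms
proof (induction l arbitrary: m)
  case Nil
  then show ?case by (simp add: gl_ranges_def strict_partition_def)
next
  case (Cons a l)
  show ?case
  proof (cases l)
    case Nil
    then show ?thesis using Cons.prems by (simp add: gl_ranges_def strict_partition_def)
  next
    case (Cons b l')
    then obtain x m' where m: "m = x # m'" "x \<in> {b..<a}" "m' \<in> listset (gl_ranges l)"
      using Cons.prems(2) by (auto simp: gl_ranges_def set_Cons_def)
    have "strict_partition m' \<and> length m' = length l - 1 \<and> (\<forall>x\<in>set m'. x < hd l)"
      using m(3) Cons.prems(1) by (intro Cons.IH) (auto simp: strict_partition_Cons)
    then show ?thesis
      using m Cons Cons.prems(1) by (auto simp: strict_partition_Cons)
  qed
qed

lemma sp_ranges_strict:
  assumes "strict_partition l" "m \<in> listset (sp_ranges l)"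
  shows "strict_partition m \<and> length m = length l \<and> (\<forall>x\<in>set m. x \<le> hd l)"
  using assms
proof (induction l arbitrary: m)
  case Nil
  then show ?case by (simp add: sp_ranges_def strict_partition_def)
next
  case (Cons a l)
  show ?case
  proof (cases l)
    case Nil
    then show ?thesis
      using Cons.prems by (cases m) (auto simp: sp_ranges_def strict_partition_def listset_iff)
  next
    case (Cons b l')
    then obtain x m' where m: "m = x # m'" "x \<in> {b<..a}" "m' \<in> listset (sp_ranges l)"
      using Cons.prems(2) by (auto simp: sp_ranges_def set_Cons_def)
    have "strict_partition m' \<and> length m' = length l \<and> (\<forall>x\<in>set m'. x \<le> hd l)"
      using m(3) Cons.prems(1) by (intro Cons.IH) (auto simp: strict_partition_Cons)
    then show ?thesis
      using m Cons Cons.prems(1) by (fastforce simp: strict_partition_Cons)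
  qed
qed

section \<open>Alternants of differences of consecutive columns\<close>

lemma alt_Cons_subtract:
  assumes "finite A"
  shows "alt A (c # d # cs) = alt A ((\<lambda>i. c i - d i) # d # cs)"
  using alt_repeated[OF assms, of d "d # cs"] by (simp only: alt_Cons_diff) simp

text \<open>Subtracting from each column its successor clears the row of ones except for the last
  entry. As \<open>r\<close> exceeds every index in \<open>A\<close>, this entry sits in the bottom
  corner and is expanded without a sign.\<close>

lemma alt_insert_ones:
  assumes "finite A" "\<And>i. i \<in> A \<Longrightarrow> i < r" "\<And>v. F v r = 1" "l \<noteq> []"
  shows "alt (insert r A) (map F l) = alt A (map (\<lambda>(a, b) i. F a i - F b i) (zip l (tl l)))"
  using assms(1,2,4)
proof (induction l arbitrary: A)
  case (Cons a l)
  have notin: "r \<notin> A" using Cons.prems(2) by blast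
  show ?case
  proof (cases l)
    case Nil
    show ?thesis
    proof (cases "A = {}")
      case True
      then show ?thesis using Nil assms(3) by (simp cong: conj_cong)
    next
      case False
      then have "insert r A - {i} \<noteq> {}" for i using notin by auto
      then have "alt (insert r A) [F a] = 0"
        unfolding alt.simps by (intro sum.neutral) simp
      then show ?thesis using False Nil by (simp del: alt.simps(2))
    qed
  next
    case (Cons b l')
    let ?cs = "map (\<lambda>(a, b) i. F a i - F b i) (zip l (tl l))"
    have card: "card {j \<in> insert r A. j < i} = card {j \<in> A. j < i}" if "i \<in> A" for i
      using Cons.prems(2)[OF that] by (intro arg_cong[of _ _ card]) auto
    have IH: "alt (insert r A - {i}) (map F l) = alt (A - {i}) ?cs" if "i \<in> A" for i
    proof -
      have "insert r A - {i} = insert r (A - {i})" using that notin by auto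
      then show ?thesis using Cons.IH[of "A - {i}"] Cons.prems Cons by simp
    qed
    have "alt (insert r A) (map F (a # l)) = alt (insert r A) ((\<lambda>i. F a i - F b i) # map F l)"
      using alt_Cons_subtract[of "insert r A" "F a" "F b" "map F l'"] Cons.prems(1) Cons by (simp del: alt.simps)
    also have "\<dots> = (\<Sum>i\<in>A. (-1) ^ card {j \<in> insert r A. j < i} * (F a i - F b i) * alt (insert r A - {i}) (map F l))"
      unfolding alt.simps using Cons.prems(1) notin assms(3) by (subst sum.insert) auto
    also have "\<dots> = alt A ((\<lambda>i. F a i - F b i) # ?cs)"
      unfolding alt.simps by (intro sum.cong refl) (simp only: card IH)
    finally show ?thesis using Cons by simp
  qed
qed simp

text \<open>The last column has no successor, but position 0 can serve as one because its column
  vanishes; the size is kept.\<close>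

lemma alt_differences:
  assumes "finite A" "\<And>i. i \<in> A \<Longrightarrow> F (0 :: nat) i = 0"
  shows "alt A (map F l) = alt A (map (\<lambda>(a, b) i. F a i - F b i) (zip l (tl l @ [0])))"
  using assms
proof (induction l arbitrary: A)
  case (Cons a l)
  show ?case
  proof (cases l)
    case Nil
    then show ?thesis using Cons.prems by simp
  next
    case (Cons b l')
    let ?cs = "map (\<lambda>(a, b) i. F a i - F b i) (zip l (tl l @ [0]))"
    have IH: "alt (A - {i}) (map F l) = alt (A - {i}) ?cs" for i
      using Cons.prems by (intro Cons.IH) auto
    have "alt A (map F (a # l)) = alt A ((\<lambda>i. F a i - F b i) # map F l)"
      using alt_Cons_subtract[of A "F a" "F b" "map F l'"] Cons.prems(1) Cons by (simp del: alt.simps)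
    also have "\<dots> = alt A ((\<lambda>i. F a i - F b i) # ?cs)"
      unfolding alt.simps IH ..
    finally show ?thesis using Cons by simp
  qed
qed simp

lemma prod_list_power: "prod_list (map (\<lambda>v. z ^ v) l) = (z :: real) ^ sum_list l"
  by (induction l) (simp_all add: power_add)

lemma sorted_zip_tl:
  assumes "strict_partition l" "(a, b) \<in> set (zip l (tl l))"
  shows "b < a"
  using assms
proof (induction l)
  case (Cons x l)
  then show ?case by (cases l) (auto simp: strict_partition_Cons)
qed simp

lemma sorted_zip_tl_0:
  assumes "strict_partition l" "(a, b) \<in> set (zip l (tl l @ [0]))"
  shows "b < a"
  using assms
proof (induction l)
  case (Cons x l)
  then show ?case by (cases l) (auto simp: strict_partition_Cons)
qed simp

lemma step_alt:
  assumes "z \<noteq> 0" "\<And>m. m \<in> listset Rs \<Longrightarrow> f m = c * alt A (map g m)"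
  shows "(\<Sum>m\<in>listset Rs. z ^ sum_list l / z ^ sum_list m * f m) =
    c * (z ^ sum_list l * alt A (map (\<lambda>R i. \<Sum>v\<in>R. g v i / z ^ v) Rs))"
proof -
  have "(\<Sum>m\<in>listset Rs. z ^ sum_list l / z ^ sum_list m * f m) =
      (\<Sum>m\<in>listset Rs. c * (z ^ sum_list l * alt A (map (\<lambda>v i. g v i / z ^ v) m)))"
  proof (intro sum.cong refl)
    fix m assume m: "m \<in> listset Rs"
    have "alt A (map (\<lambda>v i. g v i / z ^ v) m) = alt A (map (\<lambda>v i. (1 / z) ^ v * g v i) m)"
      by (simp add: power_one_over)
    also have "\<dots> = (1 / z) ^ sum_list m * alt A (map g m)"
      by (simp add: alt_scale_cols prod_list_power)
    finally show "z ^ sum_list l / z ^ sum_list m * f m =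
        c * (z ^ sum_list l * alt A (map (\<lambda>v i. g v i / z ^ v) m))"
      by (simp add: assms(2)[OF m] power_one_over)
  qed
  also have "\<dots> = c * (z ^ sum_list l * alt A (map (\<lambda>R i. \<Sum>v\<in>R. g v i / z ^ v) Rs))"
    by (simp only: sum_distrib_left[symmetric] sum_listset_alt)
  finally show ?thesis .
qed

text \<open>The recurrence says that \<open>h v i / z ^ v\<close> has the increments
  \<open>g v i / z ^ v\<close>, so the sum over each interval telescopes. The resulting column
  differences merge into one larger determinant, whose new row \<open>z ^ v\<close> is the row of
  ones before rescaling.\<close>

lemma gl_step_alt:
  assumes "finite A" "\<And>i. i \<in> A \<Longrightarrow> i < r" "z \<noteq> 0" "strict_partition l" "l \<noteq> []"
    and "\<And>m. m \<in> listset (gl_ranges l) \<Longrightarrow> f m = c * alt A (map g m)"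
    and "\<And>v i. i \<in> A \<Longrightarrow> h (Suc v) i - z * h v i = z * g v i" "\<And>v. h v r = z ^ v"
  shows "gl_step z f l = c * alt (insert r A) (map h l)"
proof -
  define F where "F v i = h v i / z ^ v" for v i
  have tele: "g v i / z ^ v = F (Suc v) i - F v i" if "i \<in> A" for v i
  proof -
    have "h (Suc v) i = z * h v i + z * g v i" using assms(7)[OF that, of v] by simp
    then show ?thesis using assms(3) by (simp add: F_def field_simps)
  qed
  have "alt A (map (\<lambda>R i. \<Sum>v\<in>R. g v i / z ^ v) (gl_ranges l)) =
      alt A (map (\<lambda>(a, b) i. F a i - F b i) (zip l (tl l)))"
    unfolding gl_ranges_def map_map
  proof (intro alt_map_cong assms(1))
    fix p i assume p: "p \<in> set (zip l (tl l))" and i: "i \<in> A"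
    obtain a b where [simp]: "p = (a, b)" by (cases p)
    have "b \<le> a" using sorted_zip_tl[OF assms(4)] p by fastforce
    then show "((\<lambda>R i. \<Sum>v\<in>R. g v i / z ^ v) \<circ> (\<lambda>(a, b). {b..<a})) p i = (case p of (a, b) \<Rightarrow> \<lambda>i. F a i - F b i) i"
      using sum_Suc_diff'[of b a "\<lambda>v. F v i"] by (simp add: tele[OF i])
  qed
  also have "\<dots> = alt (insert r A) (map F l)"
    using assms by (intro alt_insert_ones[symmetric]) (auto simp: F_def)
  finally have "gl_step z f l = c * (z ^ sum_list l * alt (insert r A) (map F l))"
    unfolding gl_step_def using step_alt[OF assms(3,6)] by simp
  also have "z ^ sum_list l * alt (insert r A) (map F l) = alt (insert r A) (map (\<lambda>v i. z ^ v * F v i) l)"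
    by (simp add: alt_scale_cols prod_list_power)
  also have "(\<lambda>v i. z ^ v * F v i) = h"
    using assms(3) by (simp add: F_def)
  finally show ?thesis .
qed

text \<open>As in \<open>gl_step_alt\<close>, but the intervals are open on the left, hence the
  shifted index of \<open>g\<close>; the initial value 0 provides the column for position 0, so no
  row is added.\<close>

lemma sp_step_alt:
  assumes "finite A" "z \<noteq> 0" "strict_partition l"
    and "\<And>m. m \<in> listset (sp_ranges l) \<Longrightarrow> f m = c * alt A (map g m)"
    and "\<And>v i. i \<in> A \<Longrightarrow> h (Suc v) i - z * h v i = g (Suc v) i" "\<And>i. i \<in> A \<Longrightarrow> h 0 i = 0"
  shows "sp_step z f l = c * alt A (map h l)"
proof -
  define F where "F v i = h v i / z ^ v" for v i
  have tele: "g (Suc v) i / z ^ Suc v = F (Suc v) i - F v i" if "i \<in> A" for v i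
  proof -
    have "h (Suc v) i = z * h v i + g (Suc v) i" using assms(5)[OF that, of v] by simp
    then show ?thesis using assms(2) by (simp add: F_def field_simps)
  qed
  have "alt A (map (\<lambda>R i. \<Sum>v\<in>R. g v i / z ^ v) (sp_ranges l)) =
      alt A (map (\<lambda>(a, b) i. F a i - F b i) (zip l (tl l @ [0])))"
    unfolding sp_ranges_def map_map
  proof (intro alt_map_cong assms(1))
    fix p i assume p: "p \<in> set (zip l (tl l @ [0]))" and i: "i \<in> A"
    obtain a b where [simp]: "p = (a, b)" by (cases p)
    have "b \<le> a" using sorted_zip_tl_0[OF assms(3)] p by fastforce
    moreover have "(\<Sum>v\<in>{b<..a}. g v i / z ^ v) = (\<Sum>v\<in>{b..<a}. g (Suc v) i / z ^ Suc v)"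
      by (rule sum.reindex_bij_witness[of _ Suc "\<lambda>v. v - 1"]) auto
    ultimately show "((\<lambda>R i. \<Sum>v\<in>R. g v i / z ^ v) \<circ> (\<lambda>(a, b). {b<..a})) p i = (case p of (a, b) \<Rightarrow> \<lambda>i. F a i - F b i) i"
      using sum_Suc_diff'[of b a "\<lambda>v. F v i"] by (simp only: tele[OF i] o_apply prod.case \<open>p = (a, b)\<close>)
  qed
  also have "\<dots> = alt A (map F l)"
    using assms by (intro alt_differences[symmetric]) (auto simp: F_def)
  finally have "sp_step z f l = c * (z ^ sum_list l * alt A (map F l))"
    unfolding sp_step_def using step_alt[OF assms(2,4)] by simp
  also have "z ^ sum_list l * alt A (map F l) = alt A (map (\<lambda>v i. z ^ v * F v i) l)"
    by (simp add: alt_scale_cols prod_list_power)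
  also have "(\<lambda>v i. z ^ v * F v i) = h"
    using assms(2) by (simp add: F_def)
  finally show ?thesis .
qed

text \<open>Two steps share one variable with opposite exponents: up to a monomial this is the
  weighted sum over symplectic (Zhelobenko) patterns.\<close>

primrec sp_weight :: "(nat \<Rightarrow> real) \<Rightarrow> nat \<Rightarrow> nat list \<Rightarrow> real" where
  "sp_weight z 0 = (\<lambda>l. 1)"
| "sp_weight z (Suc r) = sp_step (1 / z r) (gl_step (z r) (sp_weight z r))"

primrec gl_weight :: "(nat \<Rightarrow> real) \<Rightarrow> nat \<Rightarrow> nat \<Rightarrow> nat list \<Rightarrow> real" where
  "gl_weight z k 0 = sp_weight z k"
| "gl_weight z k (Suc d) = gl_step (z (k + d)) (gl_weight z k d)"

text \<open>Invariant under \<open>y \<mapsto> 1 / y\<close>: a factor that depends on a variable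
  only through this function is blind to sign changes.\<close>

definition joukowsky :: "real \<Rightarrow> real" where
  "joukowsky y = y + 1 / y"

lemma joukowsky_diff: "y \<noteq> 0 \<Longrightarrow> z \<noteq> 0 \<Longrightarrow> joukowsky y - joukowsky z = (y - z) * (y - 1 / z) / y"
  by (simp add: joukowsky_def field_simps)

text \<open>The step with \<open>z r\<close> multiplies \<open>x ^ v\<close>, for \<open>x\<close>
  either \<open>z i\<close> or its inverse, by \<open>z r / (x - z r)\<close>, so the two powers in
  a row get different factors. The step with \<open>1 / z r\<close> multiplies by
  \<open>x / (x - 1 / z r)\<close>, and the product of both factors depends on
  \<open>joukowsky x\<close> only, which restores the form of the row.\<close>

lemma sp_weight_alt:
  assumes "inj_on z {..<k}" "\<And>i. i < k \<Longrightarrow> z i > 1" "r \<le> k"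
  shows "\<exists>c. \<forall>l. strict_partition l \<longrightarrow> length l = r \<longrightarrow>
    sp_weight z r l = c * alt {..<r} (map (\<lambda>v i. z i ^ v - (1 / z i) ^ v) l)"
  using assms(3)
proof (induction r)
  case 0
  then show ?case by (auto intro: exI[of _ 1])
next
  case (Suc r)
  then obtain c where c: "\<And>l. strict_partition l \<Longrightarrow> length l = r \<Longrightarrow>
      sp_weight z r l = c * alt {..<r} (map (\<lambda>v i. z i ^ v - (1 / z i) ^ v) l)"
    by auto
  define h where "h v i = (if i = r then z r ^ v else
    z r * (z i ^ v / (z i - z r) - (1 / z i) ^ v / (1 / z i - z r)))" for v i
  \<comment> \<open>Row \<open>r\<close> enters with the bare power \<open>z r ^ v\<close>. The
    inverse power solves the homogeneous recurrence of the second step and is subtracted to attain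
    the initial value 0.\<close>
  define s where "s i = (if i = r then z r / (z r - 1 / z r) else z r / (joukowsky (z i) - joukowsky (z r)))" for i
  have zr: "z r > 1" using assms(2) Suc.prems by simp
  have gt: "z i > 1" "z i \<noteq> z r" "1 / z i < z r" if "i < r" for i
  proof -
    show "z i > 1" using assms(2)[of i] that Suc.prems by simp
    then have "1 / z i < 1" by simp
    then show "1 / z i < z r" using zr by linarith
    show "z i \<noteq> z r" using inj_onD[OF assms(1), of i r] that Suc.prems by auto
  qed
  have 1: "gl_step (z r) (sp_weight z r) m = c * alt {..<Suc r} (map h m)"
    if "strict_partition m" "length m = Suc r" for m
    unfolding lessThan_Suc
  proof (rule gl_step_alt)
    fix m' assume "m' \<in> listset (gl_ranges m)"
    then have "strict_partition m' \<and> length m' = length m - 1" using gl_ranges_strict that(1) by blast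
    then show "sp_weight z r m' = c * alt {..<r} (map (\<lambda>v i. z i ^ v - (1 / z i) ^ v) m')"
      using c that by simp
  next
    fix v i assume i: "i \<in> {..<r}"
    have *: "x ^ Suc v / (x - z r) - z r * (x ^ v / (x - z r)) = x ^ v" if "x \<noteq> z r" for x
      using that by (simp add: diff_divide_distrib[symmetric] left_diff_distrib[symmetric])
    have "h (Suc v) i - z r * h v i = z r * ((z i ^ Suc v / (z i - z r) - z r * (z i ^ v / (z i - z r))) -
        ((1 / z i) ^ Suc v / (1 / z i - z r) - z r * ((1 / z i) ^ v / (1 / z i - z r))))"
      using i by (simp only: h_def) (simp add: right_diff_distrib)
    also have "\<dots> = z r * (z i ^ v - (1 / z i) ^ v)"
      using gt[of i] i by (subst (1 2) *) auto
    finally show "h (Suc v) i - z r * h v i = z r * (z i ^ v - (1 / z i) ^ v)" .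
  qed (use that zr in \<open>auto simp: h_def\<close>)
  have 2: "sp_weight z (Suc r) l = c * alt {..<Suc r} (map (\<lambda>v i. s i * (z i ^ v - (1 / z i) ^ v)) l)"
    if "strict_partition l" "length l = Suc r" for l
    unfolding sp_weight.simps
  proof (rule sp_step_alt)
    fix m assume "m \<in> listset (sp_ranges l)"
    then have "strict_partition m \<and> length m = length l" using sp_ranges_strict that(1) by blast
    then show "gl_step (z r) (sp_weight z r) m = c * alt {..<Suc r} (map h m)"
      using 1 that by simp
  next
    fix v i assume i: "i \<in> {..<Suc r}"
    have zi: "z i > 1" using gt[of i] zr i by (cases "i = r") auto
    have eq: "s i * (z i ^ Suc v - (1 / z i) ^ Suc v) - 1 / z r * (s i * (z i ^ v - (1 / z i) ^ v)) =
        s i * (z i - 1 / z r) * z i ^ v - s i * (1 / z i - 1 / z r) * (1 / z i) ^ v"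
      by (simp add: algebra_simps)
    show "s i * (z i ^ Suc v - (1 / z i) ^ Suc v) - 1 / z r * (s i * (z i ^ v - (1 / z i) ^ v)) = h (Suc v) i"
    proof (cases "i = r")
      case True
      have "z r - 1 / z r \<noteq> 0"
        using zr by (simp add: field_simps) (metis less_1_mult less_irrefl)
      then show ?thesis using True unfolding eq by (simp add: s_def h_def)
    next
      case False
      then have "i < r" using i by auto
      note g = gt[OF this]
      have nz: "1 / z r < z i" "z i - 1 / z r \<noteq> 0" "z i - z r \<noteq> 0" "1 / z i - z r \<noteq> 0" "1 / z i - 1 / z r \<noteq> 0"
      proof -
        have "1 / z r < 1" using zr by simp
        then show "1 / z r < z i" using g(1) by linarith
        then show "z i - 1 / z r \<noteq> 0" by simp
        show "z i - z r \<noteq> 0" "1 / z i - z r \<noteq> 0" "1 / z i - 1 / z r \<noteq> 0" using g by auto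
      qed
      have a: "s i * (z i - 1 / z r) = z r * z i / (z i - z r)"
        unfolding s_def using False joukowsky_diff[of "z i" "z r"] g(1) zr nz by simp
      have "joukowsky (z i) - joukowsky (z r) = joukowsky (1 / z i) - joukowsky (z r)"
        by (simp add: joukowsky_def)
      also have "\<dots> = (1 / z i - z r) * (1 / z i - 1 / z r) / (1 / z i)"
        using joukowsky_diff[of "1 / z i" "z r"] g(1) zr by simp
      finally have b: "s i * (1 / z i - 1 / z r) = z r * (1 / z i) / (1 / z i - z r)"
        unfolding s_def using False nz by simp
      show ?thesis
        unfolding eq a b using False by (simp add: h_def algebra_simps)
    qed
  qed (use that zr in auto)
  show ?case
  proof (intro exI allI impI)
    fix l :: "nat list" assume "strict_partition l" "length l = Suc r"
    then show "sp_weight z (Suc r) l = (c * (\<Prod>i<Suc r. s i)) * alt {..<Suc r} (map (\<lambda>v i. z i ^ v - (1 / z i) ^ v) l)"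
      using 2[of l] alt_scale_rows[of "{..<Suc r}" s "\<lambda>v i. z i ^ v - (1 / z i) ^ v" l] by simp
  qed
qed

text \<open>Each new variable \<open>z j\<close> multiplies \<open>y ^ v\<close> by
  \<open>z j / (y - z j)\<close>. In the rows \<open>i < k\<close> the two powers get different
  factors, which \<open>a\<close> collects; any other row has a single power, whose factor moves
  into the constant.\<close>

lemma gl_weight_alt:
  fixes z :: "nat \<Rightarrow> real" and k :: nat
  defines "a \<equiv> \<lambda>d y. \<Prod>j\<in>{k..<k + d}. z j / (y - z j)"
  assumes "inj_on z {..<n}" "\<And>i. i < n \<Longrightarrow> z i > 1" "k + d \<le> n"
  shows "\<exists>c. \<forall>l. strict_partition l \<longrightarrow> length l = k + d \<longrightarrow> gl_weight z k d l =
    c * alt {..<k + d} (map (\<lambda>v i. if i < k then a d (z i) * z i ^ v - a d (1 / z i) * (1 / z i) ^ v else z i ^ v) l)"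
  using assms(4)
proof (induction d)
  case 0
  have "\<exists>c. \<forall>l. strict_partition l \<longrightarrow> length l = k \<longrightarrow>
    sp_weight z k l = c * alt {..<k} (map (\<lambda>v i. z i ^ v - (1 / z i) ^ v) l)"
    using 0 assms by (intro sp_weight_alt[of z k]) (auto intro: inj_on_subset)
  moreover have "alt {..<k} (map (\<lambda>v i. if i < k then a 0 (z i) * z i ^ v - a 0 (1 / z i) * (1 / z i) ^ v else z i ^ v) l) =
      alt {..<k} (map (\<lambda>v i. z i ^ v - (1 / z i) ^ v) l)" for l
    by (intro alt_map_cong) (auto simp: a_def)
  ultimately show ?case by simp
next
  case (Suc d)
  define r where "r = k + d"
  define g where "g d v i = (if i < k then a d (z i) * z i ^ v - a d (1 / z i) * (1 / z i) ^ v else z i ^ v)" for d v i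
  obtain c where c: "\<And>l. strict_partition l \<Longrightarrow> length l = r \<Longrightarrow> gl_weight z k d l = c * alt {..<r} (map (g d) l)"
    using Suc unfolding g_def r_def by auto
  define s where "s i = (if i < k \<or> i = r then 1 else z r / (z i - z r))" for i
  have r: "r < n" "k \<le> r" using Suc.prems by (auto simp: r_def)
  have zr: "z r > 1" using assms(3) r by simp
  have gt: "z i > 1" "z i \<noteq> z r" "1 / z i < z r" if "i < r" for i
  proof -
    show "z i > 1" using assms(3)[of i] that r by simp
    then have "1 / z i < 1" by simp
    then show "1 / z i < z r" using zr by linarith
    show "z i \<noteq> z r" using inj_onD[OF assms(2), of i r] that r by auto
  qed
  have a: "a (Suc d) y = z r / (y - z r) * a d y" for y
    by (simp add: a_def r_def prod.atLeastLessThan_Suc)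
  have "gl_weight z k (Suc d) l = c * alt {..<Suc r} (map (\<lambda>v i. s i * g (Suc d) v i) l)"
    if "strict_partition l" "length l = Suc r" for l
    unfolding gl_weight.simps lessThan_Suc r_def[symmetric]
  proof (rule gl_step_alt)
    fix m assume "m \<in> listset (gl_ranges l)"
    then have "strict_partition m \<and> length m = length l - 1" using gl_ranges_strict that(1) by blast
    then show "gl_weight z k d m = c * alt {..<r} (map (g d) m)"
      using c that by simp
  next
    fix v i assume i: "i \<in> {..<r}"
    have *: "z r / (x - z r) * x ^ Suc v - z r * (z r / (x - z r) * x ^ v) = z r * x ^ v" if "x \<noteq> z r" for x
    proof -
      have "z r / (x - z r) * x ^ Suc v - z r * (z r / (x - z r) * x ^ v) = z r * x ^ v * ((x - z r) / (x - z r))"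
        unfolding divide_inverse power_Suc by (simp only: algebra_simps)
      then show ?thesis using that by simp
    qed
    show "s i * g (Suc d) (Suc v) i - z r * (s i * g (Suc d) v i) = z r * g d v i"
    proof (cases "i < k")
      case True
      then have "s i * g (Suc d) (Suc v) i - z r * (s i * g (Suc d) v i) =
        a d (z i) * (z r / (z i - z r) * z i ^ Suc v - z r * (z r / (z i - z r) * z i ^ v)) -
        a d (1 / z i) * (z r / (1 / z i - z r) * (1 / z i) ^ Suc v - z r * (z r / (1 / z i - z r) * (1 / z i) ^ v))"
        by (simp only: g_def s_def a if_True simp_thms) (simp only: algebra_simps mult_1_left)
      also have "\<dots> = a d (z i) * (z r * z i ^ v) - a d (1 / z i) * (z r * (1 / z i) ^ v)"
        using gt[of i] i by (subst (1 2) *) auto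
      finally show ?thesis using True by (simp add: g_def algebra_simps)
    next
      case False
      then show ?thesis using *[of "z i"] gt[of i] i by (simp add: g_def s_def)
    qed
  next
    show "s r * g (Suc d) v r = z r ^ v" for v
      using r by (simp add: s_def g_def)
  qed (use that zr in auto)
  then have "gl_weight z k (Suc d) l = (c * (\<Prod>i<Suc r. s i)) * alt {..<Suc r} (map (g (Suc d)) l)"
    if "strict_partition l" "length l = Suc r" for l
    using that alt_scale_rows[of "{..<Suc r}" s "g (Suc d)" l] by (simp only: mult.assoc finite_lessThan)
  then have "\<exists>c. \<forall>l. strict_partition l \<longrightarrow> length l = k + Suc d \<longrightarrow>
      gl_weight z k (Suc d) l = c * alt {..<k + Suc d} (map (g (Suc d)) l)"
    by (intro exI[of _ "c * (\<Prod>i<Suc r. s i)"]) (simp only: r_def add_Suc_right, blast)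
  then show ?case unfolding g_def .
qed

subsection \<open>Factorization of the generating function\<close>

text \<open>A recursion over columns hides linearity in a row: row \<open>r\<close> is used once,
  either by the current column or inside the minor.\<close>

lemma alt_add_row:
  assumes "finite A" "r \<in> A"
  shows "alt A (map (\<lambda>v i. if i = r then f v i + g v i else f v i) l) =
    alt A (map f l) + alt A (map (\<lambda>v i. if i = r then g v i else f v i) l)"
  using assms
proof (induction l arbitrary: A)
  case (Cons v l)
  let ?s = "\<lambda>i. (-1) ^ card {j \<in> A. j < i} :: real"
  let ?h = "\<lambda>v i. if i = r then f v i + g v i else f v i"
  let ?g = "\<lambda>v i. if i = r then g v i else f v i"
  have r: "alt (A - {r}) (map ?h l) = alt (A - {r}) (map f l)" "alt (A - {r}) (map ?g l) = alt (A - {r}) (map f l)"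
    using Cons.prems(1) by (auto intro!: alt_map_cong split: if_splits)
  have "(\<Sum>i\<in>A - {r}. ?s i * f v i * alt (A - {i}) (map ?h l)) =
      (\<Sum>i\<in>A - {r}. ?s i * f v i * alt (A - {i}) (map f l)) + (\<Sum>i\<in>A - {r}. ?s i * f v i * alt (A - {i}) (map ?g l))"
    unfolding sum.distrib[symmetric]
  proof (intro sum.cong refl)
    fix i assume "i \<in> A - {r}"
    then have "alt (A - {i}) (map ?h l) = alt (A - {i}) (map f l) + alt (A - {i}) (map ?g l)"
      using Cons.prems by (intro Cons.IH) auto
    then show "?s i * f v i * alt (A - {i}) (map ?h l) =
        ?s i * f v i * alt (A - {i}) (map f l) + ?s i * f v i * alt (A - {i}) (map ?g l)"
      by (simp only: distrib_left)
  qed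
  moreover have "(\<Sum>i\<in>A - {r}. ?s i * ?h v i * alt (A - {i}) (map ?h l)) = (\<Sum>i\<in>A - {r}. ?s i * f v i * alt (A - {i}) (map ?h l))"
    "(\<Sum>i\<in>A - {r}. ?s i * ?g v i * alt (A - {i}) (map ?g l)) = (\<Sum>i\<in>A - {r}. ?s i * f v i * alt (A - {i}) (map ?g l))"
    by (intro sum.cong refl, simp)+
  ultimately show ?case
    unfolding list.map alt.simps sum.remove[OF Cons.prems] r
    by (simp only: if_True refl distrib_left distrib_right)
qed auto

lemma alt_expand_rows:
  assumes "finite A" "finite K" "K \<subseteq> A"
  shows "alt A (map (\<lambda>v i. if i \<in> K then f v i + g v i else f v i) l) =
    (\<Sum>X\<in>Pow K. alt A (map (\<lambda>v i. if i \<in> X then g v i else f v i) l))"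
  using assms(2,3)
proof (induction K arbitrary: f)
  case (insert r K)
  define f' where "f' v i = (if i = r then g v i else f v i)" for v i
  have "(\<lambda>v i. if i \<in> insert r K then f v i + g v i else f v i) =
      (\<lambda>v i. if i = r then (if i \<in> K then f v i + g v i else f v i) + g v i else (if i \<in> K then f v i + g v i else f v i))"
    using insert.hyps by (auto simp: fun_eq_iff)
  then have "alt A (map (\<lambda>v i. if i \<in> insert r K then f v i + g v i else f v i) l) =
      alt A (map (\<lambda>v i. if i \<in> K then f v i + g v i else f v i) l) +
      alt A (map (\<lambda>v i. if i = r then g v i else (if i \<in> K then f v i + g v i else f v i)) l)"
    using alt_add_row[OF assms(1), of r "\<lambda>v i. if i \<in> K then f v i + g v i else f v i" g l] insert.prems by simp
  also have "(\<lambda>v i. if i = r then g v i else (if i \<in> K then f v i + g v i else f v i)) =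
      (\<lambda>v i. if i \<in> K then f' v i + g v i else f' v i)"
    using insert.hyps by (auto simp: fun_eq_iff f'_def)
  also have "alt A (map (\<lambda>v i. if i \<in> K then f v i + g v i else f v i) l) =
      (\<Sum>X\<in>Pow K. alt A (map (\<lambda>v i. if i \<in> X then g v i else f v i) l))"
    using insert.prems by (intro insert.IH) auto
  also have "alt A (map (\<lambda>v i. if i \<in> K then f' v i + g v i else f' v i) l) =
      (\<Sum>X\<in>Pow K. alt A (map (\<lambda>v i. if i \<in> X then g v i else f' v i) l))"
    using insert.prems by (intro insert.IH) auto
  also have "\<dots> = (\<Sum>X\<in>Pow K. alt A (map (\<lambda>v i. if i \<in> insert r X then g v i else f v i) l))"
    by (intro sum.cong refl arg_cong[of _ _ "alt A"] map_cong) (auto simp: f'_def)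
  also have "\<dots> = (\<Sum>X\<in>insert r ` Pow K. alt A (map (\<lambda>v i. if i \<in> X then g v i else f v i) l))"
    using insert.hyps by (subst sum.reindex) (auto intro!: inj_onI simp: o_def)
  also have "(\<Sum>X\<in>Pow K. alt A (map (\<lambda>v i. if i \<in> X then g v i else f v i) l)) +
      (\<Sum>X\<in>insert r ` Pow K. alt A (map (\<lambda>v i. if i \<in> X then g v i else f v i) l)) =
      (\<Sum>X\<in>Pow (insert r K). alt A (map (\<lambda>v i. if i \<in> X then g v i else f v i) l))"
    unfolding Pow_insert using insert.hyps by (subst sum.union_disjoint) auto
  finally show ?case .
qed simp

lemma pair_prod_both:
  assumes "finite A"
  shows "pair_prod A (\<lambda>i j. y i * y j) = (\<Prod>i\<in>A. y i ^ (card A - 1))"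
  using assms
proof (induction A)
  case (insert a F)
  have "pair_prod (insert a F) (\<lambda>i j. y i * y j) = (\<Prod>j\<in>F. y a * y j) * (\<Prod>i\<in>F. y i ^ (card F - 1))"
    using pair_prod_sym_remove[of "insert a F" a "\<lambda>i j. y i * y j"] insert by (simp add: mult.commute)
  also have "\<dots> = y a ^ card F * (\<Prod>i\<in>F. y i * y i ^ (card F - 1))"
    by (simp add: prod.distrib mult_ac)
  also have "(\<Prod>i\<in>F. y i * y i ^ (card F - 1)) = (\<Prod>i\<in>F. y i ^ card F)"
  proof (intro prod.cong refl)
    fix i assume "i \<in> F"
    then have "card F > 0" using insert.hyps(1) by (auto simp: card_gt_0_iff)
    then show "y i * y i ^ (card F - 1) = y i ^ card F" by (cases "card F") auto
  qed
  finally show ?case using insert.hyps by simp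
qed simp

text \<open>Choosing one of the two powers in every row of \<open>K\<close> leaves an ordinary
  alternant in the variables \<open>flip X z\<close>, to which \<open>alt_sum_powers\<close>
  applies.\<close>

lemma alt_sum_expand_rows:
  assumes "finite A" "K \<subseteq> A"
  shows "alt_sum A M (\<lambda>v i. if i \<in> K then p i * z i ^ v + q i * (1 / z i) ^ v else z i ^ v) =
    (\<Sum>X\<in>Pow K. (\<Prod>i\<in>K. if i \<in> X then q i else p i) * alt_sum A M (\<lambda>v i. flip X z i ^ v))"
proof -
  define f where "f v i = (if i \<in> K then p i else 1) * z i ^ v" for v i
  define g where "g v i = q i * (1 / z i) ^ v" for v i
  have fin: "finite K" using assms by (rule finite_subset[rotated])
  have "(\<lambda>v i. if i \<in> K then p i * z i ^ v + q i * (1 / z i) ^ v else z i ^ v) =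
      (\<lambda>v i. if i \<in> K then f v i + g v i else f v i)"
    by (auto simp: fun_eq_iff f_def g_def)
  then have "alt_sum A M (\<lambda>v i. if i \<in> K then p i * z i ^ v + q i * (1 / z i) ^ v else z i ^ v) =
      (\<Sum>l\<in>decreasing (card A) M. \<Sum>X\<in>Pow K. alt A (map (\<lambda>v i. if i \<in> X then g v i else f v i) l))"
    unfolding alt_sum_def using alt_expand_rows[OF assms(1) fin assms(2), of f g] by simp
  also have "\<dots> = (\<Sum>X\<in>Pow K. \<Sum>l\<in>decreasing (card A) M. alt A (map (\<lambda>v i. if i \<in> X then g v i else f v i) l))"
    by (rule sum.swap)
  also have "\<dots> = (\<Sum>X\<in>Pow K. (\<Prod>i\<in>K. if i \<in> X then q i else p i) * alt_sum A M (\<lambda>v i. flip X z i ^ v))"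
  proof (intro sum.cong refl)
    fix X assume X: "X \<in> Pow K"
    have "alt A (map (\<lambda>v i. if i \<in> X then g v i else f v i) l) =
        (\<Prod>i\<in>K. if i \<in> X then q i else p i) * alt A (map (\<lambda>v i. flip X z i ^ v) l)" for l
    proof -
      have "(\<lambda>v i. if i \<in> X then g v i else f v i) =
          (\<lambda>v i. (if i \<in> K then if i \<in> X then q i else p i else 1) * flip X z i ^ v)"
        using X by (auto simp: fun_eq_iff f_def g_def flip_def power_one_over)
      then show ?thesis
        by (simp only: alt_scale_rows[OF assms(1)] prod_subset_if[OF assms, symmetric])
    qed
    then show "(\<Sum>l\<in>decreasing (card A) M. alt A (map (\<lambda>v i. if i \<in> X then g v i else f v i) l)) =
        (\<Prod>i\<in>K. if i \<in> X then q i else p i) * alt_sum A M (\<lambda>v i. flip X z i ^ v)"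
      by (simp add: alt_sum_def sum_distrib_left)
  qed
  finally show ?thesis .
qed

lemma joukowsky_diff_mult:
  assumes "y \<noteq> 0" "w \<noteq> 0"
  shows "joukowsky y - joukowsky w = (y - w) * (y * w - 1) / (y * w)"
  using assms by (simp add: joukowsky_def field_simps)

text \<open>The factor \<open>w / (y - w)\<close> stems from the branching step with
  \<open>w\<close>, and \<open>1 - y * w\<close> from Macdonald's denominator. Only in combination
  do they depend on the sign choice for \<open>y\<close> merely through the monomial
  \<open>1 / y\<close>.\<close>

lemma cross_factor:
  assumes "y \<noteq> 0" "w \<noteq> 0" "y \<noteq> w" "1 - y * w \<noteq> 0"
  shows "w / (y - w) / (1 - y * w) = 1 / y * (1 / (joukowsky w - joukowsky y))"
proof -
  have "1 / y * (1 / (joukowsky w - joukowsky y)) = w / ((w - y) * (w * y - 1))"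
    using assms(1,2) by (simp add: joukowsky_diff_mult)
  also have "(w - y) * (w * y - 1) = (y - w) * (1 - y * w)"
    by (simp add: algebra_simps)
  finally show ?thesis by simp
qed

text \<open>For two symplectic variables Macdonald's denominator yields the Vandermonde factor
  \<open>y - w\<close> of the flipped variables, from which the second \<open>flip_sum\<close> is
  built.\<close>

lemma inner_factor:
  assumes "y \<noteq> 0" "w \<noteq> 0" "y \<noteq> w" "1 - y * w \<noteq> 0"
  shows "1 / (1 - y * w) = (y - w) * (- 1 / (joukowsky y - joukowsky w)) / (y * w)"
proof -
  have "(y - w) * (- 1 / (joukowsky y - joukowsky w)) / (y * w) = - 1 / (y * w - 1)"
    using assms(1-3) by (simp add: joukowsky_diff_mult)
  also have "\<dots> = - 1 / - (1 - y * w)"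
    by (simp only: minus_diff_eq)
  finally show ?thesis by (simp only: minus_divide_divide)
qed

text \<open>The order of quantifiers matters: \<open>C\<close> is the same for all \<open>m\<close>,
  which allows it to cancel against the case \<open>m = 0\<close>.\<close>

lemma gl_weight_total:
  assumes "k \<le> n" "inj_on z {..<n}" "\<And>i. i < n \<Longrightarrow> z i > 1"
  shows "\<exists>C. \<forall>m. (\<Sum>l\<in>decreasing n (m + n). gl_weight z k (n - k) l) =
    C * box_sum {..<n} (m + n) z * flip_sum {..<k} (\<lambda>i. 1 / z i ^ (m + 2)) z"
proof -
  define a where "a y = (\<Prod>j\<in>{k..<n}. z j / (y - z j))" for y
  define J where "J i = joukowsky (z i)" for i
  have kn: "k + (n - k) = n"
    using assms(1) by simp
  obtain c where c: "\<And>l. strict_partition l \<Longrightarrow> length l = n \<Longrightarrow> gl_weight z k (n - k) l =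
      c * alt {..<n} (map (\<lambda>v i. if i < k then a (z i) * z i ^ v - a (1 / z i) * (1 / z i) ^ v else z i ^ v) l)"
    using gl_weight_alt[OF assms(2,3), of k "n - k", unfolded kn] unfolding a_def by auto
  \<comment> \<open>Everything that depends neither on the sign changes \<open>X\<close> nor on
    \<open>m\<close>.\<close>
  define K where "K = (\<Prod>i\<in>{k..<n}. z i / (1 - z i)) / pair_prod {k..<n} (\<lambda>i j. 1 - z i * z j) *
      (\<Prod>i<k. z i ^ 2 / z i ^ n / (1 - z i)) * (\<Prod>i<k. \<Prod>j\<in>{k..<n}. 1 / (J j - J i)) *
      pair_prod {..<k} (\<lambda>i j. - 1 / (J i - J j))"
  have zn: "z i \<noteq> z j" if "i < n" "j < n" "i \<noteq> j" for i j
    using assms(2) that by (auto simp: inj_on_def)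
  have inv: "1 / z i < 1" "1 / z i > 0" if "i < n" for i
    using assms(3)[OF that] by simp_all
  have inv': "1 / z i < z j" if "i < n" "j < n" for i j
    using inv(1)[OF that(1)] assms(3)[OF that(2)] by linarith
  have flipped: "(\<Prod>i<k. if i \<in> X then - a (1 / z i) else a (z i)) * alt_sum {..<n} (m + n) (\<lambda>v i. flip X z i ^ v) =
      K * box_sum {..<n} (m + n) z * ((\<Prod>i\<in>X. - (1 / z i ^ (m + 2))) * vdm {..<k} (flip X z))"
    if X: "X \<subseteq> {..<k}" for X m
  proof -
    define y where "y = flip X z"
    define e where "e = m + n + n - 1"
    have Xn: "X \<subseteq> {..<n}" using X assms(1) by auto
    have y0: "y i \<noteq> 0" "1 - y i \<noteq> 0" "y i > 0" if "i < n" for i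
      using assms(3)[OF that] inv[OF that] by (auto simp: y_def flip_def)
    have yn: "y i \<noteq> y j" if "i < n" "j < n" "i \<noteq> j" for i j
      using zn[OF that] inv'[of i j] inv'[of j i] that by (auto simp: y_def flip_def)
    have yn': "y i \<noteq> 1 / y j" if "i < n" "j < n" "i \<noteq> j" for i j
      using zn[OF that] inv'[of i j] inv'[of j i] that by (auto simp: y_def flip_def)
    have yy: "1 - y i * y j \<noteq> 0" if "i < n" "j < n" "i \<noteq> j" for i j
      using yn'[OF that] y0[OF that(2)] by (auto simp: field_simps)
    have yz: "y j = z j" if "k \<le> j" for j using X that by (auto simp: y_def flip_def)
    have J: "J i = joukowsky (y i)" for i
      by (auto simp: J_def y_def flip_def joukowsky_def)
    have "box_sum {..<n} (m + n) y = flip_sum {..<n} (flip X (\<lambda>i. z i ^ e)) (flip X z)"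
      by (intro flip_sum_cong) (auto simp: flip_def y_def e_def power_one_over)
    also have "\<dots> = (\<Prod>i\<in>X. - 1 / z i ^ e) * flip_sum {..<n} (\<lambda>i. z i ^ e) z"
      using assms(3) Xn by (intro flip_sum_flip) force+
    finally have box: "box_sum {..<n} (m + n) y = (\<Prod>i\<in>X. - 1 / z i ^ e) * box_sum {..<n} (m + n) z"
      by (simp add: e_def)
    have Y: "{..<n} = {..<k} \<union> {k..<n}" using assms(1) by auto
    have Ypair: "pair_prod {..<n} (\<lambda>i j. 1 - y i * y j) = pair_prod {..<k} (\<lambda>i j. 1 - y i * y j) *
        pair_prod {k..<n} (\<lambda>i j. 1 - z i * z j) * (\<Prod>i<k. \<Prod>j\<in>{k..<n}. 1 - y i * z j)"
      unfolding Y by (subst pair_prod_Un) (auto simp: yz intro!: pair_prod_cong arg_cong2[of _ _ _ _ "(*)"] prod.cong)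
    have Yprod: "(\<Prod>i<n. h i) = (\<Prod>i<k. h i) * (\<Prod>i\<in>{k..<n}. h i)" for h :: "nat \<Rightarrow> real"
      unfolding Y by (subst prod.union_disjoint) auto
    define D where "D = (\<Prod>i<n. 1 - y i) * pair_prod {..<n} (\<lambda>i j. 1 - y i * y j)"
    have "D \<noteq> 0"
    proof -
      have "pair_prod {..<n} (\<lambda>i j. 1 - y i * y j) \<noteq> 0"
        using yy by (intro pair_prod_nonzero) auto
      then show ?thesis unfolding D_def using y0 by auto
    qed
    have "alt_sum {..<n} (m + n) (\<lambda>v i. y i ^ v) * D = (\<Prod>i<n. y i) * box_sum {..<n} (m + n) y"
      unfolding D_def y_def using assms Xn by (intro alt_sum_powers) auto
    then have alt: "alt_sum {..<n} (m + n) (\<lambda>v i. y i ^ v) =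
        (\<Prod>i<n. y i) * (\<Prod>i\<in>X. - 1 / z i ^ e) / D * box_sum {..<n} (m + n) z"
      using \<open>D \<noteq> 0\<close> box by (simp add: field_simps)
    have cross: "z j / (y i - z j) / (1 - y i * z j) = 1 / y i * (1 / (J j - J i))" if "i < k" "j \<in> {k..<n}" for i j
    proof -
      have ij: "i < n" "j < n" "i \<noteq> j" using that assms(1) by auto
      have "y j = z j" using yz that by simp
      then show ?thesis
        unfolding J using cross_factor[of "y i" "y j"] yn[OF ij] yy[OF ij] y0[OF ij(1)] y0[OF ij(2)] by simp
    qed
    have inner: "1 / (1 - y i * y j) = (y i - y j) * (- 1 / (J i - J j)) / (y i * y j)" if "i < k" "j < k" "i \<noteq> j" for i j
    proof -
      have ij: "i < n" "j < n" "i \<noteq> j" using that assms(1) by auto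
      show ?thesis
        unfolding J using inner_factor[of "y i" "y j"] yn[OF ij] yy[OF ij] y0[OF ij(1)] y0[OF ij(2)] by simp
    qed
    \<comment> \<open>Origin of the exponent \<open>m + 2\<close>: inverting \<open>z i\<close>
      brings \<open>z i ^ (- e)\<close> from the box sum, \<open>z i ^ (2 * n - 4)\<close> from the
      total power \<open>y i ^ (2 - n)\<close>, and \<open>- z i\<close> from
      \<open>1 / (1 - y i)\<close>. With \<open>e = m + 2 * n - 1\<close> all multiples of
      \<open>n\<close> cancel, and the three signs give one minus.\<close>
    have single: "(if i \<in> X then - 1 else 1) * y i * (if i \<in> X then - 1 / z i ^ e else 1) / (1 - y i) *
        (1 / y i) ^ (n - k) / y i ^ (k - 1) =
        z i ^ 2 / z i ^ n / (1 - z i) * (if i \<in> X then - (1 / z i ^ (m + 2)) else 1)" if ik: "i < k" for i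
    proof -
      have zi: "z i > 1" using assms ik by simp
      obtain n' where n': "n = Suc n'" using ik assms(1) by (cases n) auto
      have "n - k + (k - 1) = n'" using ik assms(1) n' by simp
      then have p: "(1 / y i) ^ (n - k) / y i ^ (k - 1) = (1 / y i) ^ n'"
        by (metis power_add power_one_over divide_inverse mult_1 inverse_eq_divide)
      have e: "e = m + n + n'" using n' by (simp add: e_def)
      have lhs: "(if i \<in> X then - 1 else 1) * y i * (if i \<in> X then - 1 / z i ^ e else 1) / (1 - y i) *
        (1 / y i) ^ (n - k) / y i ^ (k - 1) =
        (if i \<in> X then - 1 else 1) * y i * (if i \<in> X then - 1 / z i ^ e else 1) / (1 - y i) * (1 / y i) ^ n'"
        unfolding p[symmetric] by (simp only: times_divide_eq_right)
      define b where "b = z i ^ n'"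
      define c where "c = z i ^ m"
      have nz: "z i \<noteq> 0" "1 - z i \<noteq> 0" "b \<noteq> 0" "c \<noteq> 0"
        using zi by (auto simp: b_def c_def)
      have pw: "z i ^ n = z i * b" "z i ^ e = c * (z i * b) * b" "z i ^ (m + 2) = c * z i ^ 2"
        by (simp_all add: e n' b_def c_def power_add power2_eq_square)
      show ?thesis
      proof (cases "i \<in> X")
        case True
        then have y: "y i = 1 / z i" by (simp add: y_def flip_def)
        have "(1 / z i) / (1 - 1 / z i) = 1 / (z i * (1 - 1 / z i))"
          by simp
        also have "z i * (1 - 1 / z i) = - (1 - z i)"
          using nz by (simp add: right_diff_distrib)
        finally have q: "(1 / z i) / (1 - 1 / z i) = - (1 / (1 - z i))"
          by (simp only: minus_divide_right)
        have "(if i \<in> X then - 1 else 1) * y i * (if i \<in> X then - 1 / z i ^ e else 1) / (1 - y i) * (1 / y i) ^ n'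
            = 1 / z i ^ e * ((1 / z i) / (1 - 1 / z i)) * b"
          using True by (simp add: y b_def)
        also have "\<dots> = z i ^ 2 / z i ^ n / (1 - z i) * (- (1 / z i ^ (m + 2)))"
          unfolding q pw using nz by (simp add: power2_eq_square)
        finally show ?thesis unfolding lhs using True by simp
      next
        case False
        then have y: "y i = z i" by (simp add: y_def flip_def)
        show ?thesis
          unfolding lhs using False nz by (simp add: y pw power_one_over b_def[symmetric] power2_eq_square)
      qed
    qed
    have "(\<Prod>i<k. if i \<in> X then - a (1 / z i) else a (z i)) * ((\<Prod>i<n. y i) * (\<Prod>i\<in>X. - 1 / z i ^ e) / D) =
        (\<Prod>i\<in>{k..<n}. z i / (1 - z i)) / pair_prod {k..<n} (\<lambda>i j. 1 - z i * z j) *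
        (\<Prod>i<k. (if i \<in> X then - 1 else 1) * y i * (if i \<in> X then - 1 / z i ^ e else 1) / (1 - y i)) *
        (\<Prod>i<k. \<Prod>j\<in>{k..<n}. z j / (y i - z j) / (1 - y i * z j)) * pair_prod {..<k} (\<lambda>i j. 1 / (1 - y i * y j))"
    proof -
      have "(\<Prod>i<k. if i \<in> X then - a (1 / z i) else a (z i)) = (\<Prod>i<k. (if i \<in> X then - 1 else 1) * a (y i))"
        by (intro prod.cong refl) (auto simp: y_def flip_def)
      moreover have "(\<Prod>i\<in>{k..<n}. y i) = (\<Prod>i\<in>{k..<n}. z i)" "(\<Prod>i\<in>{k..<n}. 1 - y i) = (\<Prod>i\<in>{k..<n}. 1 - z i)"
        by (intro prod.cong refl; simp add: yz)+
      ultimately show ?thesis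
        unfolding D_def Ypair Yprod prod_subset_if[OF finite_lessThan X] a_def
        by (simp add: prod.distrib prod_dividef pair_prod_divide[of _ "\<lambda>_ _. 1"] pair_prod_def[of _ "\<lambda>_ _. 1"] mult_ac)
    qed
    also have "(\<Prod>i<k. \<Prod>j\<in>{k..<n}. z j / (y i - z j) / (1 - y i * z j)) =
        (\<Prod>i<k. (1 / y i) ^ (n - k)) * (\<Prod>i<k. \<Prod>j\<in>{k..<n}. 1 / (J j - J i))"
      unfolding prod.distrib[symmetric]
    proof (intro prod.cong refl)
      fix i assume "i \<in> {..<k}"
      then have "(\<Prod>j\<in>{k..<n}. z j / (y i - z j) / (1 - y i * z j)) = (\<Prod>j\<in>{k..<n}. 1 / y i * (1 / (J j - J i)))"
        using cross by (intro prod.cong refl) auto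
      also have "\<dots> = (1 / y i) ^ (n - k) * (\<Prod>j\<in>{k..<n}. 1 / (J j - J i))"
        by (subst prod.distrib) simp
      finally show "(\<Prod>j\<in>{k..<n}. z j / (y i - z j) / (1 - y i * z j)) = (1 / y i) ^ (n - k) * (\<Prod>j\<in>{k..<n}. 1 / (J j - J i))" .
    qed
    also have "pair_prod {..<k} (\<lambda>i j. 1 / (1 - y i * y j)) =
        vdm {..<k} y * pair_prod {..<k} (\<lambda>i j. - 1 / (J i - J j)) / (\<Prod>i<k. y i ^ (k - 1))"
    proof -
      have "pair_prod {..<k} (\<lambda>i j. 1 / (1 - y i * y j)) =
          pair_prod {..<k} (\<lambda>i j. (y i - y j) * (- 1 / (J i - J j)) / (y i * y j))"
        using inner by (intro pair_prod_cong) auto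
      also have "\<dots> = pair_prod {..<k} (\<lambda>i j. (y i - y j) * (- 1 / (J i - J j))) / (\<Prod>i<k. y i ^ (k - 1))"
        by (simp only: pair_prod_divide[of _ "\<lambda>i j. (y i - y j) * (- 1 / (J i - J j))"]
            pair_prod_both[OF finite_lessThan] card_lessThan)
      finally show ?thesis
        by (simp only: pair_prod_mult vdm_def)
    qed
    also have "(\<Prod>i\<in>{k..<n}. z i / (1 - z i)) / pair_prod {k..<n} (\<lambda>i j. 1 - z i * z j) *
        (\<Prod>i<k. (if i \<in> X then - 1 else 1) * y i * (if i \<in> X then - 1 / z i ^ e else 1) / (1 - y i)) *
        ((\<Prod>i<k. (1 / y i) ^ (n - k)) * (\<Prod>i<k. \<Prod>j\<in>{k..<n}. 1 / (J j - J i))) *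
        (vdm {..<k} y * pair_prod {..<k} (\<lambda>i j. - 1 / (J i - J j)) / (\<Prod>i<k. y i ^ (k - 1))) =
        (\<Prod>i\<in>{k..<n}. z i / (1 - z i)) / pair_prod {k..<n} (\<lambda>i j. 1 - z i * z j) *
        (\<Prod>i<k. (if i \<in> X then - 1 else 1) * y i * (if i \<in> X then - 1 / z i ^ e else 1) / (1 - y i) *
        (1 / y i) ^ (n - k) / y i ^ (k - 1)) * (\<Prod>i<k. \<Prod>j\<in>{k..<n}. 1 / (J j - J i)) *
        pair_prod {..<k} (\<lambda>i j. - 1 / (J i - J j)) * vdm {..<k} y"
    proof -
      have pull: "(\<Prod>i<k. F i * (1 / y i) ^ (n - k) / y i ^ (k - 1)) =
          (\<Prod>i<k. F i) * (\<Prod>i<k. (1 / y i) ^ (n - k)) / (\<Prod>i<k. y i ^ (k - 1))" for F :: "nat \<Rightarrow> real"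
        by (simp only: prod.distrib prod_dividef)
      show ?thesis
        unfolding pull by (simp only: divide_inverse mult_ac)
    qed
    also have "(\<Prod>i<k. (if i \<in> X then - 1 else 1) * y i * (if i \<in> X then - 1 / z i ^ e else 1) / (1 - y i) *
        (1 / y i) ^ (n - k) / y i ^ (k - 1)) =
        (\<Prod>i<k. z i ^ 2 / z i ^ n / (1 - z i) * (if i \<in> X then - (1 / z i ^ (m + 2)) else 1))"
      using single by (intro prod.cong refl) auto
    also have "\<dots> = (\<Prod>i<k. z i ^ 2 / z i ^ n / (1 - z i)) * (\<Prod>i\<in>X. - (1 / z i ^ (m + 2)))"
      by (simp only: prod.distrib prod_subset_if[OF finite_lessThan X])
    finally have main: "(\<Prod>i<k. if i \<in> X then - a (1 / z i) else a (z i)) * ((\<Prod>i<n. y i) * (\<Prod>i\<in>X. - 1 / z i ^ e) / D) =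
        K * ((\<Prod>i\<in>X. - (1 / z i ^ (m + 2))) * vdm {..<k} y)"
      unfolding K_def by (simp only: mult_ac)
    have "(\<Prod>i<k. if i \<in> X then - a (1 / z i) else a (z i)) * alt_sum {..<n} (m + n) (\<lambda>v i. y i ^ v) =
        ((\<Prod>i<k. if i \<in> X then - a (1 / z i) else a (z i)) * ((\<Prod>i<n. y i) * (\<Prod>i\<in>X. - 1 / z i ^ e) / D)) *
          box_sum {..<n} (m + n) z"
      unfolding alt by (simp only: mult.assoc)
    also have "\<dots> = K * box_sum {..<n} (m + n) z * ((\<Prod>i\<in>X. - (1 / z i ^ (m + 2))) * vdm {..<k} y)"
      unfolding main by (simp only: mult_ac)
    finally show ?thesis unfolding y_def .
  qed
  have "(\<Sum>l\<in>decreasing n (m + n). gl_weight z k (n - k) l) =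
      c * K * box_sum {..<n} (m + n) z * flip_sum {..<k} (\<lambda>i. 1 / z i ^ (m + 2)) z" for m
  proof -
    have strict: "strict_partition l \<and> length l = n" if "l \<in> decreasing n (m + n)" for l
      using that by (auto simp: decreasing_def strict_partition_def)
    have "(\<Sum>l\<in>decreasing n (m + n). gl_weight z k (n - k) l) = c * alt_sum {..<n} (m + n)
        (\<lambda>v i. if i < k then a (z i) * z i ^ v - a (1 / z i) * (1 / z i) ^ v else z i ^ v)"
      unfolding alt_sum_def sum_distrib_left card_lessThan using c strict by (intro sum.cong refl) blast
    also have "(\<lambda>v i. if i < k then a (z i) * z i ^ v - a (1 / z i) * (1 / z i) ^ v else z i ^ v) =
        (\<lambda>v i. if i \<in> {..<k} then a (z i) * z i ^ v + (- a (1 / z i)) * (1 / z i) ^ v else z i ^ v)"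
      by (auto simp: fun_eq_iff)
    also have "alt_sum {..<n} (m + n) \<dots> = (\<Sum>X\<in>Pow {..<k}. (\<Prod>i<k. if i \<in> X then - a (1 / z i) else a (z i)) *
        alt_sum {..<n} (m + n) (\<lambda>v i. flip X z i ^ v))"
      using assms(1) by (intro alt_sum_expand_rows) auto
    also have "\<dots> = (\<Sum>X\<in>Pow {..<k}. K * box_sum {..<n} (m + n) z *
        ((\<Prod>i\<in>X. - (1 / z i ^ (m + 2))) * vdm {..<k} (flip X z)))"
      using flipped by (intro sum.cong refl) auto
    also have "\<dots> = K * box_sum {..<n} (m + n) z * flip_sum {..<k} (\<lambda>i. 1 / z i ^ (m + 2)) z"
      unfolding flip_sum_def sum_distrib_left ..
    finally show ?thesis by (simp only: mult.assoc)
  qed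
  then show ?thesis by blast
qed

subsection \<open>Specialization and limit\<close>

text \<open>Each summand is a Vandermonde determinant in the flipped variables, so the sum over
  \<open>T\<close> is the expansion of the rows into their two terms, read backwards.\<close>

lemma flip_sum_alt:
  assumes "finite A" "inj_on z A" "\<And>i. i \<in> A \<Longrightarrow> z i > 1"
  shows "flip_sum A u z = alt A (map (\<lambda>j i. z i ^ j - u i * (1 / z i) ^ j) (rev [0..<card A]))"
proof -
  have "flip_sum A u z = (\<Sum>T\<in>Pow A. alt A (map (\<lambda>j i. if i \<in> T then - (u i * (1 / z i) ^ j) else z i ^ j) (rev [0..<card A])))"
    unfolding flip_sum_def
  proof (intro sum.cong refl)
    fix T assume T: "T \<in> Pow A"
    have "inj_on (flip T z) A"
      using assms(2,3) by (rule inj_on_flip)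
    then have "(\<Prod>i\<in>T. - u i) * vdm A (flip T z) =
        (\<Prod>i\<in>A. if i \<in> T then - u i else 1) * alt A (map (\<lambda>j i. flip T z i ^ j) (rev [0..<card A]))"
      using assms(1) T by (simp add: alt_powers prod_subset_if[of A T])
    also have "\<dots> = alt A (map (\<lambda>j i. (if i \<in> T then - u i else 1) * flip T z i ^ j) (rev [0..<card A]))"
      by (rule alt_scale_rows[OF assms(1), symmetric])
    also have "(\<lambda>j i. (if i \<in> T then - u i else 1) * flip T z i ^ j) =
        (\<lambda>j i. if i \<in> T then - (u i * (1 / z i) ^ j) else z i ^ j)"
      by (auto simp: fun_eq_iff flip_def)
    finally show "(\<Prod>i\<in>T. - u i) * vdm A (flip T z) =
        alt A (map (\<lambda>j i. if i \<in> T then - (u i * (1 / z i) ^ j) else z i ^ j) (rev [0..<card A]))" .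
  qed
  also have "\<dots> = alt A (map (\<lambda>j i. if i \<in> A then z i ^ j + - (u i * (1 / z i) ^ j) else z i ^ j) (rev [0..<card A]))"
    by (rule alt_expand_rows[OF assms(1,1) subset_refl, symmetric])
  also have "\<dots> = alt A (map (\<lambda>j i. z i ^ j - u i * (1 / z i) ^ j) (rev [0..<card A]))"
    using assms(1) by (intro alt_map_cong) auto
  finally show ?thesis .
qed

text \<open>Chebyshev polynomials of the second kind at half the argument,
  \<open>U_i (x / 2)\<close>; the rescaling makes them monic.\<close>

fun cheb :: "nat \<Rightarrow> real poly" where
  "cheb 0 = 1"
| "cheb (Suc 0) = [:0, 1:]"
| "cheb (Suc (Suc i)) = pCons 0 (cheb (Suc i)) - cheb i"

lemma cheb_monic: "degree (cheb i) = i \<and> coeff (cheb i) i = 1"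
proof (induction i rule: cheb.induct)
  case (3 i)
  then have "coeff (cheb i) (Suc (Suc i)) = 0"
    by (intro coeff_eq_0) simp
  then have "coeff (cheb (Suc (Suc i))) (Suc (Suc i)) = 1"
    using 3 by simp
  moreover have "degree (cheb (Suc (Suc i))) \<le> Suc (Suc i)"
    unfolding cheb.simps using 3 by (intro degree_diff_le order.trans[OF degree_pCons_le]) auto
  ultimately show ?case
    by (metis le_antisym le_degree one_neq_zero)
qed auto

lemma sinh_multiple: "sinh (real (Suc i) * x) = sinh x * poly (cheb i) (2 * cosh x)"
proof (induction i rule: cheb.induct)
  case 2
  then show ?case by (simp add: sinh_double)
next
  case (3 i)
  have "sinh (real (Suc (Suc (Suc i))) * x) + sinh (real (Suc i) * x) = 2 * cosh x * sinh (real (Suc (Suc i)) * x)"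
  proof -
    have "real (Suc (Suc (Suc i))) * x = real (Suc (Suc i)) * x + x" "real (Suc i) * x = real (Suc (Suc i)) * x - x"
      by (simp_all add: algebra_simps)
    then show ?thesis by (simp only: sinh_add sinh_diff) simp
  qed
  then show ?case
    using 3 by (simp add: algebra_simps del: of_nat_Suc)
qed simp

text \<open>The principal specialization with \<open>u i = z i ^ e\<close>. The exponent is real
  because it is negative for the symplectic factor.\<close>

definition sinh_sum :: "nat \<Rightarrow> real \<Rightarrow> real \<Rightarrow> real" where
  "sinh_sum n e t = flip_sum {..<n} (\<lambda>i. exp (2 * real (Suc i) * t * e)) (\<lambda>i. exp (2 * real (Suc i) * t))"

lemma cosh_diff_cosh: "cosh x - cosh y = 2 * sinh ((x + y) / 2) * sinh ((x - y) / (2 :: real))"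
proof -
  have "x = (x + y) / 2 + (x - y) / 2" "y = (x + y) / 2 - (x - y) / 2"
    by (simp_all add: field_simps)
  then have "cosh x - cosh y = cosh ((x + y) / 2 + (x - y) / 2) - cosh ((x + y) / 2 - (x - y) / 2)"
    by metis
  then show ?thesis by (simp only: cosh_add cosh_diff)
qed

text \<open>Once an exponential is taken out of row \<open>i\<close>, its entries are
  \<open>sinh\<close> of \<open>Suc i\<close> times an angle belonging to the column. Up to the
  column factor \<open>sinh (th j)\<close> this is a polynomial of degree \<open>i\<close> in
  \<open>2 * cosh (th j)\<close>, so \<open>alt_monic_polys\<close> applies.\<close>

lemma sinh_sum_product:
  fixes n :: nat and e t :: real
  defines "p \<equiv> \<lambda>a. real (n - Suc a)"
  assumes "t > 0" "\<forall>i<n. \<forall>j<n. real i + real j \<noteq> e"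
  shows "sinh_sum n e t = (\<Prod>i<n. 2 * exp (real (Suc i) * t * e)) * (\<Prod>a<n. sinh ((2 * p a - e) * t)) *
    ((\<Prod>i<n. (-1) ^ i) * (\<Prod>a<n. \<Prod>b\<in>{a<..<n}. 4 * sinh ((p a + p b - e) * t) * sinh ((p a - p b) * t)))"
proof -
  define z where "z i = exp (2 * real (Suc i) * t)" for i
  define th where "th j = (2 * real j - e) * t" for j
  have inj: "inj_on z {..<n}"
    using assms(2) by (auto simp: inj_on_def z_def)
  have gt: "z i > 1" for i
    using assms(2) by (simp add: z_def)
  have "sinh_sum n e t = alt {..<n} (map (\<lambda>j i. z i ^ j - exp (2 * real (Suc i) * t * e) * (1 / z i) ^ j) (rev [0..<n]))"
    using flip_sum_alt[OF finite_lessThan inj gt] unfolding sinh_sum_def z_def by simp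
  also have "(\<lambda>j i. z i ^ j - exp (2 * real (Suc i) * t * e) * (1 / z i) ^ j) =
      (\<lambda>j i. (2 * exp (real (Suc i) * t * e)) * (sinh (th j) * poly (cheb i) (2 * cosh (th j))))"
  proof (intro ext)
    fix j i
    define x where "x = real (Suc i) * t"
    have "z i ^ j = exp (x * e) * exp (real (Suc i) * th j)"
      unfolding z_def exp_of_nat_mult[symmetric] exp_add[symmetric] by (simp add: x_def th_def algebra_simps)
    moreover have "exp (2 * real (Suc i) * t * e) * (1 / z i) ^ j = exp (x * e) * exp (- (real (Suc i) * th j))"
    proof -
      have "1 / z i = exp (- (2 * real (Suc i) * t))"
        unfolding z_def by (simp add: exp_minus inverse_eq_divide)
      then show ?thesis
        unfolding exp_of_nat_mult[symmetric] exp_add[symmetric]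
        by (simp add: x_def th_def algebra_simps flip: exp_of_nat_mult exp_add)
    qed
    ultimately have "z i ^ j - exp (2 * real (Suc i) * t * e) * (1 / z i) ^ j =
        2 * exp (x * e) * sinh (real (Suc i) * th j)"
      by (simp add: sinh_def right_diff_distrib)
    then show "z i ^ j - exp (2 * real (Suc i) * t * e) * (1 / z i) ^ j =
        (2 * exp (real (Suc i) * t * e)) * (sinh (th j) * poly (cheb i) (2 * cosh (th j)))"
      unfolding sinh_multiple x_def .
  qed
  also have "alt {..<n} (map \<dots> (rev [0..<n])) = (\<Prod>i<n. 2 * exp (real (Suc i) * t * e)) *
      (prod_list (map (\<lambda>j. sinh (th j)) (rev [0..<n])) *
        alt {..<n} (map (\<lambda>j i. poly (cheb i) (2 * cosh (th j))) (rev [0..<n])))"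
    by (simp only: alt_scale_rows[OF finite_lessThan] alt_scale_cols)
  also have "prod_list (map (\<lambda>j. sinh (th j)) (rev [0..<n])) = (\<Prod>a<n. sinh ((2 * p a - e) * t))"
  proof -
    have "prod_list (map (\<lambda>j. sinh (th j)) (rev [0..<n])) = (\<Prod>j<n. sinh (th j))"
      by (subst prod.distinct_set_conv_list[symmetric]) (auto simp: atLeast0LessThan)
    also have "\<dots> = (\<Prod>a<n. sinh (th (n - Suc a)))"
      by (rule prod.nat_diff_reindex[symmetric])
    finally show ?thesis by (simp add: th_def p_def)
  qed
  also have "alt {..<n} (map (\<lambda>j i. poly (cheb i) (2 * cosh (th j))) (rev [0..<n])) =
      (\<Prod>i<n. (-1) ^ i) * (\<Prod>a<n. \<Prod>b\<in>{a<..<n}. 4 * sinh ((p a + p b - e) * t) * sinh ((p a - p b) * t))"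
  proof -
    define xs where "xs = map (\<lambda>j. 2 * cosh (th j)) (rev [0..<n])"
    have len: "length xs = n" by (simp add: xs_def)
    have diff: "xs ! a - xs ! b = 4 * sinh ((p a + p b - e) * t) * sinh ((p a - p b) * t)" if "a < n" "b < n" for a b
    proof -
      have "xs ! a = 2 * cosh (th (n - Suc a))" "xs ! b = 2 * cosh (th (n - Suc b))"
        using that by (simp_all add: xs_def rev_nth)
      moreover have "(th (n - Suc a) + th (n - Suc b)) / 2 = (p a + p b - e) * t"
        "(th (n - Suc a) - th (n - Suc b)) / 2 = (p a - p b) * t"
        by (simp_all add: th_def p_def field_simps)
      ultimately show ?thesis
        using cosh_diff_cosh[of "th (n - Suc a)" "th (n - Suc b)"] by simp
    qed
    \<comment> \<open>Two hyperbolic cosines agree only if the angles agree up to sign; equal angles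
      are impossible, opposite ones are excluded by the hypothesis on \<open>e\<close>.\<close>
    have "distinct xs"
      unfolding distinct_conv_nth len
    proof (intro allI impI)
      fix a b assume ab: "a < n" "b < n" "a \<noteq> b"
      have "p a + p b \<noteq> e" using assms(3)[rule_format, of "n - Suc a" "n - Suc b"] ab by (simp add: p_def)
      moreover have "p a \<noteq> p b" using ab by (simp add: p_def)
      ultimately show "xs ! a \<noteq> xs ! b"
        using diff[OF ab(1,2)] assms(2) by auto
    qed
    then have "alt {..<n} (map (\<lambda>x i. poly (cheb i) x) xs) =
        (\<Prod>i<n. (-1) ^ i) * (\<Prod>a<n. \<Prod>b\<in>{a<..<n}. xs ! a - xs ! b)"
      using alt_monic_polys[of xs cheb] cheb_monic by (simp add: len)
    moreover have "map (\<lambda>x i. poly (cheb i) x) xs = map (\<lambda>j i. poly (cheb i) (2 * cosh (th j))) (rev [0..<n])"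
      by (simp add: xs_def)
    moreover have "(\<Prod>a<n. \<Prod>b\<in>{a<..<n}. xs ! a - xs ! b) =
        (\<Prod>a<n. \<Prod>b\<in>{a<..<n}. 4 * sinh ((p a + p b - e) * t) * sinh ((p a - p b) * t))"
      using diff by (intro prod.cong refl) auto
    ultimately show ?thesis by simp
  qed
  finally show ?thesis by (simp only: mult.assoc)
qed

section \<open>Limits as the parameter t tends to 0\<close>

lemma sinh_ratio_tendsto:
  assumes "b \<noteq> 0"
  shows "((\<lambda>t. sinh (a * t) / sinh (b * t)) \<longlongrightarrow> a / b) (at_right (0 :: real))"
proof (rule lhopital_right_0)
  show "((\<lambda>t. sinh (a * t)) \<longlongrightarrow> 0) (at_right 0)" "((\<lambda>t. sinh (b * t)) \<longlongrightarrow> 0) (at_right 0)"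
    by (auto intro!: tendsto_eq_intros)
  show "\<forall>\<^sub>F t in at_right 0. sinh (b * t) \<noteq> 0"
    using assms by (auto simp: eventually_at_right_field intro: exI[of _ 1])
  show "\<forall>\<^sub>F t in at_right 0. b * cosh (b * t) \<noteq> 0"
    using assms by simp
  show "\<forall>\<^sub>F t in at_right 0. ((\<lambda>t. sinh (a * t)) has_real_derivative a * cosh (a * t)) (at t)"
    "\<forall>\<^sub>F t in at_right 0. ((\<lambda>t. sinh (b * t)) has_real_derivative b * cosh (b * t)) (at t)"
    by (auto intro!: always_eventually derivative_eq_intros)
  show "((\<lambda>t. a * cosh (a * t) / (b * cosh (b * t))) \<longlongrightarrow> a / b) (at_right 0)"
    using assms by (auto intro!: tendsto_eq_intros)
qed

lemma sinh_sum_nonzero: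
  assumes "t > 0" "\<forall>i<n. \<forall>j<n. real i + real j \<noteq> e"
  shows "sinh_sum n e t \<noteq> 0"
proof -
  have *: "real (n - Suc a) + real (n - Suc b) - e \<noteq> 0" if "a < n" "b < n" for a b
    using assms(2)[rule_format, of "n - Suc a" "n - Suc b"] that by simp
  have "2 * real (n - Suc a) - e \<noteq> 0" if "a < n" for a
    using *[OF that that] by simp
  moreover have "real (n - Suc a) - real (n - Suc b) \<noteq> 0" if "a < b" "b < n" for a b
    using that by simp
  ultimately show ?thesis
    unfolding sinh_sum_product[OF assms] using * assms(1) by (simp del: of_nat_diff)
qed

lemma prod_triangle:
  fixes n :: nat and f :: "nat \<Rightarrow> nat \<Rightarrow> real"
  shows "(\<Prod>a<n. \<Prod>b\<in>{a..<n}. f a b) = (\<Prod>a<n. f a a) * (\<Prod>a<n. \<Prod>b\<in>{a<..<n}. f a b)"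
proof -
  have "{a..<n} = insert a {a<..<n}" if "a < n" for a
    using that by auto
  then show ?thesis
    unfolding prod.distrib[symmetric] by (intro prod.cong refl) simp
qed

text \<open>Signs, powers of 2 and the factors \<open>sinh ((p a - p b) * t)\<close> do not involve
  \<open>e\<close> and cancel; the exponentials tend to 1. The terms \<open>b = a\<close> of the
  limit come from the column factors.\<close>

lemma sinh_sum_ratio_tendsto:
  fixes n :: nat and e e0 :: real
  defines "p \<equiv> \<lambda>a. real (n - Suc a)"
  assumes "\<forall>i<n. \<forall>j<n. real i + real j \<noteq> e" "\<forall>i<n. \<forall>j<n. real i + real j \<noteq> e0"
  shows "((\<lambda>t. sinh_sum n e t / sinh_sum n e0 t) \<longlongrightarrow> (\<Prod>a<n. \<Prod>b\<in>{a..<n}. (p a + p b - e) / (p a + p b - e0))) (at_right 0)"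
proof -
  have nz: "p a + p b - e0 \<noteq> 0" if "a < n" "b < n" for a b
    using assms(3)[rule_format, of "n - Suc a" "n - Suc b"] that by (simp add: p_def)
  have nz': "2 * p a - e0 \<noteq> 0" if "a < n" for a
    using nz[OF that that] by simp
  have "((\<lambda>t. (\<Prod>i<n. exp (real (Suc i) * t * e) / exp (real (Suc i) * t * e0)) *
      (\<Prod>a<n. sinh ((2 * p a - e) * t) / sinh ((2 * p a - e0) * t)) *
      (\<Prod>a<n. \<Prod>b\<in>{a<..<n}. sinh ((p a + p b - e) * t) / sinh ((p a + p b - e0) * t))) \<longlongrightarrow>
      (\<Prod>i<n. exp (real (Suc i) * 0 * e) / exp (real (Suc i) * 0 * e0)) *
      (\<Prod>a<n. (2 * p a - e) / (2 * p a - e0)) *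
      (\<Prod>a<n. \<Prod>b\<in>{a<..<n}. (p a + p b - e) / (p a + p b - e0))) (at_right 0)"
    using nz nz' by (intro tendsto_mult tendsto_prod sinh_ratio_tendsto tendsto_divide tendsto_exp tendsto_const tendsto_ident_at) auto
  moreover have "\<forall>\<^sub>F t in at_right 0. (\<Prod>i<n. exp (real (Suc i) * t * e) / exp (real (Suc i) * t * e0)) *
      (\<Prod>a<n. sinh ((2 * p a - e) * t) / sinh ((2 * p a - e0) * t)) *
      (\<Prod>a<n. \<Prod>b\<in>{a<..<n}. sinh ((p a + p b - e) * t) / sinh ((p a + p b - e0) * t)) = sinh_sum n e t / sinh_sum n e0 t"
    unfolding eventually_at_right_field
  proof (intro exI[of _ 1] conjI allI impI)
    fix t :: real assume "0 < t"
    define c :: real where "c = (\<Prod>i<n. 2) * (\<Prod>i<n. (-1) ^ i) * (\<Prod>a<n. \<Prod>b\<in>{a<..<n}. 4 * sinh ((p a - p b) * t))"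
    have c: "sinh_sum n e t = c * ((\<Prod>i<n. exp (real (Suc i) * t * e)) * (\<Prod>a<n. sinh ((2 * p a - e) * t)) *
        (\<Prod>a<n. \<Prod>b\<in>{a<..<n}. sinh ((p a + p b - e) * t)))"
      if "\<forall>i<n. \<forall>j<n. real i + real j \<noteq> e" for e
      unfolding sinh_sum_product[OF \<open>0 < t\<close> that] c_def p_def by (simp only: prod.distrib mult_ac)
    have "c \<noteq> 0"
      using sinh_sum_nonzero[OF \<open>0 < t\<close> assms(3)] c[OF assms(3)] by auto
    then show "(\<Prod>i<n. exp (real (Suc i) * t * e) / exp (real (Suc i) * t * e0)) *
      (\<Prod>a<n. sinh ((2 * p a - e) * t) / sinh ((2 * p a - e0) * t)) *
      (\<Prod>a<n. \<Prod>b\<in>{a<..<n}. sinh ((p a + p b - e) * t) / sinh ((p a + p b - e0) * t)) = sinh_sum n e t / sinh_sum n e0 t"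
      unfolding c[OF assms(2)] c[OF assms(3)] by (simp add: prod_dividef)
  qed simp
  ultimately have "((\<lambda>t. sinh_sum n e t / sinh_sum n e0 t) \<longlongrightarrow>
      (\<Prod>i<n. exp (real (Suc i) * 0 * e) / exp (real (Suc i) * 0 * e0)) *
      (\<Prod>a<n. (2 * p a - e) / (2 * p a - e0)) *
      (\<Prod>a<n. \<Prod>b\<in>{a<..<n}. (p a + p b - e) / (p a + p b - e0))) (at_right 0)"
    by (rule Lim_transform_eventually)
  then show ?thesis
    by (simp add: prod_triangle)
qed

text \<open>For fixed \<open>l\<close> the weight is a finite sum of quotients of powers and hence
  continuous at 1, where the denominators of the determinant formula vanish.\<close>

lemma gl_weight_tendsto:
  assumes "\<And>i. ((\<lambda>t. z t i) \<longlongrightarrow> 1) F"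
  shows "((\<lambda>t. gl_weight (z t) k d l) \<longlongrightarrow> gl_weight (\<lambda>_. 1) k d l) F"
proof -
  have gl: "((\<lambda>t. gl_step (w t) (f t) l) \<longlongrightarrow> gl_step 1 g l) F"
    if "(w \<longlongrightarrow> 1) F" "\<And>l. ((\<lambda>t. f t l) \<longlongrightarrow> g l) F" for w f g l
    unfolding gl_step_def by (intro tendsto_intros that) simp
  have sp: "((\<lambda>t. sp_step (w t) (f t) l) \<longlongrightarrow> sp_step 1 g l) F"
    if "(w \<longlongrightarrow> 1) F" "\<And>l. ((\<lambda>t. f t l) \<longlongrightarrow> g l) F" for w f g l
    unfolding sp_step_def by (intro tendsto_intros that) simp
  have inv: "((\<lambda>t. 1 / z t i) \<longlongrightarrow> 1) F" for i
    using tendsto_divide[OF tendsto_const[of 1] assms[of i]] by simp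
  have sp_w: "((\<lambda>t. sp_weight (z t) r l) \<longlongrightarrow> sp_weight (\<lambda>_. 1) r l) F" for r l
  proof (induction r arbitrary: l)
    case (Suc r)
    then show ?case
      using sp[OF inv[of r] gl[OF assms[of r]]] by simp
  qed simp
  show ?thesis
  proof (induction d arbitrary: l)
    case (Suc d)
    then show ?case using gl[OF assms] by simp
  qed (simp add: sp_w)
qed

subsection \<open>Shifted plane partitions as chains of interlacing diagonals\<close>

text \<open>Diagonal \<open>d\<close> consists of the boxes \<open>(i, i + d)\<close> with \<open>1 \<le> i \<le> diag_len n k d\<close>.\<close>

definition diag_len :: "nat \<Rightarrow> nat \<Rightarrow> nat \<Rightarrow> nat" where
  "diag_len n k d = (if d \<le> n - k then n - d else (n + k + 1 - d) div 2)"

definition outer_diagonals :: "nat \<Rightarrow> nat \<Rightarrow> nat \<Rightarrow> (nat \<times> nat) set" where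
  "outer_diagonals n k d = {(i, j). 1 \<le> i \<and> i + d \<le> j \<and> i \<le> diag_len n k (j - i)}"

definition plane_partitions :: "(nat \<times> nat) set \<Rightarrow> (nat \<times> nat \<Rightarrow> nat) set" where
  "plane_partitions S = {p \<in> S \<rightarrow>\<^sub>E UNIV.
     (\<forall>i j j'. (i, j) \<in> S \<longrightarrow> (i, j') \<in> S \<longrightarrow> j \<le> j' \<longrightarrow> p (i, j') \<le> p (i, j)) \<and>
     (\<forall>i i' j. (i, j) \<in> S \<longrightarrow> (i', j) \<in> S \<longrightarrow> i \<le> i' \<longrightarrow> p (i', j) \<le> p (i, j))}"

definition diag_positions :: "nat \<Rightarrow> nat \<Rightarrow> nat \<Rightarrow> (nat \<times> nat \<Rightarrow> nat) \<Rightarrow> nat list" where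
  "diag_positions n k d p =
     map (\<lambda>i. p (Suc i, Suc i + d) + (diag_len n k d - i)) [0..<diag_len n k d]"

definition fibre :: "nat \<Rightarrow> nat \<Rightarrow> nat \<Rightarrow> nat list \<Rightarrow> (nat \<times> nat \<Rightarrow> nat) set" where
  "fibre n k d l = {p \<in> plane_partitions (outer_diagonals n k d). diag_positions n k d p = l}"

definition interlacing_ranges :: "nat \<Rightarrow> nat \<Rightarrow> nat \<Rightarrow> nat list \<Rightarrow> nat set list" where
  "interlacing_ranges n k d l = (if diag_len n k (Suc d) < diag_len n k d then gl_ranges l else sp_ranges l)"

section \<open>Geometry of the diagonals\<close>

lemma diag_len_Suc:
  assumes "k \<le> n"
  shows "diag_len n k (Suc d) \<le> diag_len n k d" "diag_len n k d \<le> Suc (diag_len n k (Suc d))"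
  using assms unfolding diag_len_def by (auto split: if_splits)

lemma diag_len_antimono:
  assumes "k \<le> n" "d \<le> d'"
  shows "diag_len n k d' \<le> diag_len n k d"
  using assms(2) by (rule lift_Suc_antimono_le[rotated]) (rule diag_len_Suc(1)[OF assms(1)])

lemma diag_len_add:
  assumes "k \<le> n"
  shows "diag_len n k d \<le> diag_len n k (d + c) + c"
proof (induction c)
  case (Suc c)
  then show ?case using diag_len_Suc(2)[OF assms, of "d + c"] by simp
qed simp

lemma shifted_diagram_eq_outer_diagonals:
  assumes "k \<le> n"
  shows "shifted_diagram (shifted_double_staircase n k) = outer_diagonals n k 0"
proof -
  have "(1 \<le> i \<and> i \<le> n \<and> i \<le> j \<and> j < i + shifted_double_staircase n k ! (i - 1)) \<longleftrightarrow>
      (1 \<le> i \<and> i + 0 \<le> j \<and> i \<le> diag_len n k (j - i))" for i j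
  proof (cases "1 \<le> i \<and> i \<le> n \<and> i \<le> j")
    case True
    then have "shifted_double_staircase n k ! (i - 1) = (n - (i - 1)) + (k - (i - 1))"
      using assms by (intro nth_shifted_double_staircase) auto
    then show ?thesis
      using True assms unfolding diag_len_def by auto
  next
    case False
    have "diag_len n k (j - i) \<le> n"
      using diag_len_antimono[OF assms, of 0 "j - i"] by (simp add: diag_len_def)
    then show ?thesis using False by auto
  qed
  then show ?thesis
    unfolding shifted_diagram_def outer_diagonals_def length_shifted_double_staircase[OF assms] by auto
qed

lemma nth_gl_ranges_iff:
  "m \<in> listset (gl_ranges l) \<longleftrightarrow>
    length m = length l - 1 \<and> (\<forall>i<length m. l ! Suc i \<le> m ! i \<and> m ! i < l ! i)"
  by (auto simp: listset_iff gl_ranges_def list_all2_conv_all_nth nth_tl)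

lemma nth_sp_ranges_iff:
  "m \<in> listset (sp_ranges l) \<longleftrightarrow>
    length m = length l \<and> (\<forall>i<length m. (if Suc i < length l then l ! Suc i else 0) < m ! i \<and> m ! i \<le> l ! i)"
proof -
  have "length (zip l (tl l @ [0])) = length l" by (cases l) auto
  moreover have "(tl l @ [0]) ! i = (if Suc i < length l then l ! Suc i else 0)" if "i < length l" for i
    using that by (cases l) (auto simp: nth_append)
  ultimately show ?thesis
    by (auto simp: listset_iff sp_ranges_def list_all2_conv_all_nth)
qed

text \<open>A box on diagonal \<open>d\<close> touches the later diagonals only through its right
  and its upper neighbour, both on diagonal \<open>Suc d\<close>. All other inequalities in its row
  and column follow by transitivity.\<close>

lemma plane_partitions_outer_diagonals_iff:
  assumes "k \<le> n" "p \<in> outer_diagonals n k d \<rightarrow>\<^sub>E UNIV"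
  shows "p \<in> plane_partitions (outer_diagonals n k d) \<longleftrightarrow>
    restrict p (outer_diagonals n k (Suc d)) \<in> plane_partitions (outer_diagonals n k (Suc d)) \<and>
    (\<forall>i. 1 \<le> i \<longrightarrow> i \<le> diag_len n k (Suc d) \<longrightarrow> p (i, i + Suc d) \<le> p (i, i + d)) \<and>
    (\<forall>i. 1 \<le> i \<longrightarrow> Suc i \<le> diag_len n k d \<longrightarrow> p (Suc i, Suc i + d) \<le> p (i, i + Suc d))"
    (is "?L \<longleftrightarrow> ?A \<and> ?B \<and> ?C")
proof
  assume L: ?L
  have sub: "outer_diagonals n k (Suc d) \<subseteq> outer_diagonals n k d" by (auto simp: outer_diagonals_def)
  have row: "p (i, j') \<le> p (i, j)" if "(i, j) \<in> outer_diagonals n k d" "(i, j') \<in> outer_diagonals n k d" "j \<le> j'" for i j j'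
    using L that unfolding plane_partitions_def by blast
  have col: "p (i', j) \<le> p (i, j)" if "(i, j) \<in> outer_diagonals n k d" "(i', j) \<in> outer_diagonals n k d" "i \<le> i'" for i i' j
    using L that unfolding plane_partitions_def by blast
  have ?A
    using sub row col unfolding plane_partitions_def by (auto simp: subset_iff)
  moreover have ?B
  proof (intro allI impI)
    fix i assume "1 \<le> i" "i \<le> diag_len n k (Suc d)"
    then show "p (i, i + Suc d) \<le> p (i, i + d)"
      using diag_len_Suc(1)[OF assms(1), of d] by (intro row) (auto simp: outer_diagonals_def)
  qed
  moreover have ?C
  proof (intro allI impI)
    fix i assume "1 \<le> i" "Suc i \<le> diag_len n k d"
    then have "p (Suc i, i + Suc d) \<le> p (i, i + Suc d)"
      using diag_len_Suc(2)[OF assms(1), of d] by (intro col) (auto simp: outer_diagonals_def)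
    then show "p (Suc i, Suc i + d) \<le> p (i, i + Suc d)" by simp
  qed
  ultimately show "?A \<and> ?B \<and> ?C" by blast
next
  assume R: "?A \<and> ?B \<and> ?C"
  have row: "p (i, j') \<le> p (i, j)" if "(i, j) \<in> outer_diagonals n k (Suc d)" "(i, j') \<in> outer_diagonals n k (Suc d)" "j \<le> j'" for i j j'
    using R that unfolding plane_partitions_def by fastforce
  have col: "p (i', j) \<le> p (i, j)" if "(i, j) \<in> outer_diagonals n k (Suc d)" "(i', j) \<in> outer_diagonals n k (Suc d)" "i \<le> i'" for i i' j
    using R that unfolding plane_partitions_def by fastforce
  have "p (i, j') \<le> p (i, j)" if ij: "(i, j) \<in> outer_diagonals n k d" "(i, j') \<in> outer_diagonals n k d" "j \<le> j'" for i j j'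
  proof (cases "j = i + d")
    case True
    show ?thesis
    proof (cases "j' = j")
      case False
      then have j': "i + Suc d \<le> j'" using True ij by simp
      \<comment> \<open>A box further right in row \<open>i\<close> forces the right neighbour into
        the shape, because the lengths weakly decrease.\<close>
      then have "diag_len n k (j' - i) \<le> diag_len n k (Suc d)"
        by (intro diag_len_antimono assms(1)) simp
      then have i: "i \<le> diag_len n k (Suc d)" "1 \<le> i"
        using ij by (auto simp: outer_diagonals_def)
      then have "p (i, j') \<le> p (i, i + Suc d)"
        using ij j' by (intro row) (auto simp: outer_diagonals_def)
      also have "\<dots> \<le> p (i, i + d)" using R i by blast
      finally show ?thesis using True by simp
    qed simp
  next
    case False
    then show ?thesis using ij by (intro row) (auto simp: outer_diagonals_def)
  qed
  moreover have "p (i', j) \<le> p (i, j)" if ij: "(i, j) \<in> outer_diagonals n k d" "(i', j) \<in> outer_diagonals n k d" "i \<le> i'" for i i' j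
  proof (cases "j = i' + d")
    case True
    show ?thesis
    proof (cases "i' = i")
      case False
      then obtain h where h: "i' = Suc h" "i \<le> h" "1 \<le> h"
        using ij by (cases i') (auto simp: outer_diagonals_def)
      then have hd: "Suc h \<le> diag_len n k d" "j = h + Suc d"
        using ij True by (auto simp: outer_diagonals_def)
      \<comment> \<open>The upper neighbour lies in the shape because the length drops by at most
        one.\<close>
      then have "h \<le> diag_len n k (Suc d)"
        using diag_len_Suc(2)[OF assms(1), of d] by simp
      then have "p (h, j) \<le> p (i, j)"
        using ij h hd by (intro col) (auto simp: outer_diagonals_def)
      moreover have "p (Suc h, Suc h + d) \<le> p (h, h + Suc d)" using R h(3) hd(1) by blast
      ultimately show ?thesis using h hd by simp
    qed simp
  next
    case False
    then show ?thesis using ij by (intro col) (auto simp: outer_diagonals_def)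
  qed
  ultimately show ?L
    using assms(2) unfolding plane_partitions_def by blast
qed

text \<open>With equal lengths, both diagonals are shifted equally within a row, so the upper end of
  the interval is closed and the lower one open. If the lengths differ by one, the shifts agree
  within a column and the roles are exchanged.\<close>

lemma diag_positions_interlacing_iff:
  assumes "k \<le> n"
  shows "diag_positions n k (Suc d) q \<in> listset (interlacing_ranges n k d (diag_positions n k d p)) \<longleftrightarrow>
    (\<forall>i. 1 \<le> i \<longrightarrow> i \<le> diag_len n k (Suc d) \<longrightarrow> q (i, i + Suc d) \<le> p (i, i + d)) \<and>
    (\<forall>i. 1 \<le> i \<longrightarrow> Suc i \<le> diag_len n k d \<longrightarrow> p (Suc i, Suc i + d) \<le> q (i, i + Suc d))"
proof -
  define r where "r = diag_len n k (Suc d)"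
  have shift: "(\<forall>i. 1 \<le> i \<longrightarrow> P i) \<longleftrightarrow> (\<forall>i. P (Suc i))" for P
    by (metis One_nat_def Suc_le_D Suc_le_mono le0)
  define P Q where "P = diag_positions n k d p" and "Q = diag_positions n k (Suc d) q"
  have P: "length P = diag_len n k d" "\<And>i. i < diag_len n k d \<Longrightarrow> P ! i = p (Suc i, Suc i + d) + (diag_len n k d - i)"
    by (simp_all add: P_def diag_positions_def)
  have Q: "length Q = r" "\<And>i. i < r \<Longrightarrow> Q ! i = q (Suc i, Suc i + Suc d) + (r - i)"
    by (simp_all add: Q_def diag_positions_def r_def)
  consider "diag_len n k d = r" | "diag_len n k d = Suc r"
    using diag_len_Suc[OF assms, of d] unfolding r_def by linarith
  then show ?thesis
  proof cases
    case 1
    have "(\<forall>i<r. (if Suc i < r then p (Suc (Suc i), Suc (Suc i) + d) + (r - Suc i) else 0) < q (Suc i, Suc i + Suc d) + (r - i) \<and>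
        q (Suc i, Suc i + Suc d) + (r - i) \<le> p (Suc i, Suc i + d) + (r - i)) \<longleftrightarrow>
      (\<forall>i. Suc i \<le> r \<longrightarrow> q (Suc i, Suc i + Suc d) \<le> p (Suc i, Suc i + d)) \<and>
      (\<forall>i. Suc (Suc i) \<le> r \<longrightarrow> p (Suc (Suc i), Suc (Suc i) + d) \<le> q (Suc i, Suc i + Suc d))" (is "?X \<longleftrightarrow> ?Y")
    proof
      assume X: ?X
      have "p (Suc (Suc i), Suc (Suc i) + d) \<le> q (Suc i, Suc i + Suc d)" if "Suc (Suc i) \<le> r" for i
        using X[rule_format, of i] that by auto
      moreover have "q (Suc i, Suc i + Suc d) \<le> p (Suc i, Suc i + d)" if "Suc i \<le> r" for i
        using X[rule_format, of i, THEN conjunct2, OF Suc_le_lessD[OF that]] by (simp only: add_le_cancel_right)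
      ultimately show ?Y by blast
    next
      assume Y: ?Y
      show ?X
      proof (intro allI impI)
        fix i assume "i < r"
        then show "(if Suc i < r then p (Suc (Suc i), Suc (Suc i) + d) + (r - Suc i) else 0) < q (Suc i, Suc i + Suc d) + (r - i) \<and>
          q (Suc i, Suc i + Suc d) + (r - i) \<le> p (Suc i, Suc i + d) + (r - i)"
          using Y[THEN conjunct1, rule_format, of i] Y[THEN conjunct2, rule_format, of i] by auto
      qed
    qed
    moreover have "Q \<in> listset (sp_ranges P) \<longleftrightarrow> ?X"
      unfolding nth_sp_ranges_iff Q(1) P(1) 1
      by (simp only: P(2)[unfolded 1] Q(2) simp_thms cong: if_cong imp_cong)
    moreover have "interlacing_ranges n k d P = sp_ranges P"
      by (simp add: interlacing_ranges_def r_def[symmetric] 1)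
    ultimately show ?thesis
      unfolding r_def[symmetric] 1 shift P_def[symmetric] Q_def[symmetric] by (simp only:)
  next
    case 2
    have "(\<forall>i<r. p (Suc (Suc i), Suc (Suc i) + d) + (Suc r - Suc i) \<le> q (Suc i, Suc i + Suc d) + (r - i) \<and>
        q (Suc i, Suc i + Suc d) + (r - i) < p (Suc i, Suc i + d) + (Suc r - i)) \<longleftrightarrow>
      (\<forall>i. Suc i \<le> r \<longrightarrow> q (Suc i, Suc i + Suc d) \<le> p (Suc i, Suc i + d)) \<and>
      (\<forall>i. Suc (Suc i) \<le> Suc r \<longrightarrow> p (Suc (Suc i), Suc (Suc i) + d) \<le> q (Suc i, Suc i + Suc d))" (is "?X \<longleftrightarrow> ?Y")
    proof -
      have "(a + (Suc r - Suc i) \<le> b + (r - i) \<and> b + (r - i) < c + (Suc r - i)) \<longleftrightarrow> (b \<le> c \<and> a \<le> b)"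
        if "i < r" for a b c i
        using that by arith
      then have "?X \<longleftrightarrow> (\<forall>i<r. q (Suc i, Suc i + Suc d) \<le> p (Suc i, Suc i + d) \<and>
          p (Suc (Suc i), Suc (Suc i) + d) \<le> q (Suc i, Suc i + Suc d))"
        by (simp only: cong: imp_cong)
      then show ?thesis
        unfolding Suc_le_mono Suc_le_eq by blast
    qed
    moreover have "Q \<in> listset (gl_ranges P) \<longleftrightarrow> ?X"
      unfolding nth_gl_ranges_iff Q(1) P(1) 2 diff_Suc_1
      by (simp only: P(2)[unfolded 2] Q(2) simp_thms less_SucI Suc_less_eq cong: imp_cong)
    moreover have "interlacing_ranges n k d P = gl_ranges P"
      by (simp add: interlacing_ranges_def r_def[symmetric] 2)
    ultimately show ?thesis
      unfolding r_def[symmetric] 2 shift P_def[symmetric] Q_def[symmetric] by (simp only:)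
  qed
qed

text \<open>Ensures that subtracting the staircase from positions is exact, so that entries can be
  recovered from \<open>l\<close> in \<open>bij_betw_fibre\<close>.\<close>

lemma strict_partition_nth_ge:
  assumes "strict_partition l" "i < length l"
  shows "length l - i \<le> l ! i"
  using assms
proof (induction l arbitrary: i)
  case (Cons a l)
  show ?case
  proof (cases i)
    case 0
    show ?thesis
    proof (cases l)
      case Nil
      then show ?thesis using Cons.prems 0 by (simp add: strict_partition_Cons)
    next
      case (Cons b l')
      have "length l - 0 \<le> l ! 0"
        using Cons.IH[of 0] Cons.prems Cons by (simp add: strict_partition_Cons)
      then show ?thesis using Cons.prems Cons 0 by (auto simp: strict_partition_Cons)
    qed
  next
    case (Suc i')
    then show ?thesis using Cons by (simp add: strict_partition_Cons)
  qed
qed simp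

text \<open>Diagonal \<open>d\<close> is encoded by \<open>l\<close>, so forgetting it loses
  nothing, and any filling of the later diagonals that interlaces \<open>l\<close> extends
  back.\<close>

lemma bij_betw_fibre:
  assumes "k \<le> n" "strict_partition l" "length l = diag_len n k d"
  shows "bij_betw (\<lambda>p. restrict p (outer_diagonals n k (Suc d))) (fibre n k d l)
    (\<Union>m\<in>listset (interlacing_ranges n k d l). fibre n k (Suc d) m)"
proof -
  let ?D = "outer_diagonals n k d" and ?D' = "outer_diagonals n k (Suc d)"
  define ext where "ext q = (\<lambda>(i, j). if (i, j) \<in> ?D - ?D' then l ! (i - 1) - (diag_len n k d - (i - 1)) else q (i, j))"
    for q :: "nat \<times> nat \<Rightarrow> nat"
  have sub: "?D' \<subseteq> ?D" by (auto simp: outer_diagonals_def)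
  have diag: "(i, j) \<in> ?D - ?D' \<longleftrightarrow> j = i + d \<and> 1 \<le> i \<and> i \<le> diag_len n k d" for i j
    by (cases "j = i + d") (auto simp: outer_diagonals_def)
  have pos: "diag_positions n k (Suc d) (restrict p ?D') = diag_positions n k (Suc d) p" for p
    by (auto simp: diag_positions_def outer_diagonals_def)
  have pos_eq: "diag_positions n k d p = l \<longleftrightarrow> (\<forall>i<length l. p (Suc i, Suc i + d) + (length l - i) = l ! i)" for p
    unfolding diag_positions_def assms(3)[symmetric] by (subst list_eq_iff_nth_eq) simp
  show ?thesis
  proof (rule bij_betw_byWitness[where f' = ext])
    show "\<forall>p\<in>fibre n k d l. ext (restrict p ?D') = p"
    proof
      fix p assume p: "p \<in> fibre n k d l"
      show "ext (restrict p ?D') = p"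
      proof
        fix b :: "nat \<times> nat"
        obtain i j where b: "b = (i, j)" by (cases b)
        consider "b \<in> ?D - ?D'" | "b \<in> ?D'" | "b \<notin> ?D" using sub by auto
        then show "ext (restrict p ?D') b = p b"
        proof cases
          case 1
          then have ij: "j = i + d" "1 \<le> i" "i \<le> diag_len n k d" using diag b by auto
          then obtain i' where i': "i = Suc i'" by (cases i) auto
          then have "p (Suc i', Suc i' + d) + (length l - i') = l ! i'"
            using p ij assms(3) unfolding fibre_def pos_eq by auto
          then show ?thesis using 1 b i' ij assms(3) by (simp add: ext_def)
        next
          case 2
          then show ?thesis using b by (simp add: ext_def)
        next
          case 3
          have "p \<in> extensional ?D" using p by (auto simp: fibre_def plane_partitions_def PiE_def)
          then have "p b = undefined" using 3 by (rule extensional_arb)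
          then show ?thesis using 3 b sub by (auto simp: ext_def)
        qed
      qed
    qed
    have ext_restrict: "restrict (ext q) ?D' = q" if "q \<in> plane_partitions ?D'" for q
    proof
      fix b :: "nat \<times> nat"
      obtain i j where b: "b = (i, j)" by (cases b)
      show "restrict (ext q) ?D' b = q b"
        using that b by (auto simp: ext_def plane_partitions_def PiE_def extensional_def)
    qed
    then show "\<forall>q\<in>(\<Union>m\<in>listset (interlacing_ranges n k d l). fibre n k (Suc d) m). restrict (ext q) ?D' = q"
      by (auto simp: fibre_def)
    show "(\<lambda>p. restrict p ?D') ` fibre n k d l \<subseteq> (\<Union>m\<in>listset (interlacing_ranges n k d l). fibre n k (Suc d) m)"
    proof
      fix q assume "q \<in> (\<lambda>p. restrict p ?D') ` fibre n k d l"
      then obtain p where p: "p \<in> plane_partitions ?D" "diag_positions n k d p = l" "q = restrict p ?D'"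
        by (auto simp: fibre_def)
      have "p \<in> ?D \<rightarrow>\<^sub>E UNIV" using p(1) by (auto simp: plane_partitions_def)
      note iff = plane_partitions_outer_diagonals_iff[OF assms(1) this]
      have "diag_positions n k (Suc d) p \<in> listset (interlacing_ranges n k d (diag_positions n k d p))"
        unfolding diag_positions_interlacing_iff[OF assms(1)] using iff p(1) by blast
      moreover have "q \<in> plane_partitions ?D'" using iff p by blast
      ultimately show "q \<in> (\<Union>m\<in>listset (interlacing_ranges n k d l). fibre n k (Suc d) m)"
        using p pos by (auto simp: fibre_def)
    qed
    show "ext ` (\<Union>m\<in>listset (interlacing_ranges n k d l). fibre n k (Suc d) m) \<subseteq> fibre n k d l"
    proof
      fix p assume "p \<in> ext ` (\<Union>m\<in>listset (interlacing_ranges n k d l). fibre n k (Suc d) m)"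
      then obtain q where q: "p = ext q" "q \<in> plane_partitions ?D'"
        "diag_positions n k (Suc d) q \<in> listset (interlacing_ranges n k d l)"
        by (auto simp: fibre_def)
      have E: "p \<in> ?D \<rightarrow>\<^sub>E UNIV"
        using q(2) sub unfolding q(1) by (auto simp: ext_def plane_partitions_def PiE_def extensional_def)
      have pl: "diag_positions n k d p = l"
        unfolding pos_eq
      proof (intro allI impI)
        fix i assume i: "i < length l"
        then have "(Suc i, Suc i + d) \<in> ?D - ?D'" unfolding diag using assms(3) by auto
        then show "p (Suc i, Suc i + d) + (length l - i) = l ! i"
          using strict_partition_nth_ge[OF assms(2) i] assms(3) by (simp add: q(1) ext_def)
      qed
      have "q = restrict p ?D'" using ext_restrict[OF q(2)] q(1) by simp
      then have "diag_positions n k (Suc d) p \<in> listset (interlacing_ranges n k d (diag_positions n k d p))"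
        using q(3) pos pl by simp
      then have "p \<in> plane_partitions ?D"
        unfolding plane_partitions_outer_diagonals_iff[OF assms(1) E] diag_positions_interlacing_iff[OF assms(1)]
        using q(2) \<open>q = restrict p ?D'\<close> by simp
      then show "p \<in> fibre n k d l" using pl by (simp add: fibre_def)
    qed
  qed
qed

section \<open>Counting by removal of diagonals\<close>

lemma finite_listset_nat: "(\<And>R. R \<in> set Rs \<Longrightarrow> finite R) \<Longrightarrow> finite (listset Rs)"
proof (induction Rs)
  case (Cons R Rs)
  have "set_Cons R (listset Rs) = (\<lambda>(x, m). x # m) ` (R \<times> listset Rs)"
    by (auto simp: set_Cons_def)
  then show ?case using Cons by simp
qed simp

lemma card_fibre_Suc:
  assumes "k \<le> n" "strict_partition l" "length l = diag_len n k d"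
    and "\<And>m. strict_partition m \<Longrightarrow> length m = diag_len n k (Suc d) \<Longrightarrow>
      finite (fibre n k (Suc d) m) \<and> real (card (fibre n k (Suc d) m)) = f m"
  shows "finite (fibre n k d l) \<and> real (card (fibre n k d l)) =
    (if diag_len n k (Suc d) < diag_len n k d then gl_step 1 f l else sp_step 1 f l)"
proof -
  let ?U = "\<Union>m\<in>listset (interlacing_ranges n k d l). fibre n k (Suc d) m"
  have strict: "strict_partition m \<and> length m = diag_len n k (Suc d)" if "m \<in> listset (interlacing_ranges n k d l)" for m
    using that gl_ranges_strict[OF assms(2), of m] sp_ranges_strict[OF assms(2), of m] assms(3)
      diag_len_Suc[OF assms(1), of d] by (auto simp: interlacing_ranges_def split: if_splits)
  have fin: "finite (listset (interlacing_ranges n k d l))"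
    by (intro finite_listset_nat) (auto simp: interlacing_ranges_def gl_ranges_def sp_ranges_def split: if_splits)
  have finU: "finite ?U" using fin strict assms(4) by blast
  have "real (card ?U) = (\<Sum>m\<in>listset (interlacing_ranges n k d l). real (card (fibre n k (Suc d) m)))"
    using fin strict assms(4) by (subst card_UN_disjoint) (auto simp: fibre_def)
  also have "\<dots> = (\<Sum>m\<in>listset (interlacing_ranges n k d l). f m)"
    using strict assms(4) by (intro sum.cong) auto
  finally have "real (card ?U) = (if diag_len n k (Suc d) < diag_len n k d then gl_step 1 f l else sp_step 1 f l)"
    by (simp add: gl_step_def sp_step_def interlacing_ranges_def)
  then show ?thesis
    using bij_betw_finite[OF bij_betw_fibre[OF assms(1-3)]] bij_betw_same_card[OF bij_betw_fibre[OF assms(1-3)]] finU by simp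
qed

text \<open>Coming from outside, \<open>n + k - 2 * r\<close> is the second diagonal of length
  \<open>r\<close> when \<open>r > 0\<close>; one unit of \<open>r\<close> thus covers two
  diagonals, a longer one and then one of equal length.\<close>

lemma card_fibre_sp:
  assumes "k \<le> n" "r \<le> k" "strict_partition l" "length l = r"
  shows "finite (fibre n k (n + k - 2 * r) l) \<and> real (card (fibre n k (n + k - 2 * r) l)) = sp_weight (\<lambda>_. 1) r l"
  using assms(2-)
proof (induction r arbitrary: l)
  case 0
  have "outer_diagonals n k (n + k) = {}"
    using assms(1) by (auto simp: outer_diagonals_def diag_len_def split: if_splits)
  moreover have "diag_len n k (n + k) = 0"
    using assms(1) by (auto simp: diag_len_def)
  \<comment> \<open>The empty shape has exactly one extensional filling, matching the initial value
    1 of \<open>sp_weight\<close>.\<close>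
  ultimately have "fibre n k (n + k) l = {\<lambda>_. undefined}"
    using 0 by (auto simp: fibre_def plane_partitions_def diag_positions_def)
  then show ?case by simp
next
  case (Suc r)
  define d where "d = n + k - 2 * Suc r"
  have d: "n + k - 2 * r = Suc (Suc d)" using Suc.prems assms(1) by (simp add: d_def)
  have len: "diag_len n k d = Suc r" "diag_len n k (Suc d) = Suc r" "diag_len n k (Suc (Suc d)) = r"
    using Suc.prems assms(1) by (auto simp: diag_len_def d_def)
  have "finite (fibre n k (Suc d) m) \<and> real (card (fibre n k (Suc d) m)) = gl_step 1 (sp_weight (\<lambda>_. 1) r) m"
    if "strict_partition m" "length m = diag_len n k (Suc d)" for m
    using card_fibre_Suc[OF assms(1) that, of "sp_weight (\<lambda>_. 1) r"] Suc.IH Suc.prems len unfolding d by simp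
  then show ?case
    using card_fibre_Suc[OF assms(1) Suc.prems(2), of d "gl_step 1 (sp_weight (\<lambda>_. 1) r)"] Suc.prems len
    unfolding d_def[symmetric] by simp
qed

lemma card_fibre_gl:
  assumes "k \<le> n" "d \<le> n - k" "strict_partition l" "length l = k + d"
  shows "finite (fibre n k (n - k - d) l) \<and> real (card (fibre n k (n - k - d) l)) = gl_weight (\<lambda>_. 1) k d l"
  using assms(2-)
proof (induction d arbitrary: l)
  case 0
  have "n + k - 2 * k = n - k" using assms(1) by simp
  then show ?case using card_fibre_sp[OF assms(1), of k l] 0 by simp
next
  case (Suc d)
  define c where "c = n - k - Suc d"
  have c: "n - k - d = Suc c" using Suc.prems by (simp add: c_def)
  have len: "diag_len n k c = k + Suc d" "diag_len n k (Suc c) = k + d"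
    using Suc.prems assms(1) by (auto simp: diag_len_def c_def)
  show ?case
    using card_fibre_Suc[OF assms(1) Suc.prems(2), of c "gl_weight (\<lambda>_. 1) k d"] Suc.IH Suc.prems len
    unfolding c_def[symmetric] c by simp
qed

text \<open>The bound on all entries is a bound on the corner box alone, whose position is its entry
  plus \<open>n\<close>; hence the range up to \<open>m + n\<close>.\<close>

lemma card_SPP:
  assumes "k \<le> n"
  shows "real (card (SPP m (shifted_double_staircase n k))) =
    (\<Sum>l\<in>decreasing n (m + n). gl_weight (\<lambda>_. 1) k (n - k) l)"
proof -
  let ?D = "outer_diagonals n k 0"
  have len0: "diag_len n k 0 = n" by (simp add: diag_len_def)
  have strict: "strict_partition l \<and> length l = n" if "l \<in> decreasing n (m + n)" for l
    using that by (auto simp: decreasing_def strict_partition_def)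
  have "SPP m (shifted_double_staircase n k) = {p \<in> plane_partitions ?D. \<forall>b\<in>?D. p b \<le> m}"
    unfolding SPP_def shifted_plane_partitions_def shifted_diagram_eq_outer_diagonals[OF assms] plane_partitions_def ..
  also have "\<dots> = (\<Union>l\<in>decreasing n (m + n). fibre n k 0 l)"
  proof (intro set_eqI iffI)
    fix p assume "p \<in> {p \<in> plane_partitions ?D. \<forall>b\<in>?D. p b \<le> m}"
    then have p: "p \<in> plane_partitions ?D" "\<And>b. b \<in> ?D \<Longrightarrow> p b \<le> m" by auto
    have "p \<in> ?D \<rightarrow>\<^sub>E UNIV" using p(1) by (auto simp: plane_partitions_def)
    note iff = plane_partitions_outer_diagonals_iff[OF assms this]
    have step: "p (Suc (Suc i), Suc (Suc i)) \<le> p (Suc i, Suc i)" if "Suc i < n" for i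
    proof -
      have "Suc i \<le> diag_len n k (Suc 0)"
        using diag_len_Suc(2)[OF assms, of 0] that len0 by simp
      then have "p (Suc i, Suc i + Suc 0) \<le> p (Suc i, Suc i + 0)"
        using iff p(1) by (metis One_nat_def Suc_le_mono le0)
      moreover have "p (Suc (Suc i), Suc (Suc i) + 0) \<le> p (Suc i, Suc i + Suc 0)"
        using iff p(1) that len0 by (metis One_nat_def Suc_le_mono Suc_leI le0)
      ultimately show ?thesis by simp
    qed
    define l where "l = diag_positions n k 0 p"
    have l: "length l = n" "\<And>i. i < n \<Longrightarrow> l ! i = p (Suc i, Suc i) + (n - i)"
      by (simp_all add: l_def diag_positions_def len0)
    have "sorted_wrt (>) l"
      unfolding sorted_wrt_iff_nth_Suc_transp[OF transp_on_greater] l(1)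
    proof (intro allI impI)
      fix i assume i: "Suc i < n"
      then have "p (Suc (Suc i), Suc (Suc i)) + (n - Suc i) < p (Suc i, Suc i) + (n - i)"
        using step by (intro add_le_less_mono) auto
      then show "l ! i > l ! Suc i" using l i by simp
    qed
    moreover have "set l \<subseteq> {1..m + n}"
    proof
      fix x assume "x \<in> set l"
      then obtain i where i: "i < n" "x = p (Suc i, Suc i) + (n - i)"
        using l by (auto simp: in_set_conv_nth)
      moreover have "p (Suc i, Suc i) \<le> m" using i by (intro p) (auto simp: outer_diagonals_def len0)
      ultimately show "x \<in> {1..m + n}" by auto
    qed
    ultimately have "l \<in> decreasing n (m + n)" using l by (simp add: decreasing_def)
    then show "p \<in> (\<Union>l\<in>decreasing n (m + n). fibre n k 0 l)"
      using p(1) by (auto simp: fibre_def l_def)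
  next
    fix p assume "p \<in> (\<Union>l\<in>decreasing n (m + n). fibre n k 0 l)"
    then obtain l where l: "l \<in> decreasing n (m + n)" "diag_positions n k 0 p = l" "p \<in> plane_partitions ?D"
      by (auto simp: fibre_def)
    have "p (i, j) \<le> m" if ij: "(i, j) \<in> ?D" for i j
    proof -
      have i: "1 \<le> i" "i \<le> j" "i \<le> diag_len n k (j - i)" using ij by (auto simp: outer_diagonals_def)
      \<comment> \<open>Moving up \<open>i - 1\<close> rows in column \<open>j\<close> crosses as
        many diagonals, each costing at most one unit of length; so column \<open>j\<close> reaches
        row 1 inside the shape.\<close>
      then have "i \<le> diag_len n k (j - 1) + (i - 1)"
        using diag_len_add[OF assms, of "j - i" "i - 1"] by simp
      then have "(1, j) \<in> ?D" using i by (auto simp: outer_diagonals_def)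
      then have "p (i, j) \<le> p (1, j)" using l(3) ij i unfolding plane_partitions_def by blast
      moreover have n: "n > 0"
        using i diag_len_antimono[OF assms, of 0 "j - i"] len0 by simp
      have "(1, 1) \<in> ?D" using n by (auto simp: outer_diagonals_def len0)
      then have "p (1, j) \<le> p (1, 1)" using l(3) \<open>(1, j) \<in> ?D\<close> i unfolding plane_partitions_def by auto
      moreover have "p (1, 1) + n \<in> set l"
        unfolding l(2)[symmetric] diag_positions_def len0 using n by (force simp: image_iff)
      then have "p (1, 1) + n \<le> m + n" using l(1) by (auto simp: decreasing_def)
      ultimately show ?thesis by simp
    qed
    then show "p \<in> {p \<in> plane_partitions ?D. \<forall>b\<in>?D. p b \<le> m}" using l(3) by auto
  qed
  finally have "real (card (SPP m (shifted_double_staircase n k))) =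
      (\<Sum>l\<in>decreasing n (m + n). real (card (fibre n k 0 l)))"
    using card_fibre_gl[OF assms order_refl] strict assms
    by (simp, subst card_UN_disjoint) (auto simp: fibre_def)
  also have "\<dots> = (\<Sum>l\<in>decreasing n (m + n). gl_weight (\<lambda>_. 1) k (n - k) l)"
    using card_fibre_gl[OF assms order_refl] strict assms by (intro sum.cong) auto
  finally show ?thesis .
qed

text \<open>The normalization: dividing by the case \<open>m = 0\<close> does not change the
  count.\<close>

lemma card_SPP_0: "card (SPP 0 lam) = 1"
proof -
  have "SPP 0 lam = {\<lambda>b\<in>shifted_diagram lam. 0}"
    by (auto simp: SPP_def shifted_plane_partitions_def PiE_def extensional_def fun_eq_iff)
  then show ?thesis by simp
qed

subsection \<open>The product formula\<close>

lemma gl_weight_total_sinh: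
  assumes "k \<le> n" "t > 0"
  shows "\<exists>C. \<forall>m. (\<Sum>l\<in>decreasing n (m + n). gl_weight (\<lambda>i. exp (2 * real (Suc i) * t)) k (n - k) l) =
    C * sinh_sum n (real m + 2 * real n - 1) t * sinh_sum k (- (real m + 2)) t"
proof -
  define z where "z i = exp (2 * real (Suc i) * t)" for i
  have "inj_on z {..<n}" "\<And>i. z i > 1"
    using assms(2) by (auto simp: inj_on_def z_def)
  then obtain C where C: "\<And>m. (\<Sum>l\<in>decreasing n (m + n). gl_weight z k (n - k) l) =
      C * box_sum {..<n} (m + n) z * flip_sum {..<k} (\<lambda>i. 1 / z i ^ (m + 2)) z"
    using gl_weight_total[OF assms(1)] by blast
  have "box_sum {..<n} (m + n) z = sinh_sum n (real m + 2 * real n - 1) t" for m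
    unfolding sinh_sum_def
  proof (intro flip_sum_cong)
    fix i assume "i \<in> {..<n}"
    then have "real (m + n + card {..<n} - 1) = real m + 2 * real n - 1"
      by (simp add: of_nat_diff)
    then show "z i ^ (m + n + card {..<n} - 1) = exp (2 * real (Suc i) * t * (real m + 2 * real n - 1))"
      unfolding z_def exp_of_nat_mult[symmetric] by (simp add: mult_ac)
  qed (simp add: z_def)
  moreover have "flip_sum {..<k} (\<lambda>i. 1 / z i ^ (m + 2)) z = sinh_sum k (- (real m + 2)) t" for m
    unfolding sinh_sum_def
  proof (intro flip_sum_cong)
    fix i
    have "1 / z i ^ (m + 2) = exp (- (real (m + 2) * (2 * real (Suc i) * t)))"
      unfolding z_def exp_of_nat_mult[symmetric] by (simp only: exp_minus inverse_eq_divide)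
    also have "- (real (m + 2) * (2 * real (Suc i) * t)) = 2 * real (Suc i) * t * (- (real m + 2))"
      by (simp add: algebra_simps)
    finally show "1 / z i ^ (m + 2) = exp (2 * real (Suc i) * t * (- (real m + 2)))" .
  qed (simp add: z_def)
  ultimately show ?thesis
    using C unfolding z_def by auto
qed

theorem theorem1p1:
  fixes n k m :: nat
  assumes "k \<le> n"
  shows "real (card (SPP m (shifted_double_staircase n k))) =
    (\<Prod>i = 1..n. \<Prod>j = i..n. (real m + real i + real j - 1) / (real i + real j - 1)) *
    (\<Prod>i = 1..k. \<Prod>j = i..k. (real m + real i + real j) / (real i + real j))"
proof -
  define N where "N m = real (card (SPP m (shifted_double_staircase n k)))" for m
  define z where "z t i = exp (2 * real (Suc i) * t)" for t i
  define F where "F m t = (\<Sum>l\<in>decreasing n (m + n). gl_weight (z t) k (n - k) l)" for m t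
  define e where "e m = real m + 2 * real n - 1" for m
  define e' where "e' m = - (real m + 2)" for m
  define p q where "p a = real (n - Suc a)" and "q a = real (k - Suc a)" for a
  have "((\<lambda>t. z t i) \<longlongrightarrow> 1) (at_right 0)" for i
    unfolding z_def by (auto intro!: tendsto_eq_intros)
  then have F: "((\<lambda>t. F m t) \<longlongrightarrow> N m) (at_right 0)" for m
    unfolding F_def N_def card_SPP[OF assms] by (intro tendsto_sum gl_weight_tendsto)
  have N0: "N 0 = 1"
    by (simp add: N_def card_SPP_0)
  \<comment> \<open>The sums are at most \<open>2 * n - 2\<close>, one below \<open>e 0\<close>, so
    no factor vanishes for any \<open>m\<close>.\<close>
  have e: "\<forall>i<n. \<forall>j<n. real i + real j \<noteq> e m" for m
  proof (intro allI impI)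
    fix i j assume "i < n" "j < n"
    then have "real i + 1 \<le> real n" "real j + 1 \<le> real n"
      by linarith+
    then show "real i + real j \<noteq> e m" unfolding e_def by linarith
  qed
  have e': "\<forall>i<k. \<forall>j<k. real i + real j \<noteq> e' m" for m
    unfolding e'_def by (auto simp: add_eq_0_iff)
  have "((\<lambda>t. F m t / F 0 t) \<longlongrightarrow> N m / N 0) (at_right 0)"
    using N0 by (intro tendsto_divide F) simp
  moreover have "\<forall>\<^sub>F t in at_right 0. F m t / F 0 t =
      (sinh_sum n (e m) t / sinh_sum n (e 0) t) * (sinh_sum k (e' m) t / sinh_sum k (e' 0) t)"
  proof -
    \<comment> \<open>Since \<open>F 0 t\<close> tends to 1, the unknown constant is nonzero for
      small \<open>t\<close> and cancels in the quotient.\<close>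
    have "\<forall>\<^sub>F t in at_right 0. F 0 t \<noteq> 0"
      using tendsto_imp_eventually_ne[OF F[of 0], of 0] N0 by simp
    moreover have "\<forall>\<^sub>F t :: real in at_right 0. 0 < t"
      by (rule eventually_at_right_less)
    ultimately show ?thesis
    proof eventually_elim
      case (elim t)
      obtain C where "\<And>m. F m t = C * sinh_sum n (e m) t * sinh_sum k (e' m) t"
        using gl_weight_total_sinh[OF assms elim(2)] unfolding F_def z_def e_def e'_def by auto
      then show ?case using elim(1) by auto
    qed
  qed
  ultimately have "((\<lambda>t. (sinh_sum n (e m) t / sinh_sum n (e 0) t) * (sinh_sum k (e' m) t / sinh_sum k (e' 0) t))
      \<longlongrightarrow> N m / N 0) (at_right 0)"
    by (rule Lim_transform_eventually)
  moreover have "((\<lambda>t. (sinh_sum n (e m) t / sinh_sum n (e 0) t) * (sinh_sum k (e' m) t / sinh_sum k (e' 0) t))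
      \<longlongrightarrow> (\<Prod>a<n. \<Prod>b\<in>{a..<n}. (p a + p b - e m) / (p a + p b - e 0)) *
        (\<Prod>a<k. \<Prod>b\<in>{a..<k}. (q a + q b - e' m) / (q a + q b - e' 0))) (at_right 0)"
    unfolding p_def q_def by (intro tendsto_mult sinh_sum_ratio_tendsto e e')
  ultimately have "N m / N 0 = (\<Prod>a<n. \<Prod>b\<in>{a..<n}. (p a + p b - e m) / (p a + p b - e 0)) *
        (\<Prod>a<k. \<Prod>b\<in>{a..<k}. (q a + q b - e' m) / (q a + q b - e' 0))"
    by (intro tendsto_unique[of "at_right (0 :: real)"]) auto
  also have "(\<Prod>a<n. \<Prod>b\<in>{a..<n}. (p a + p b - e m) / (p a + p b - e 0)) =
      (\<Prod>i = 1..n. \<Prod>j = i..n. (real m + real i + real j - 1) / (real i + real j - 1))"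
  proof (rule prod.reindex_bij_witness[of _ "\<lambda>i. i - 1" Suc])
    fix a assume a: "a \<in> {..<n}"
    show "(\<Prod>j = Suc a..n. (real m + real (Suc a) + real j - 1) / (real (Suc a) + real j - 1)) =
        (\<Prod>b\<in>{a..<n}. (p a + p b - e m) / (p a + p b - e 0))"
    proof (rule prod.reindex_bij_witness[of _ Suc "\<lambda>j. j - 1"])
      fix j assume j: "j \<in> {Suc a..n}"
      \<comment> \<open>Numerator and denominator are both negative; the signs cancel in the
        quotient.\<close>
      have "p a + p (j - 1) - e m = - (real m + real (Suc a) + real j - 1)" for m
        using a j by (simp add: p_def e_def of_nat_diff)
      from this[of m] this[of 0]
      show "(p a + p (j - 1) - e m) / (p a + p (j - 1) - e 0) = (real m + real (Suc a) + real j - 1) / (real (Suc a) + real j - 1)"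
        by (simp only: minus_divide_divide of_nat_0 add_0)
    qed auto
  qed auto
  also have "(\<Prod>a<k. \<Prod>b\<in>{a..<k}. (q a + q b - e' m) / (q a + q b - e' 0)) =
      (\<Prod>i = 1..k. \<Prod>j = i..k. (real m + real i + real j) / (real i + real j))"
  proof -
    have "(\<Prod>a<k. \<Prod>b\<in>{a..<k}. (q a + q b - e' m) / (q a + q b - e' 0)) =
        (\<Prod>(a, b)\<in>(SIGMA a:{..<k}. {a..<k}). (q a + q b - e' m) / (q a + q b - e' 0))"
      by (intro prod.Sigma) auto
    also have "\<dots> = (\<Prod>(i, j)\<in>(SIGMA i:{1..k}. {i..k}). (real m + real i + real j) / (real i + real j))"
      \<comment> \<open>Here \<open>q\<close> counts down, so \<open>a\<close> and \<open>b\<close>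
        turn into \<open>k - a\<close> and \<open>k - b\<close>; exchanging the two keeps
        \<open>i \<le> j\<close>.\<close>
      by (rule prod.reindex_bij_witness[of _ "\<lambda>(i, j). (k - j, k - i)" "\<lambda>(a, b). (k - b, k - a)"])
        (auto simp: q_def e'_def of_nat_diff algebra_simps)
    also have "\<dots> = (\<Prod>i = 1..k. \<Prod>j = i..k. (real m + real i + real j) / (real i + real j))"
      by (intro prod.Sigma[symmetric]) auto
    finally show ?thesis .
  qed
  finally show ?thesis
    using N0 by (simp add: N_def)
qed

end
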